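(* For all integers $\mu,k,t,p,l$ with $k<t$, $t+k\le p$ and $p\le l$, there exists a classical $(p,t,0,0)$ threshold secret sharing scheme for $l$-bit messages with shares of $l+\mu+o(l+\mu)$ bits, which is perfectly correct and perfectly private and is $p\cdot2^{-\tilde\Omega((\frac{l+\mu}{p})^{1/3})}$-leakage-resilient against the quantum $k$-local leakage family $\mathcal F^{p,t}_{k,\mu}$.
   Context: A classical $(p,t,\varepsilon_{priv},\varepsilon_c)$ secret sharing scheme: randomized $\mathrm{Share}:\{0,1\}^l\to(\{0,1\}^{l'})^p$ and reconstruction from any $T$ with $|T|\ge t$ failing with probability $\le\varepsilon_c$, while any $\le t-1$ shares of two messages are within statistical distance $\varepsilon_{priv}$. The family $\mathcal F^{p,t}_{k,\mu}$ consists of triples $(T,K,\Lambda)$ with $T,K\subseteq[p]$, $|T|<t$, $|K|\le k$, and $\Lambda$ a channel mapping $\{0,1\}^{l'|K|}$ to density matrices on $\mu$ qubits; a leakage query on message $m$ returns the state $(\mathrm{id}_T\otimes\Lambda_K)(\mathrm{Share}(m)_{T\cup K})$, i.e. the shares in $T$ together with the $\mu$-qubit state $\Lambda$ applied jointly to the shares in $K$. The scheme is $\varepsilon$-leakage-resilient against the family if for every query and every $m_0,m_1$ the resulting states are within trace distance $\varepsilon$. $\tilde\Omega$ hides polylogarithmic factors. *)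

theory Defs
  imports "Jordan_Normal_Form.Schur_Decomposition"
          "HOL-Probability.Probability_Mass_Function"
          "HOL-Library.Landau_Symbols"
begin

text \<open>A share vector is a function nat => bool list; party i (i < p) holds s i.
  proj T s keeps exactly the shares of the parties in T.\<close>
definition proj :: "nat set \<Rightarrow> (nat \<Rightarrow> bool list) \<Rightarrow> (nat \<Rightarrow> bool list)" where
  "proj T s = (\<lambda>i. if i \<in> T then s i else [])"

definition psd_mat :: "nat \<Rightarrow> complex mat \<Rightarrow> bool" where
  "psd_mat d A \<longleftrightarrow> A \<in> carrier_mat d d \<and>
     (\<forall>v \<in> carrier_vec d. Im (conjugate v \<bullet> (A *\<^sub>v v)) = 0 \<and> Re (conjugate v \<bullet> (A *\<^sub>v v)) \<ge> 0)"

definition density_mat :: "nat \<Rightarrow> complex mat \<Rightarrow> bool" where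
  "density_mat d A \<longleftrightarrow> psd_mat d A \<and> (\<Sum>i<d. A $$ (i,i)) = 1"

definition trace_norm :: "complex mat \<Rightarrow> real" where
  "trace_norm A = (let q = char_poly (mat_adjoint A * A) in
     (\<Sum>a | poly q a = 0. real (order a q) * sqrt (cmod a)))"

text \<open>Classical-quantum state (id_T \<otimes> Lambda_K)(Share(m)_{T \<union> K}), represented as
  its blocks: the (subnormalised) mu-qubit operator attached to each value c of the
  classical register holding the shares in T.\<close>
definition cq_block :: "nat \<Rightarrow> (nat \<Rightarrow> bool list) pmf \<Rightarrow> nat set \<Rightarrow> nat set
    \<Rightarrow> ((nat \<Rightarrow> bool list) \<Rightarrow> complex mat) \<Rightarrow> (nat \<Rightarrow> bool list) \<Rightarrow> complex mat" where
  "cq_block d D T K Lam c = Matrix.mat d d (\<lambda>(i,j).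
     \<Sum>s \<in> {s \<in> set_pmf D. proj T s = c}. complex_of_real (pmf D s) * (Lam (proj K s) $$ (i,j)))"

text \<open>Trace distance of two cq states (block diagonal: half the sum of the trace
  norms of the block differences; blocks outside the supports vanish).\<close>
definition cq_trace_dist :: "nat \<Rightarrow> (nat \<Rightarrow> bool list) pmf \<Rightarrow> (nat \<Rightarrow> bool list) pmf \<Rightarrow> nat set
    \<Rightarrow> nat set \<Rightarrow> ((nat \<Rightarrow> bool list) \<Rightarrow> complex mat) \<Rightarrow> real" where
  "cq_trace_dist d D0 D1 T K Lam = (1/2) *
     (\<Sum>c \<in> proj T ` (set_pmf D0 \<union> set_pmf D1).
        trace_norm (cq_block d D0 T K Lam c - cq_block d D1 T K Lam c))"

definition share_wf :: "nat \<Rightarrow> nat \<Rightarrow> nat \<Rightarrow> (bool list \<Rightarrow> (nat \<Rightarrow> bool list) pmf) \<Rightarrow> bool" where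
  "share_wf p l l' Share \<longleftrightarrow> (\<forall>m. length m = l \<longrightarrow> (\<forall>s \<in> set_pmf (Share m).
      (\<forall>i < p. length (s i) = l') \<and> (\<forall>i. p \<le> i \<longrightarrow> s i = [])))"

definition perfectly_correct :: "nat \<Rightarrow> nat \<Rightarrow> nat \<Rightarrow> (bool list \<Rightarrow> (nat \<Rightarrow> bool list) pmf)
    \<Rightarrow> (nat set \<Rightarrow> (nat \<Rightarrow> bool list) \<Rightarrow> bool list) \<Rightarrow> bool" where
  "perfectly_correct p t l Share Rec \<longleftrightarrow> (\<forall>m T. length m = l \<longrightarrow> T \<subseteq> {..<p} \<longrightarrow> t \<le> card T \<longrightarrow>
      measure_pmf.prob (Share m) {s. Rec T (proj T s) = m} = 1)"

definition perfectly_private :: "nat \<Rightarrow> nat \<Rightarrow> nat \<Rightarrow> (bool list \<Rightarrow> (nat \<Rightarrow> bool list) pmf) \<Rightarrow> bool" where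
  "perfectly_private p t l Share \<longleftrightarrow> (\<forall>m0 m1 T. length m0 = l \<longrightarrow> length m1 = l \<longrightarrow>
      T \<subseteq> {..<p} \<longrightarrow> card T < t \<longrightarrow> map_pmf (proj T) (Share m0) = map_pmf (proj T) (Share m1))"

text \<open>eps-leakage resilience against the quantum k-local family F^{p,t}_{k,mu}:
  Lam is a classical-to-quantum channel from the shares in K to mu-qubit states.\<close>
definition leakage_resilient :: "nat \<Rightarrow> nat \<Rightarrow> nat \<Rightarrow> nat \<Rightarrow> nat \<Rightarrow> (bool list \<Rightarrow> (nat \<Rightarrow> bool list) pmf)
    \<Rightarrow> real \<Rightarrow> bool" where
  "leakage_resilient p t k mu l Share eps \<longleftrightarrow>
     (\<forall>T K Lam m0 m1. T \<subseteq> {..<p} \<longrightarrow> K \<subseteq> {..<p} \<longrightarrow> card T < t \<longrightarrow> card K \<le> k \<longrightarrow>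
        (\<forall>x. density_mat (2 ^ mu) (Lam x)) \<longrightarrow> length m0 = l \<longrightarrow> length m1 = l \<longrightarrow>
        cq_trace_dist (2 ^ mu) (Share m0) (Share m1) T K Lam \<le> eps)"

end

theory Submission
  imports "HOL-Computational_Algebra.Fundamental_Theorem_Algebra"
    "HOL-Algebra.Algebraic_Closure_Type" "HOL-Library.Z2" "HOL-Real_Asymp.Real_Asymp" Defs
begin

text \<open>
  Shares: the message is Shamir-shared into values \<open>y\<^sub>i\<close>, an extractor seed \<open>s\<close> is Shamir-shared
  into \<open>\<sigma>\<^sub>i\<close>, and party \<open>i\<close> gets \<open>w\<^sub>i @ \<sigma>\<^sub>i\<close> with \<open>w\<^sub>i\<close> uniform in the fibre over \<open>y\<^sub>i\<close> of the
  extractor with seed \<open>s\<close>; all fibres have the same size. Joint leakage from \<open>K\<close> is independent of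
  \<open>s\<close>, since \<open>K\<close> has fewer than \<open>t\<close> parties. As any \<open>t - 1\<close> of the \<open>y\<^sub>i\<close> are jointly uniform, the
  \<open>y\<^sub>i\<close> of \<open>K - T\<close> are uniform on average over the shares of \<open>T\<close>, so the extractor may replace the
  \<open>w\<^sub>i\<close> of \<open>K - T\<close>, one at a time, by uniform words, after which the state no longer depends on the
  message.

  The extractor is Trevisan's, with seed length \<open>o(l + \<mu>)\<close>. One output bit is a position of a
  small-bias code. Against a side register of dimension \<open>d\<close> and \<open>G\<close> classical values its bias is
  at most the square root of \<open>2 (G d / N + \<delta>)\<close>, \<open>N\<close> being the number of words and \<open>\<delta>\<close> the bias of
  the code: bound the trace norm by a Hilbert-Schmidt norm weighted with the average state. The
  earlier output bits are the classical side information, kept small by a weak design. Everything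
  is phrased with traces against families of contractions, which makes hybrid arguments linear; a
  trace norm is attained by one contraction.
\<close>

section \<open>Matrices as functions\<close>

text \<open>Every share contains a share of the seed, which is as long as the seed itself, so the
  seed length has to be o(l + mu), while l bits are extracted from words of only l + mu + o(l + mu)
  bits beside mu qubits. Hence a weak design, whose overlaps multiply l only by a factor close to 1,
  and one seed for all parties. With n = l + mu and h about n^(1/6), a code position takes 2 h^2
  bits and a row of the design has 2 h^3 cells: the overlap factor is at most 1 + 2/h, the seed has
  4 h^5 bits, and the error is 2^(-h^2/2) up to polynomial factors, whence the exponent 1/3.

  Equal fibres are what makes privacy perfect: whatever the message, the words of t - 1 parties
  extend to the same number of share vectors. The difficulty in the leakage bound is that the words
  of T - K lie in fibres over values that depend on those of K. They never enter the leaked state,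
  so the test can be averaged over these fibres; the result is again a contraction, depending on the
  seed and the extracted values. Thus T becomes part of the distinguisher. This is why security is
  stated for tests that depend on both seed and output.\<close>

definition qform :: "nat \<Rightarrow> (nat \<Rightarrow> nat \<Rightarrow> complex) \<Rightarrow> (nat \<Rightarrow> complex) \<Rightarrow> complex" where
  "qform d A x = (\<Sum>i<d. \<Sum>j<d. cnj (x i) * A i j * x j)"

definition posf :: "nat \<Rightarrow> (nat \<Rightarrow> nat \<Rightarrow> complex) \<Rightarrow> bool" where
  "posf d A \<longleftrightarrow> (\<forall>x. Im (qform d A x) = 0 \<and> 0 \<le> Re (qform d A x))"

definition hermf :: "nat \<Rightarrow> (nat \<Rightarrow> nat \<Rightarrow> complex) \<Rightarrow> bool" where
  "hermf d A \<longleftrightarrow> (\<forall>i<d. \<forall>j<d. A j i = cnj (A i j))"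

definition densf :: "nat \<Rightarrow> (nat \<Rightarrow> nat \<Rightarrow> complex) \<Rightarrow> bool" where
  "densf d A \<longleftrightarrow> posf d A \<and> (\<Sum>i<d. A i i) = 1"

definition trpair :: "nat \<Rightarrow> (nat \<Rightarrow> nat \<Rightarrow> complex) \<Rightarrow> (nat \<Rightarrow> nat \<Rightarrow> complex) \<Rightarrow> complex" where
  "trpair d V A = (\<Sum>i<d. \<Sum>j<d. V i j * A j i)"

text \<open>Operator norm at most 1. The form is bilinear instead of sesquilinear, which describes
  the same matrices because conjugating \<open>x\<close> keeps its norm, and it makes closure under
  transposition immediate.\<close>

definition contractions :: "nat \<Rightarrow> (nat \<Rightarrow> nat \<Rightarrow> complex) set" where
  "contractions d = {V. \<forall>x y. cmod (\<Sum>i<d. \<Sum>j<d. x i * V i j * y j)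
      \<le> L2_set (\<lambda>i. cmod (x i)) {..<d} * L2_set (\<lambda>i. cmod (y i)) {..<d}}"

definition unitaryf :: "nat \<Rightarrow> (nat \<Rightarrow> nat \<Rightarrow> complex) \<Rightarrow> bool" where
  "unitaryf d u \<longleftrightarrow>
     (\<forall>k<d. \<forall>l<d. (\<Sum>i<d. cnj (u i k) * u i l) = (if k = l then 1 else 0)) \<and>
     (\<forall>i<d. \<forall>j<d. (\<Sum>k<d. u i k * cnj (u j k)) = (if i = j then 1 else 0))"

text \<open>The conjugate u* A u, that is \<open>A\<close> written in the orthonormal basis formed
  by the columns of \<open>u\<close>.\<close>

definition rotf :: "nat \<Rightarrow> (nat \<Rightarrow> nat \<Rightarrow> complex) \<Rightarrow> (nat \<Rightarrow> nat \<Rightarrow> complex) \<Rightarrow> nat \<Rightarrow> nat \<Rightarrow> complex" where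
  "rotf d u A i j = (\<Sum>k<d. \<Sum>l<d. cnj (u k i) * A k l * u l j)"

lemma contractionsD:
  "V \<in> contractions d \<Longrightarrow> cmod (\<Sum>i<d. \<Sum>j<d. x i * V i j * y j)
      \<le> L2_set (\<lambda>i. cmod (x i)) {..<d} * L2_set (\<lambda>i. cmod (y i)) {..<d}"
  by (simp add: contractions_def)

lemma sum_delta_left:
  fixes f :: "nat \<Rightarrow> complex"
  assumes "i < d"
  shows "(\<Sum>j<d. (if i = j then 1 else 0) * f j) = f i"
        "(\<Sum>j<d. (if j = i then 1 else 0) * f j) = f i"
        "(\<Sum>j<d. f j * (if i = j then 1 else 0)) = f i"
        "(\<Sum>j<d. f j * (if j = i then 1 else 0)) = f i"
  using assms by (auto simp: if_distrib if_distribR sum.delta cong: if_cong)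

lemma sum3_swap:
  "(\<Sum>i\<in>A. \<Sum>j\<in>B. \<Sum>k\<in>C. f i j k) = (\<Sum>j\<in>B. \<Sum>k\<in>C. \<Sum>i\<in>A. f i j k)"
proof -
  have "(\<Sum>i\<in>A. \<Sum>j\<in>B. \<Sum>k\<in>C. f i j k) = (\<Sum>j\<in>B. \<Sum>i\<in>A. \<Sum>k\<in>C. f i j k)" by (rule sum.swap)
  also have "\<dots> = (\<Sum>j\<in>B. \<Sum>k\<in>C. \<Sum>i\<in>A. f i j k)" by (rule sum.cong[OF refl sum.swap])
  finally show ?thesis .
qed

lemma sum4_swap:
  "(\<Sum>i\<in>A. \<Sum>j\<in>B. \<Sum>k\<in>C. \<Sum>l\<in>D. f i j k l) = (\<Sum>k\<in>C. \<Sum>l\<in>D. \<Sum>i\<in>A. \<Sum>j\<in>B. f i j k l)"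
proof -
  have "(\<Sum>i\<in>A. \<Sum>j\<in>B. \<Sum>k\<in>C. \<Sum>l\<in>D. f i j k l) = (\<Sum>i\<in>A. \<Sum>k\<in>C. \<Sum>l\<in>D. \<Sum>j\<in>B. f i j k l)"
    by (rule sum.cong[OF refl sum3_swap])
  also have "\<dots> = (\<Sum>k\<in>C. \<Sum>l\<in>D. \<Sum>i\<in>A. \<Sum>j\<in>B. f i j k l)" by (rule sum3_swap)
  finally show ?thesis .
qed

lemma sum_product_mid:
  fixes c :: "'a :: comm_semiring_0"
  shows "(\<Sum>k\<in>K. \<Sum>l\<in>L. f k * (c * g l)) = (\<Sum>k\<in>K. f k) * (c * (\<Sum>l\<in>L. g l))"
  by (simp only: sum_distrib_left[of c] sum_product)

lemma qform_two:
  assumes "i < d" "j < d" "i \<noteq> j"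
  shows "qform d A (\<lambda>k. if k = i then a else if k = j then b else 0)
    = cnj a * A i i * a + cnj a * A i j * b + cnj b * A j i * a + cnj b * A j j * b"
proof -
  have two: "(\<Sum>k<d. f k) = f i + f j" if "\<And>k. k \<noteq> i \<Longrightarrow> k \<noteq> j \<Longrightarrow> f k = 0" for f :: "nat \<Rightarrow> complex"
  proof -
    have "(\<Sum>k<d. f k) = (\<Sum>k\<in>{i,j}. f k)"
      using assms that by (intro sum.mono_neutral_right) auto
    then show ?thesis using assms by simp
  qed
  let ?v = "\<lambda>k. if k = i then a else if k = j then b else 0"
  have "qform d A ?v = (\<Sum>k<d. cnj (?v k) * (\<Sum>l<d. A k l * ?v l))"
    unfolding qform_def by (simp only: sum_distrib_left mult.assoc)
  also have "\<dots> = (\<Sum>k<d. cnj (?v k) * (A k i * a + A k j * b))"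
    by (subst two) (use assms in auto)
  also have "\<dots> = cnj a * (A i i * a + A i j * b) + cnj b * (A j i * a + A j j * b)"
    by (subst two) (use assms in auto)
  finally show ?thesis by (simp add: algebra_simps)
qed

lemma qform_unit:
  assumes "i < d"
  shows "qform d A (\<lambda>k. if k = i then 1 else 0) = A i i"
proof -
  have "qform d A (\<lambda>k. if k = i then 1 else 0) = (\<Sum>k<d. (if k = i then 1 else 0) * (\<Sum>j<d. A k j * (if j = i then 1 else 0)))"
    unfolding qform_def by (intro sum.cong refl) (auto simp: sum_distrib_left)
  then show ?thesis using assms by (simp only: sum_delta_left)
qed

lemma posf_diag:
  assumes "posf d A" "i < d"
  shows "Im (A i i) = 0" "0 \<le> Re (A i i)"
  using assms(1) unfolding posf_def qform_unit[OF assms(2), of A, symmetric] by auto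

text \<open>Polarisation: the form is real at the sum of two basis vectors, which settles the
  imaginary parts, and at the sum with the second one multiplied by the imaginary unit, which
  settles the real parts.\<close>

lemma posf_imp_hermf:
  assumes "posf d A" shows "hermf d A"
  unfolding hermf_def
proof (intro allI impI)
  fix i j assume ij: "i < d" "j < d"
  show "A j i = cnj (A i j)"
  proof (cases "i = j")
    case True
    then show ?thesis using posf_diag[OF assms ij(1)] by (simp add: complex_eq_iff)
  next
    case False
    have d: "Im (A i i) = 0" "Im (A j j) = 0" using posf_diag assms ij by auto
    have "Im (qform d A (\<lambda>k. if k = i then 1 else if k = j then 1 else 0)) = 0"
      using assms by (simp add: posf_def)
    moreover have "Im (qform d A (\<lambda>k. if k = i then 1 else if k = j then \<i> else 0)) = 0"
      using assms by (simp add: posf_def)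
    ultimately show ?thesis
      unfolding qform_two[OF ij False] using d by (simp add: complex_eq_iff)
  qed
qed

section \<open>Change of orthonormal basis\<close>

lemma unitaryfD:
  assumes "unitaryf d u"
  shows "k < d \<Longrightarrow> l < d \<Longrightarrow> (\<Sum>i<d. cnj (u i k) * u i l) = (if k = l then 1 else 0)"
        "k < d \<Longrightarrow> l < d \<Longrightarrow> (\<Sum>i<d. u i k * cnj (u i l)) = (if k = l then 1 else 0)"
        "i < d \<Longrightarrow> j < d \<Longrightarrow> (\<Sum>k<d. u i k * cnj (u j k)) = (if i = j then 1 else 0)"
        "i < d \<Longrightarrow> j < d \<Longrightarrow> (\<Sum>k<d. cnj (u i k) * u j k) = (if i = j then 1 else 0)"
proof -
  show a: "(\<Sum>i<d. cnj (u i k) * u i l) = (if k = l then 1 else 0)" if "k < d" "l < d" for k l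
    using that assms by (simp add: unitaryf_def)
  show b: "(\<Sum>k<d. u i k * cnj (u j k)) = (if i = j then 1 else 0)" if "i < d" "j < d" for i j
    using that assms by (simp add: unitaryf_def)
  show "(\<Sum>i<d. u i k * cnj (u i l)) = (if k = l then 1 else 0)" if "k < d" "l < d"
    using a[OF that(2,1)] by (auto simp: mult.commute split: if_splits)
  show "(\<Sum>k<d. cnj (u i k) * u j k) = (if i = j then 1 else 0)" if "i < d" "j < d"
    using b[OF that(2,1)] by (auto simp: mult.commute split: if_splits)
qed

lemma unitaryf_rotf_inverse:
  assumes u: "unitaryf d u" and "i < d" "j < d"
  shows "(\<Sum>k<d. \<Sum>l<d. u i k * rotf d u A k l * cnj (u j l)) = A i j"
proof -
  have "(\<Sum>k<d. \<Sum>l<d. u i k * rotf d u A k l * cnj (u j l))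
     = (\<Sum>k<d. \<Sum>l<d. \<Sum>k'<d. \<Sum>l'<d. (u i k * cnj (u k' k)) * (A k' l' * (u l' l * cnj (u j l))))"
    unfolding rotf_def by (simp add: sum_distrib_left sum_distrib_right mult_ac)
  also have "\<dots> = (\<Sum>k'<d. \<Sum>l'<d. \<Sum>k<d. \<Sum>l<d. (u i k * cnj (u k' k)) * (A k' l' * (u l' l * cnj (u j l))))"
    by (rule sum4_swap)
  also have "\<dots> = (\<Sum>k'<d. \<Sum>l'<d. (\<Sum>k<d. u i k * cnj (u k' k)) * (A k' l' * (\<Sum>l<d. u l' l * cnj (u j l))))"
    by (simp only: sum_product_mid)
  also have "\<dots> = (\<Sum>k'<d. \<Sum>l'<d. (if i = k' then 1 else 0) * (A k' l' * (if l' = j then 1 else 0)))"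
    using assms by (intro sum.cong refl arg_cong2[where f="(*)"]) (auto simp: unitaryfD(3)[OF u])
  also have "\<dots> = (\<Sum>k'<d. (if i = k' then 1 else 0) * (\<Sum>l'<d. A k' l' * (if l' = j then 1 else 0)))"
    by (simp only: sum_distrib_left)
  also have "\<dots> = A i j" using assms by (simp only: sum_delta_left)
  finally show ?thesis .
qed

lemma trpair_rotf:
  assumes u: "unitaryf d u"
  shows "trpair d (rotf d u V) (rotf d u A) = trpair d V A"
proof -
  have "trpair d V A = (\<Sum>i<d. \<Sum>j<d. V i j * (\<Sum>k<d. \<Sum>l<d. u j k * rotf d u A k l * cnj (u i l)))"
    unfolding trpair_def by (intro sum.cong refl) (simp add: unitaryf_rotf_inverse[OF u])
  also have "\<dots> = (\<Sum>i<d. \<Sum>j<d. \<Sum>k<d. \<Sum>l<d. (cnj (u i l) * V i j * u j k) * rotf d u A k l)"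
    by (simp add: sum_distrib_left mult_ac)
  also have "\<dots> = (\<Sum>k<d. \<Sum>l<d. \<Sum>i<d. \<Sum>j<d. (cnj (u i l) * V i j * u j k) * rotf d u A k l)"
    by (rule sum4_swap)
  also have "\<dots> = (\<Sum>l<d. \<Sum>k<d. \<Sum>i<d. \<Sum>j<d. (cnj (u i l) * V i j * u j k) * rotf d u A k l)"
    by (rule sum.swap)
  also have "\<dots> = trpair d (rotf d u V) (rotf d u A)"
    unfolding trpair_def by (intro sum.cong refl) (simp add: rotf_def[of d u V] sum_distrib_right)
  finally show ?thesis ..
qed

lemma bilinear_rotf:
  "(\<Sum>i<d. \<Sum>j<d. x i * rotf d u A i j * y j) = (\<Sum>k<d. \<Sum>l<d. (\<Sum>i<d. cnj (u k i) * x i) * A k l * (\<Sum>j<d. u l j * y j))"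
proof -
  have "(\<Sum>i<d. \<Sum>j<d. x i * rotf d u A i j * y j) = (\<Sum>i<d. \<Sum>j<d. \<Sum>k<d. \<Sum>l<d. (cnj (u k i) * x i) * A k l * (u l j * y j))"
    unfolding rotf_def by (simp add: sum_distrib_left sum_distrib_right mult_ac)
  also have "\<dots> = (\<Sum>k<d. \<Sum>l<d. \<Sum>i<d. \<Sum>j<d. (cnj (u k i) * x i) * A k l * (u l j * y j))"
    by (rule sum4_swap)
  also have "\<dots> = (\<Sum>k<d. \<Sum>l<d. (\<Sum>i<d. cnj (u k i) * x i) * A k l * (\<Sum>j<d. u l j * y j))"
    by (simp add: sum_distrib_left sum_distrib_right mult_ac)
  finally show ?thesis .
qed

lemma qform_rotf: "qform d (rotf d u A) x = qform d A (\<lambda>k. \<Sum>i<d. u k i * x i)"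
  unfolding qform_def bilinear_rotf by simp

lemma posf_rotf: "posf d A \<Longrightarrow> posf d (rotf d u A)"
  by (simp add: posf_def qform_rotf)

lemma hermf_rotf: "hermf d A \<Longrightarrow> hermf d (rotf d u A)"
  unfolding hermf_def
proof (intro allI impI)
  fix i j assume A: "\<forall>i<d. \<forall>j<d. A j i = cnj (A i j)"
  have kl: "A k l = cnj (A l k)" if "k < d" "l < d" for k l using A that by blast
  have "rotf d u A j i = (\<Sum>l<d. \<Sum>k<d. cnj (u k j) * A k l * u l i)"
    unfolding rotf_def by (rule sum.swap)
  also have "\<dots> = (\<Sum>l<d. \<Sum>k<d. u l i * cnj (A l k) * cnj (u k j))"
    by (intro sum.cong refl, subst kl) (auto simp: mult_ac)
  also have "\<dots> = cnj (rotf d u A i j)" unfolding rotf_def by simp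
  finally show "rotf d u A j i = cnj (rotf d u A i j)" .
qed

lemma trace_rotf:
  assumes u: "unitaryf d u"
  shows "(\<Sum>i<d. rotf d u A i i) = (\<Sum>i<d. A i i)"
proof -
  have "(\<Sum>i<d. rotf d u A i i) = (\<Sum>i<d. \<Sum>k<d. \<Sum>l<d. A k l * (cnj (u k i) * u l i))"
    unfolding rotf_def by (simp add: mult_ac)
  also have "\<dots> = (\<Sum>k<d. \<Sum>l<d. \<Sum>i<d. A k l * (cnj (u k i) * u l i))"
    by (rule sum3_swap)
  also have "\<dots> = (\<Sum>k<d. \<Sum>l<d. A k l * (if k = l then 1 else 0))"
    using unitaryfD(4)[OF u] by (intro sum.cong refl) (simp flip: sum_distrib_left)
  also have "\<dots> = (\<Sum>i<d. A i i)" by (intro sum.cong refl) (simp only: sum_delta_left lessThan_iff)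
  finally show ?thesis .
qed

lemma unitaryf_isometry:
  assumes u: "unitaryf d u"
  shows "L2_set (\<lambda>k. cmod (\<Sum>i<d. u k i * x i)) {..<d} = L2_set (\<lambda>i. cmod (x i)) {..<d}"
proof -
  have "complex_of_real (\<Sum>k<d. (cmod (\<Sum>i<d. u k i * x i))\<^sup>2) = (\<Sum>k<d. \<Sum>i<d. \<Sum>j<d. (x i * cnj (x j)) * (u k i * cnj (u k j)))"
    unfolding of_real_sum complex_norm_square
    by (intro sum.cong refl) (simp add: sum_product mult_ac)
  also have "\<dots> = (\<Sum>i<d. \<Sum>j<d. \<Sum>k<d. (x i * cnj (x j)) * (u k i * cnj (u k j)))"
    by (rule sum3_swap)
  also have "\<dots> = (\<Sum>i<d. \<Sum>j<d. (x i * cnj (x j)) * (if i = j then 1 else 0))"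
    using unitaryfD(2)[OF u] by (intro sum.cong refl) (simp flip: sum_distrib_left)
  also have "\<dots> = (\<Sum>i<d. x i * cnj (x i))" by (intro sum.cong refl) (simp only: sum_delta_left lessThan_iff)
  also have "\<dots> = complex_of_real (\<Sum>k<d. (cmod (x k))\<^sup>2)"
    unfolding of_real_sum complex_norm_square ..
  finally show ?thesis unfolding L2_set_def of_real_eq_iff by simp
qed

lemma unitaryf_cnj: "unitaryf d u \<Longrightarrow> unitaryf d (\<lambda>i j. cnj (u i j))"
  unfolding unitaryf_def[of d "\<lambda>i j. cnj (u i j)"] using unitaryfD by auto

section \<open>Closure properties of contractions\<close>

lemma contraction_rotf:
  assumes u: "unitaryf d u" and V: "V \<in> contractions d"
  shows "rotf d u V \<in> contractions d"
  unfolding contractions_def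
proof (intro CollectI allI)
  fix x y :: "nat \<Rightarrow> complex"
  have "cmod (\<Sum>i<d. \<Sum>j<d. x i * rotf d u V i j * y j)
     \<le> L2_set (\<lambda>k. cmod (\<Sum>i<d. cnj (u k i) * x i)) {..<d} * L2_set (\<lambda>l. cmod (\<Sum>j<d. u l j * y j)) {..<d}"
    unfolding bilinear_rotf by (rule contractionsD[OF V])
  then show "cmod (\<Sum>i<d. \<Sum>j<d. x i * rotf d u V i j * y j)
      \<le> L2_set (\<lambda>i. cmod (x i)) {..<d} * L2_set (\<lambda>i. cmod (y i)) {..<d}"
    using unitaryf_isometry[OF u] unitaryf_isometry[OF unitaryf_cnj[OF u]] by simp
qed

text \<open>Testing the form on the basis vector \<open>i\<close> and the conjugate of row
  \<open>i\<close> gives S \<le> sqrt S for the squared norm S of that row.\<close>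

lemma contraction_row:
  assumes V: "V \<in> contractions d" and "i < d"
  shows "(\<Sum>j<d. (cmod (V i j))\<^sup>2) \<le> 1"
proof -
  let ?S = "\<Sum>j<d. (cmod (V i j))\<^sup>2"
  have "(\<Sum>k<d. \<Sum>j<d. (if k = i then 1 else 0) * V k j * cnj (V i j)) = (\<Sum>k<d. (if k = i then 1 else 0) * (\<Sum>j<d. V k j * cnj (V i j)))"
    by (simp add: sum_distrib_left mult_ac)
  also have "\<dots> = (\<Sum>j<d. V i j * cnj (V i j))" using assms by (simp only: sum_delta_left)
  also have "\<dots> = of_real ?S" unfolding of_real_sum complex_norm_square ..
  finally have "cmod (of_real ?S) \<le> L2_set (\<lambda>k. cmod (if k = i then 1 else 0)) {..<d} * L2_set (\<lambda>j. cmod (cnj (V i j))) {..<d}"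
    using contractionsD[OF V, of "\<lambda>k. if k = i then 1 else 0" "\<lambda>j. cnj (V i j)"] by simp
  moreover have "L2_set (\<lambda>k. cmod (if k = i then 1 else 0)) {..<d} = 1"
  proof -
    have "(\<Sum>k<d. (cmod (if k = i then 1 else 0))\<^sup>2) = (\<Sum>k<d. if k = i then 1 else 0)"
      by (intro sum.cong) auto
    then show ?thesis using assms unfolding L2_set_def by simp
  qed
  ultimately have "?S \<le> sqrt ?S"
    by (simp add: L2_set_def sum_nonneg flip: of_real_power of_real_sum)
  then have "?S * ?S \<le> sqrt ?S * sqrt ?S" by (intro mult_mono) (auto intro: sum_nonneg)
  then have le: "?S * ?S \<le> ?S" by (simp add: sum_nonneg)
  show ?thesis
  proof (rule ccontr)
    assume "\<not> ?S \<le> 1"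
    then have "?S * 1 < ?S * ?S" by (intro mult_strict_left_mono) auto
    with le show False by simp
  qed
qed

lemma contraction_transpose:
  assumes V: "V \<in> contractions d"
  shows "(\<lambda>i j. V j i) \<in> contractions d"
proof -
  have *: "(\<Sum>i<d. \<Sum>j<d. y i * V i j * x j) = (\<Sum>i<d. \<Sum>j<d. x i * V j i * y j)" for x y :: "nat \<Rightarrow> complex"
    by (subst sum.swap) (simp add: mult_ac)
  show ?thesis
    unfolding contractions_def
  proof (intro CollectI allI)
    fix x y :: "nat \<Rightarrow> complex"
    show "cmod (\<Sum>i<d. \<Sum>j<d. x i * V j i * y j) \<le> L2_set (\<lambda>i. cmod (x i)) {..<d} * L2_set (\<lambda>i. cmod (y i)) {..<d}"
      using contractionsD[OF V, of y x] unfolding *[of y x]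
      by (simp only: mult.commute[of "L2_set (\<lambda>i. cmod (y i)) _"])
  qed
qed

lemma contraction_diag:
  assumes "\<And>i. i < d \<Longrightarrow> cmod (c i) \<le> 1"
  shows "(\<lambda>i j. if i = j then c i else 0) \<in> contractions d"
  unfolding contractions_def
proof (intro CollectI allI)
  fix x y :: "nat \<Rightarrow> complex"
  have "(\<Sum>i<d. \<Sum>j<d. x i * (if i = j then c i else 0) * y j) = (\<Sum>i<d. x i * c i * y i)"
    by (intro sum.cong refl) (simp add: if_distrib if_distribR sum.delta cong: if_cong)
  also have "cmod \<dots> \<le> (\<Sum>i<d. cmod (x i * c i * y i))" by (rule norm_sum)
  also have "\<dots> \<le> (\<Sum>i<d. \<bar>cmod (x i)\<bar> * \<bar>cmod (y i)\<bar>)"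
  proof (rule sum_mono)
    fix i assume "i \<in> {..<d}"
    then have "cmod (x i) * cmod (c i) * cmod (y i) \<le> cmod (x i) * 1 * cmod (y i)"
      using assms by (intro mult_right_mono mult_left_mono) auto
    then show "cmod (x i * c i * y i) \<le> \<bar>cmod (x i)\<bar> * \<bar>cmod (y i)\<bar>" by (simp add: norm_mult)
  qed
  also have "\<dots> \<le> L2_set (\<lambda>i. cmod (x i)) {..<d} * L2_set (\<lambda>i. cmod (y i)) {..<d}"
    by (rule L2_set_mult_ineq)
  finally show "cmod (\<Sum>i<d. \<Sum>j<d. x i * (if i = j then c i else 0) * y j)
      \<le> L2_set (\<lambda>i. cmod (x i)) {..<d} * L2_set (\<lambda>i. cmod (y i)) {..<d}" .
qed

text \<open>\<open>r\<close> only bounds the number of terms, so the average may be subnormalised.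
  This form is used for averages over products of fibres, which for some arguments have fewer than
  the expected number of elements.\<close>

lemma contraction_sum:
  assumes "finite E" and V: "\<And>e. e \<in> E \<Longrightarrow> V e \<in> contractions d" and "real (card E) \<le> r" "r > 0"
  shows "(\<lambda>i j. (\<Sum>e\<in>E. V e i j) / of_real r) \<in> contractions d"
  unfolding contractions_def
proof (intro CollectI allI)
  fix x y :: "nat \<Rightarrow> complex"
  let ?B = "L2_set (\<lambda>i. cmod (x i)) {..<d} * L2_set (\<lambda>i. cmod (y i)) {..<d}"
  have 0: "(\<Sum>i<d. \<Sum>j<d. x i * ((\<Sum>e\<in>E. V e i j) / of_real r) * y j) = (\<Sum>i<d. \<Sum>j<d. \<Sum>e\<in>E. x i * V e i j * y j) / of_real r"
    by (simp only: sum_divide_distrib sum_distrib_left sum_distrib_right times_divide_eq_left times_divide_eq_right)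
  have 2: "(\<Sum>i<d. \<Sum>j<d. \<Sum>e\<in>E. x i * V e i j * y j) = (\<Sum>e\<in>E. \<Sum>i<d. \<Sum>j<d. x i * V e i j * y j)"
    by (rule sum3_swap[symmetric])
  have 1: "cmod (\<Sum>i<d. \<Sum>j<d. x i * ((\<Sum>e\<in>E. V e i j) / of_real r) * y j) = cmod (\<Sum>e\<in>E. \<Sum>i<d. \<Sum>j<d. x i * V e i j * y j) / r"
    unfolding 0 2 using assms by (simp add: norm_divide)
  have "cmod (\<Sum>e\<in>E. \<Sum>i<d. \<Sum>j<d. x i * V e i j * y j) \<le> (\<Sum>e\<in>E. ?B)"
    by (rule order.trans[OF norm_sum sum_mono]) (rule contractionsD[OF V])
  then have "cmod (\<Sum>e\<in>E. \<Sum>i<d. \<Sum>j<d. x i * V e i j * y j) \<le> card E * ?B" by simp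
  also have "\<dots> \<le> r * ?B" using assms by (intro mult_right_mono) (auto simp: L2_set_nonneg)
  finally show "cmod (\<Sum>i<d. \<Sum>j<d. x i * ((\<Sum>e\<in>E. V e i j) / of_real r) * y j) \<le> ?B"
    unfolding 1 using \<open>r > 0\<close> by (simp add: pos_divide_le_eq mult.commute)
qed

section \<open>Spectral theorem and trace norm\<close>

lemma hermfD: "hermf d A \<Longrightarrow> i < d \<Longrightarrow> j < d \<Longrightarrow> A j i = cnj (A i j)"
  unfolding hermf_def by blast

lemma trpair_cong:
  assumes "\<And>i j. i < d \<Longrightarrow> j < d \<Longrightarrow> V i j = V' i j" "\<And>i j. i < d \<Longrightarrow> j < d \<Longrightarrow> A i j = A' i j"
  shows "trpair d V A = trpair d V' A'"
  unfolding trpair_def by (intro sum.cong refl arg_cong2[where f="(*)"]) (use assms in auto)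

lemma exists_eigenvector:
  fixes A :: "nat \<Rightarrow> nat \<Rightarrow> complex"
  assumes "d > 0"
  shows "\<exists>e v. (\<exists>i<d. v i \<noteq> 0) \<and> (\<forall>i<d. (\<Sum>j<d. A i j * v j) = e * v i)"
proof -
  define M where "M = Matrix.mat d d (\<lambda>(i,j). A i j)"
  have M: "M \<in> carrier_mat d d" unfolding M_def by simp
  have "Polynomial.degree (char_poly M) = d" using degree_monic_char_poly[OF M] by simp
  then have "\<not> constant (poly (char_poly M))" using assms by (simp add: constant_degree)
  then obtain e where "poly (char_poly M) e = 0" using fundamental_theorem_of_algebra by blast
  then have "eigenvalue M e" using eigenvalue_root_char_poly[OF M] by simp
  then obtain w where w: "w \<in> carrier_vec d" "w \<noteq> 0\<^sub>v d" "M *\<^sub>v w = e \<cdot>\<^sub>v w"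
    unfolding eigenvalue_def eigenvector_def using M by auto
  have "\<exists>i<d. w $ i \<noteq> 0"
  proof (rule ccontr)
    assume "\<not> (\<exists>i<d. w $ i \<noteq> 0)"
    then have "w = 0\<^sub>v d" using w(1) by (intro eq_vecI) auto
    then show False using w(2) by simp
  qed
  moreover have "(\<Sum>j<d. A i j * w $ j) = e * w $ i" if "i < d" for i
  proof -
    have "(M *\<^sub>v w) $ i = (\<Sum>j<d. A i j * w $ j)"
      using that w(1) unfolding M_def by (simp add: scalar_prod_def lessThan_atLeast0)
    then show ?thesis using w that by simp
  qed
  ultimately show ?thesis by (intro exI[of _ e] exI[of _ "\<lambda>i. w $ i"]) auto
qed

lemma unitaryf_herm:
  assumes h: "\<And>i j. i < d \<Longrightarrow> j < d \<Longrightarrow> cnj (u i j) = u j i"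
    and u: "\<And>k l. k < d \<Longrightarrow> l < d \<Longrightarrow> (\<Sum>i<d. cnj (u i k) * u i l) = (if k = l then 1 else 0)"
  shows "unitaryf d u"
  unfolding unitaryf_def
proof (intro conjI allI impI u)
  fix i j assume ij: "i < d" "j < d"
  have "(\<Sum>k<d. u i k * cnj (u j k)) = (\<Sum>k<d. cnj (u k i) * u k j)"
    by (intro sum.cong refl arg_cong2[where f="(*)"]) (use h ij in auto)
  then show "(\<Sum>k<d. u i k * cnj (u j k)) = (if i = j then 1 else 0)" using u ij by simp
qed auto

text \<open>The witness is a Householder reflection.\<close>

lemma exists_unitaryf_column:
  assumes "d > 0" and n: "(\<Sum>i<d. cnj (v i) * v i) = 1" and r: "Im (v 0) = 0"
  shows "\<exists>u. unitaryf d u \<and> (\<forall>i<d. u i 0 = v i)"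
\<comment> \<open>A unit vector with first entry 1 is the first basis vector. The reflection vector
  would vanish, so the identity serves instead.\<close>
proof (cases "v 0 = 1")
  case True
  have "(\<Sum>i<d. (cmod (v i))\<^sup>2) = 1"
  proof -
    have "complex_of_real (\<Sum>i<d. (cmod (v i))\<^sup>2) = (\<Sum>i<d. cnj (v i) * v i)"
      unfolding of_real_sum complex_norm_square by (simp only: mult.commute)
    then show ?thesis unfolding n by (simp only: of_real_eq_1_iff)
  qed
  moreover have "(\<Sum>i<d. (cmod (v i))\<^sup>2) = (cmod (v 0))\<^sup>2 + (\<Sum>i\<in>{..<d}-{0}. (cmod (v i))\<^sup>2)"
    by (rule sum.remove) (use assms in auto)
  ultimately have z: "(\<Sum>i\<in>{..<d}-{0}. (cmod (v i))\<^sup>2) = 0" using True by simp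
  have "\<forall>i\<in>{..<d}-{0}. (cmod (v i))\<^sup>2 = 0" 
    using z by (subst (asm) sum_nonneg_eq_0_iff) auto
  then have "\<forall>i<d. v i = (if i = 0 then 1 else 0)" using True by auto
  moreover have "unitaryf d (\<lambda>i j. if i = j then 1 else 0)"
  proof (rule unitaryf_herm)
    fix k l assume kl: "k < d" "l < d"
    have "(\<Sum>i<d. cnj (if i = k then 1 else 0) * (if i = l then 1 else 0)) = (\<Sum>i<d. (if i = k then 1 else 0) * (if i = l then 1 else 0 :: complex))"
      by (intro sum.cong) auto
    also have "\<dots> = (if k = l then 1 else 0)" using kl by (simp only: sum_delta_left)
    finally show "(\<Sum>i<d. cnj (if i = k then 1 else 0) * (if i = l then 1 else 0)) = (if k = l then 1 else (0::complex))" .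
  qed auto
  ultimately show ?thesis by (intro exI[of _ "\<lambda>i j. if i = j then 1 else 0"]) auto
next
  case False
  define z where "z = (\<lambda>i. (if i = 0 then 1 else 0) - v i)"
  \<comment> \<open>\<open>z\<close> is the first basis vector minus \<open>v\<close>; as
    \<open>v 0\<close> is real, its squared norm is 2 (1 - v 0), and \<open>c\<close> is 2 divided
    by it.\<close>
  define c where "c = 1 / (1 - v 0)"
  define u where "u = (\<lambda>i j. (if i = j then 1 else 0) - c * z i * cnj (z j))"
  have v0: "cnj (v 0) = v 0" using r by (simp add: complex_eq_iff)
  have c: "cnj c = c" unfolding c_def using v0 by simp
  have c1: "c * (1 - v 0) = 1" unfolding c_def using False by simp
  have zz: "(\<Sum>i<d. cnj (z i) * z i) = 2 * (1 - v 0)"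
  proof -
    have "(\<Sum>i<d. cnj (z i) * z i) = (\<Sum>i<d. (if i = 0 then 1 else 0) * (1 - v i - cnj (v i)) + cnj (v i) * v i)"
      unfolding z_def by (intro sum.cong) (auto simp: algebra_simps)
    also have "\<dots> = (1 - v 0 - cnj (v 0)) + 1"
      unfolding sum.distrib n by (subst sum_delta_left) (use assms in auto)
    finally show ?thesis by (simp add: v0)
  qed
  have "unitaryf d u"
  proof (rule unitaryf_herm)
    show "cnj (u i j) = u j i" for i j unfolding u_def by (simp add: c mult_ac)
    fix k l assume kl: "k < d" "l < d"
    have "(\<Sum>i<d. cnj (u i k) * u i l) = (\<Sum>i<d. (if i = k then 1 else 0) * (if i = l then 1 else 0))
        - (\<Sum>i<d. (if i = k then 1 else 0) * (c * z i * cnj (z l))) - (\<Sum>i<d. (c * cnj (z i) * z k) * (if i = l then 1 else 0))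
        + c * c * z k * cnj (z l) * (\<Sum>i<d. cnj (z i) * z i)"
      unfolding sum_distrib_left sum_subtractf[symmetric] sum.distrib[symmetric] u_def
      by (intro sum.cong refl) (simp add: c algebra_simps)
    also have "\<dots> = (if k = l then 1 else 0) - c * z k * cnj (z l) - c * cnj (z l) * z k + c * c * z k * cnj (z l) * (2 * (1 - v 0))"
      unfolding zz using kl by (simp only: sum_delta_left)
    also have "\<dots> = (if k = l then 1 else 0) - 2 * (c * z k * cnj (z l)) + 2 * (c * (1 - v 0)) * (c * z k * cnj (z l))"
      by (simp add: algebra_simps)
    finally show "(\<Sum>i<d. cnj (u i k) * u i l) = (if k = l then 1 else 0)" unfolding c1 by simp
  qed
  moreover have "u i 0 = v i" if "i < d" for i
  proof -
    have "u i 0 = (if i = 0 then 1 else 0) - (c * (1 - v 0)) * z i" unfolding u_def by (simp add: z_def v0 mult_ac)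
    then show ?thesis unfolding c1 z_def by simp
  qed
  ultimately show ?thesis by blast
qed

text \<open>The reflection needs a unit column with real first entry, so an eigenvector is
  normalised and turned by the phase \<open>ph\<close>.\<close>

lemma exists_unitaryf_eigencolumn:
  assumes "d > 0"
  shows "\<exists>u e. unitaryf d u \<and> (\<forall>i<d. (\<Sum>j<d. A i j * u j 0) = e * u i 0)"
proof -
  obtain e v where v: "\<exists>i<d. v i \<noteq> 0" "\<forall>i<d. (\<Sum>j<d. A i j * v j) = e * v i"
    using exists_eigenvector[OF assms, of A] by blast
  define N where "N = (\<Sum>i<d. (cmod (v i))\<^sup>2)"
  obtain i where "i < d" "v i \<noteq> 0" using v by blast
  then have N: "N > 0" unfolding N_def by (intro sum_pos2[of _ i]) auto
  define ph where "ph = (if v 0 = 0 then 1 else cnj (v 0) / of_real (cmod (v 0)))"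
  have ph: "cnj ph * ph = 1"
  proof (cases "v 0 = 0")
    case False
    have "cnj ph * ph = (v 0 * cnj (v 0)) / (of_real (cmod (v 0)))\<^sup>2"
      using False unfolding ph_def by (simp add: power2_eq_square)
    also have "\<dots> = 1" unfolding complex_norm_square[symmetric] using False by simp
    finally show ?thesis .
  qed (simp add: ph_def)
  define s where "s = ph / of_real (sqrt N)"
  have s: "cnj s * s = 1 / of_real N"
  proof -
    have "cnj s * s = (cnj ph * ph) / (of_real (sqrt N) * of_real (sqrt N))" unfolding s_def by simp
    also have "\<dots> = 1 / of_real N" unfolding ph of_real_mult[symmetric] using N by simp
    finally show ?thesis .
  qed
  have "(\<Sum>i<d. cnj (s * v i) * (s * v i)) = (cnj s * s) * (\<Sum>i<d. v i * cnj (v i))"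
    unfolding sum_distrib_left by (intro sum.cong refl) (simp add: mult_ac)
  also have "(\<Sum>i<d. v i * cnj (v i)) = of_real N" unfolding N_def of_real_sum complex_norm_square ..
  also have "(cnj s * s) * of_real N = 1" unfolding s using N by simp
  finally have n: "(\<Sum>i<d. cnj (s * v i) * (s * v i)) = 1" .
  have "ph * v 0 = of_real (cmod (v 0))"
  proof (cases "v 0 = 0")
    case False
    then have "ph * v 0 = (v 0 * cnj (v 0)) / of_real (cmod (v 0))" unfolding ph_def by simp
    then show ?thesis unfolding complex_norm_square[symmetric] using False by (simp add: power2_eq_square)
  qed simp
  then have "s * v 0 = of_real (cmod (v 0) / sqrt N)" unfolding s_def by simp
  then have "Im (s * v 0) = 0" by simp
  from exists_unitaryf_column[OF assms n this] obtain u where u: "unitaryf d u" "\<forall>i<d. u i 0 = s * v i" by blast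
  have "(\<Sum>j<d. A i j * u j 0) = e * u i 0" if "i < d" for i
  proof -
    have "(\<Sum>j<d. A i j * u j 0) = s * (\<Sum>j<d. A i j * v j)"
      unfolding sum_distrib_left using u by (intro sum.cong refl) (simp add: mult_ac)
    then show ?thesis using v u that by simp
  qed
  then show ?thesis using u by blast
qed

lemma unitaryf_adj: "unitaryf d u \<Longrightarrow> unitaryf d (\<lambda>i j. cnj (u j i))"
  unfolding unitaryf_def[of d "\<lambda>i j. cnj (u j i)"] using unitaryfD by auto

lemma unitaryf_mult_aux:
  assumes u: "unitaryf d u" and w: "unitaryf d w" and kl: "k < d" "l < d"
  shows "(\<Sum>i<d. cnj (\<Sum>j<d. u i j * w j k) * (\<Sum>j<d. u i j * w j l)) = (if k = l then 1 else 0)"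
proof -
  have "(\<Sum>i<d. cnj (\<Sum>j<d. u i j * w j k) * (\<Sum>j<d. u i j * w j l))
     = (\<Sum>i<d. \<Sum>a<d. \<Sum>b<d. (cnj (w a k) * w b l) * (cnj (u i a) * u i b))"
    by (simp only: cnj_sum complex_cnj_mult sum_product) (simp only: mult_ac)
  also have "\<dots> = (\<Sum>a<d. \<Sum>b<d. \<Sum>i<d. (cnj (w a k) * w b l) * (cnj (u i a) * u i b))"
    by (rule sum3_swap)
  also have "\<dots> = (\<Sum>a<d. \<Sum>b<d. (cnj (w a k) * w b l) * (if a = b then 1 else 0))"
    using unitaryfD(1)[OF u] by (intro sum.cong refl) (simp flip: sum_distrib_left)
  also have "\<dots> = (\<Sum>a<d. cnj (w a k) * w a l)" by (intro sum.cong refl) (simp only: sum_delta_left lessThan_iff)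
  also have "\<dots> = (if k = l then 1 else 0)" by (rule unitaryfD(1)[OF w kl])
  finally show ?thesis .
qed

lemma unitaryf_mult:
  assumes u: "unitaryf d u" and w: "unitaryf d w"
  shows "unitaryf d (\<lambda>i k. \<Sum>j<d. u i j * w j k)"
  unfolding unitaryf_def
proof (intro conjI allI impI)
  fix i j assume ij: "i < d" "j < d"
  have "(\<Sum>k<d. (\<Sum>a<d. u i a * w a k) * cnj (\<Sum>a<d. u j a * w a k))
     = (\<Sum>k<d. cnj (\<Sum>a<d. cnj (w a k) * cnj (u i a)) * (\<Sum>a<d. cnj (w a k) * cnj (u j a)))"
    by (intro sum.cong refl) (simp add: mult.commute)
  also have "\<dots> = (if i = j then 1 else 0)"
    using unitaryf_mult_aux[OF unitaryf_adj[OF w] unitaryf_adj[OF u] ij] by simp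
  finally show "(\<Sum>k<d. (\<Sum>a<d. u i a * w a k) * cnj (\<Sum>a<d. u j a * w a k)) = (if i = j then 1 else 0)" .
qed (rule unitaryf_mult_aux[OF u w])

lemma rotf_rotf:
  "rotf d w (rotf d u A) i j = rotf d (\<lambda>i k. \<Sum>j<d. u i j * w j k) A i j"
proof -
  have "rotf d w (rotf d u A) i j = (\<Sum>k<d. \<Sum>l<d. \<Sum>a<d. \<Sum>b<d. (cnj (u a k) * cnj (w k i)) * (A a b * (u b l * w l j)))"
    unfolding rotf_def by (simp add: sum_distrib_left sum_distrib_right mult_ac)
  also have "\<dots> = (\<Sum>a<d. \<Sum>b<d. \<Sum>k<d. \<Sum>l<d. (cnj (u a k) * cnj (w k i)) * (A a b * (u b l * w l j)))"
    by (rule sum4_swap)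
  also have "\<dots> = rotf d (\<lambda>i k. \<Sum>j<d. u i j * w j k) A i j"
    unfolding rotf_def sum_product_mid by (simp add: mult_ac)
  finally show ?thesis .
qed

text \<open>Deflation: in a basis that starts with an eigenvector the first column is a multiple of
  the first basis vector, hermitian symmetry clears the first row as well, and the induction
  hypothesis diagonalises the remaining block.\<close>

theorem spectral_hermf:
  assumes "hermf d A"
  shows "\<exists>u (ev :: nat \<Rightarrow> real). unitaryf d u \<and> (\<forall>i<d. \<forall>j<d. rotf d u A i j = (if i = j then of_real (ev i) else 0))"
  using assms
proof (induction d arbitrary: A)
  case 0
  then show ?case by (simp add: unitaryf_def)
next
  case (Suc n)
  obtain w e where w: "unitaryf (Suc n) w" and e: "\<And>i. i < Suc n \<Longrightarrow> (\<Sum>j<Suc n. A i j * w j 0) = e * w i 0"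
    using exists_unitaryf_eigencolumn[of "Suc n" A] by blast
  define B where "B = rotf (Suc n) w A"
  have hB: "hermf (Suc n) B" unfolding B_def by (rule hermf_rotf[OF Suc.prems])
  have col: "B i 0 = e * (if i = 0 then 1 else 0)" if "i < Suc n" for i
  proof -
    have "B i 0 = (\<Sum>k<Suc n. cnj (w k i) * (\<Sum>l<Suc n. A k l * w l 0))"
      unfolding B_def rotf_def by (simp only: sum_distrib_left mult.assoc)
    also have "\<dots> = (\<Sum>k<Suc n. e * (cnj (w k i) * w k 0))"
      using e by (intro sum.cong refl) (simp add: mult_ac)
    also have "\<dots> = e * (if i = 0 then 1 else 0)"
      unfolding sum_distrib_left[symmetric] using unitaryfD(1)[OF w that, of 0] by simp
    finally show ?thesis .
  qed
  have row: "B 0 (Suc j) = 0" if "j < n" for j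
    using hermfD[OF hB, of "Suc j" 0] col[of "Suc j"] that by simp
  have col': "B (Suc j) 0 = 0" if "j < n" for j using col[of "Suc j"] that by simp
  define B' where "B' = (\<lambda>i j. B (Suc i) (Suc j))"
  have "hermf n B'" unfolding hermf_def B'_def by (intro allI impI hermfD[OF hB]) auto
  from Suc.IH[OF this] obtain u ev where u: "unitaryf n u"
    and d: "\<And>i j. i < n \<Longrightarrow> j < n \<Longrightarrow> rotf n u B' i j = (if i = j then of_real (ev i) else 0)" by blast
  define u' where "u' = (\<lambda>i j. case i of 0 \<Rightarrow> (case j of 0 \<Rightarrow> 1 | Suc j' \<Rightarrow> 0) | Suc i' \<Rightarrow> (case j of 0 \<Rightarrow> 0 | Suc j' \<Rightarrow> u i' j'))"
  have u'[simp]: "u' 0 0 = 1" "u' 0 (Suc j) = 0" "u' (Suc i) 0 = 0" "u' (Suc i) (Suc j) = u i j" for i j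
    unfolding u'_def by auto
  have uu': "unitaryf (Suc n) u'"
    unfolding unitaryf_def
  proof (intro conjI allI impI)
    fix k l assume kl: "k < Suc n" "l < Suc n"
    show "(\<Sum>i<Suc n. cnj (u' i k) * u' i l) = (if k = l then 1 else 0)"
      unfolding sum.lessThan_Suc_shift using kl unitaryfD(1)[OF u]
      by (cases k; cases l) auto
    show "(\<Sum>i<Suc n. u' k i * cnj (u' l i)) = (if k = l then 1 else 0)"
      unfolding sum.lessThan_Suc_shift using kl unitaryfD(3)[OF u]
      by (cases k; cases l) auto
  qed
  have B00: "B 0 0 = of_real (Re (B 0 0))"
  proof -
    have "B 0 0 = cnj (B 0 0)" by (rule hermfD[OF hB]) auto
    then show ?thesis by (simp add: complex_eq_iff)
  qed
  have diag: "rotf (Suc n) u' B i j = (if i = j then of_real ((case i of 0 \<Rightarrow> Re (B 0 0) | Suc i' \<Rightarrow> ev i')) else 0)" if ij: "i < Suc n" "j < Suc n" for i j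
  proof -
    have r: "rotf (Suc n) u' B i j = cnj (u' 0 i) * B 0 0 * u' 0 j + (\<Sum>k<n. \<Sum>l<n. cnj (u' (Suc k) i) * B' k l * u' (Suc l) j)"
      unfolding rotf_def sum.lessThan_Suc_shift B'_def by (simp add: row col')
    show ?thesis
    proof (cases i)
      case 0
      show ?thesis using B00 r unfolding 0 by (cases j) auto
    next
      case (Suc i')
      show ?thesis
      proof (cases j)
        case 0
        then show ?thesis using r unfolding Suc by simp
      next
        case (Suc j')
        have "(\<Sum>k<n. \<Sum>l<n. cnj (u k i') * B' k l * u l j') = (if i' = j' then of_real (ev i') else 0)"
          using d[of i' j'] ij Suc \<open>i = Suc i'\<close> unfolding rotf_def by simp
        then show ?thesis using r unfolding Suc \<open>i = Suc i'\<close> by simp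
      qed
    qed
  qed
  show ?case
    by (intro exI[of _ "\<lambda>i k. \<Sum>j<Suc n. w i j * u' j k"] exI[of _ "\<lambda>i. case i of 0 \<Rightarrow> Re (B 0 0) | Suc i' \<Rightarrow> ev i'"] conjI unitaryf_mult[OF w uu'] allI impI)
       (simp only: rotf_rotf[symmetric] B_def[symmetric] diag)
qed

section \<open>The trace norm from the roots of a characteristic polynomial\<close>

lemma order_linear_prod_list:
  "Polynomial.order a (\<Prod>x\<leftarrow>xs. [:- x, 1 :: complex:]) = count_list xs a"
proof -
  have o: "Polynomial.order a [:- x, 1:] = (if x = a then 1 else 0)" for x :: complex
    using order_power_n_n[of a 1] by (auto intro: order_0I)
  have "Polynomial.order a (\<Prod>x\<leftarrow>xs. [:- x, 1 :: complex:]) = sum_list (map (Polynomial.order a) (map (\<lambda>x. [:- x, 1:]) xs))"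
    by (rule order_prod_list) auto
  also have "\<dots> = count_list xs a" by (induction xs) (auto simp: o)
  finally show ?thesis .
qed

lemma sum_count_list:
  fixes g :: "'a \<Rightarrow> real"
  assumes "finite H" "set xs \<subseteq> H"
  shows "(\<Sum>a\<in>H. real (count_list xs a) * g a) = sum_list (map g xs)"
  using assms(2)
proof (induction xs)
  case (Cons x xs)
  have "(\<Sum>a\<in>H. real (count_list (x # xs) a) * g a) = (\<Sum>a\<in>H. real (count_list xs a) * g a) + (\<Sum>a\<in>H. if a = x then g a else 0)"
    unfolding sum.distrib[symmetric] by (intro sum.cong) (auto simp: algebra_simps)
  then show ?case using Cons assms(1) by simp
qed simp

text \<open>The left side has the shape of \<open>trace_norm\<close>, a sum over distinct roots
  weighted by multiplicity; for a product of linear factors it is a sum over the list of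
  factors.\<close>

lemma sum_roots_prod_list:
  fixes g :: "complex \<Rightarrow> real"
  assumes q: "q = (\<Prod>x\<leftarrow>xs. [:- x, 1 :: complex:])"
  shows "(\<Sum>a | poly q a = 0. real (Polynomial.order a q) * g a) = sum_list (map g xs)"
proof -
  have "{a. poly q a = 0} = set xs" unfolding q by (auto simp: poly_prod_list prod_list_zero_iff)
  then show ?thesis unfolding q order_linear_prod_list by (simp add: sum_count_list)
qed

lemma mat_adjoint_index:
  fixes H :: "complex mat"
  assumes "H \<in> carrier_mat d d" "i < d" "j < d"
  shows "mat_adjoint H $$ (i, j) = cnj (H $$ (j, i))"
  using assms unfolding mat_adjoint_def by (subst mat_of_rows_index) auto

text \<open>In an eigenbasis the square of \<open>H\<close> is diagonal with the squared
  eigenvalues, so \<open>trace_norm\<close> adds up their absolute values. The diagonal matrix of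
  signs, rotated back, is the contraction that attains this. Attainment alone is enough for bounding
  trace distances from above.\<close>

theorem trace_norm_hermf:
  assumes H: "H \<in> carrier_mat d d" and h: "hermf d (\<lambda>i j. H $$ (i, j))"
  shows "\<exists>V \<in> contractions d. of_real (trace_norm H) = trpair d V (\<lambda>i j. H $$ (i, j))"
proof -
  obtain u ev where u: "unitaryf d u"
    and ev: "\<And>i j. i < d \<Longrightarrow> j < d \<Longrightarrow> rotf d u (\<lambda>i j. H $$ (i, j)) i j = (if i = j then of_real (ev i) else 0)"
    using spectral_hermf[OF h] by blast
  define us where "us = (\<lambda>i j. cnj (u j i))"
  have us: "unitaryf d us" unfolding us_def by (rule unitaryf_adj[OF u])
  define L where "L = (\<lambda>i j. if i = j then complex_of_real (ev i) else 0 :: complex)"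
  have Heq: "H $$ (i, j) = rotf d us L i j" if "i < d" "j < d" for i j
  proof -
    have "H $$ (i, j) = (\<Sum>k<d. \<Sum>l<d. u i k * rotf d u (\<lambda>i j. H $$ (i, j)) k l * cnj (u j l))"
      by (rule unitaryf_rotf_inverse[OF u that, symmetric])
    also have "\<dots> = rotf d us L i j"
      unfolding rotf_def[of d us] unfolding us_def L_def by (intro sum.cong refl) (simp add: ev)
    finally show ?thesis .
  qed
  define S where "S = (\<lambda>i j. if i = j then complex_of_real (sgn (ev i)) else 0 :: complex)"
  have V: "rotf d us S \<in> contractions d"
    unfolding S_def by (intro contraction_rotf[OF us] contraction_diag) (auto simp: sgn_if)
  have "trpair d (rotf d us S) (\<lambda>i j. H $$ (i, j)) = trpair d (rotf d us S) (rotf d us L)"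
    by (rule trpair_cong) (auto simp: Heq)
  also have "\<dots> = trpair d S L" by (rule trpair_rotf[OF us])
  also have "\<dots> = (\<Sum>i<d. \<Sum>j<d. (if i = j then 1 else 0) * of_real \<bar>ev j\<bar>)"
    unfolding trpair_def S_def L_def by (intro sum.cong refl) (auto simp: sgn_if)
  also have "\<dots> = (\<Sum>i<d. of_real \<bar>ev i\<bar>)"
    by (intro sum.cong refl) (simp only: sum_delta_left lessThan_iff)
  finally have tr: "trpair d (rotf d us S) (\<lambda>i j. H $$ (i, j)) = of_real (\<Sum>i<d. \<bar>ev i\<bar>)" by simp
  define P where "P = Matrix.mat d d (\<lambda>(i,j). u i j)"
  define Q where "Q = Matrix.mat d d (\<lambda>(i,j). us i j)"
  define D where "D = Matrix.mat d d (\<lambda>(i,j). L i j)"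
  have PQ: "P \<in> carrier_mat d d" "Q \<in> carrier_mat d d" "D \<in> carrier_mat d d" unfolding P_def Q_def D_def by auto
  have "P * Q = 1\<^sub>m d"
    using unitaryfD(3)[OF u] unfolding P_def Q_def us_def
    by (intro eq_matI) (auto simp: scalar_prod_def lessThan_atLeast0)
  moreover have "Q * P = 1\<^sub>m d"
    using unitaryfD(1)[OF u] unfolding P_def Q_def us_def
    by (intro eq_matI) (auto simp: scalar_prod_def lessThan_atLeast0)
  moreover have "H = P * D * Q"
  proof (rule eq_matI)
    fix i j assume "i < dim_row (P * D * Q)" "j < dim_col (P * D * Q)"
    then have ij: "i < d" "j < d" using PQ by auto
    have PD: "(P * D) $$ (i, l) = (\<Sum>k<d. u i k * L k l)" if "l < d" for l
      using ij that unfolding P_def D_def by (auto simp: scalar_prod_def lessThan_atLeast0)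
    have "(P * D * Q) $$ (i, j) = (\<Sum>l<d. (P * D) $$ (i, l) * us l j)"
      using ij PQ unfolding Q_def by (auto simp: scalar_prod_def lessThan_atLeast0)
    also have "\<dots> = (\<Sum>l<d. \<Sum>k<d. u i k * L k l * us l j)"
      by (intro sum.cong refl) (simp add: PD sum_distrib_right)
    also have "\<dots> = rotf d us L i j"
      by (subst sum.swap) (simp add: rotf_def us_def)
    finally show "H $$ (i, j) = (P * D * Q) $$ (i, j)" using Heq[OF ij] by simp
  qed (use H PQ in auto)
  ultimately have sim: "similar_mat_wit H D P Q"
    using H PQ by (intro similar_mat_witI) auto
  have adj: "mat_adjoint H = H"
  proof (rule eq_matI)
    fix i j assume "i < dim_row H" "j < dim_col H"
    then have ij: "i < d" "j < d" using H by auto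
    show "mat_adjoint H $$ (i, j) = H $$ (i, j)"
      unfolding mat_adjoint_index[OF H ij] using hermfD[OF h ij(2,1)] by simp
  qed (use H in \<open>auto simp: mat_adjoint_def\<close>)
  have "H ^\<^sub>m 2 = H * H" using H by (simp add: numeral_2_eq_2)
  moreover have "D ^\<^sub>m 2 = D * D" using PQ by (simp add: numeral_2_eq_2)
  ultimately have "similar_mat (H * H) (D * D)"
    using similar_mat_wit_pow[OF sim, of 2] unfolding similar_mat_def by auto
  then have "char_poly (mat_adjoint H * H) = char_poly (D * D)"
    unfolding adj by (rule char_poly_similar)
  moreover have DD: "(D * D) $$ (i, j) = (if i = j then of_real ((ev i)\<^sup>2) else 0)" if "i < d" "j < d" for i j
  proof -
    have "(D * D) $$ (i, j) = (\<Sum>k<d. L i k * L k j)"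
      using that unfolding D_def by (auto simp: scalar_prod_def lessThan_atLeast0)
    also have "\<dots> = (\<Sum>k<d. (if i = k then 1 else 0) * (of_real (ev i) * L i j))"
      unfolding L_def by (intro sum.cong refl) auto
    also have "\<dots> = of_real (ev i) * L i j" using that by (simp only: sum_delta_left)
    finally show ?thesis by (simp add: L_def power2_eq_square)
  qed
  moreover have "upper_triangular (D * D)"
    unfolding upper_triangular_def using PQ DD by auto
  moreover have "diag_mat (D * D) = map (\<lambda>i. complex_of_real ((ev i)\<^sup>2)) [0..<d]"
    unfolding diag_mat_def using PQ DD by auto
  moreover have "D * D \<in> carrier_mat d d" using PQ by simp
  ultimately have cp: "char_poly (mat_adjoint H * H) = (\<Prod>a\<leftarrow>map (\<lambda>i. complex_of_real ((ev i)\<^sup>2)) [0..<d]. [:- a, 1:])"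
    using char_poly_upper_triangular[of "D * D" d] by metis
  have "trace_norm H = sum_list (map (\<lambda>a. sqrt (cmod a)) (map (\<lambda>i. complex_of_real ((ev i)\<^sup>2)) [0..<d]))"
    unfolding trace_norm_def Let_def by (rule sum_roots_prod_list[OF cp])
  also have "\<dots> = sum_list (map (\<lambda>i. \<bar>ev i\<bar>) [0..<d])"
    unfolding map_map by (intro arg_cong[where f=sum_list] map_cong refl) (simp only: o_def norm_of_real, simp)
  also have "\<dots> = (\<Sum>i<d. \<bar>ev i\<bar>)" by (simp add: sum_list_distinct_conv_sum_set lessThan_atLeast0)
  finally show ?thesis using V tr by metis
qed

section \<open>Pairings with positive matrices and states\<close>

lemma posf_scale:
  assumes "posf d A"
  shows "posf d (\<lambda>i j. of_real (g i) * A i j * of_real (g j))"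
proof -
  have "qform d (\<lambda>i j. of_real (g i) * A i j * of_real (g j)) x = qform d A (\<lambda>i. of_real (g i) * x i)" for x
    unfolding qform_def by (simp add: mult_ac)
  then show ?thesis using assms unfolding posf_def by simp
qed

text \<open>In an eigenbasis of \<open>A\<close> the pairing is a sum of eigenvalues times diagonal
  entries of the rotated \<open>B\<close>, all of them nonnegative.\<close>

lemma trpair_posf_nonneg:
  assumes A: "posf d A" and B: "posf d B"
  shows "0 \<le> Re (trpair d A B)"
proof -
  obtain u ev where u: "unitaryf d u"
    and ev: "\<And>i j. i < d \<Longrightarrow> j < d \<Longrightarrow> rotf d u A i j = (if i = j then of_real (ev i) else 0)"
    using spectral_hermf[OF posf_imp_hermf[OF A]] by blast
  have evp: "0 \<le> ev i" if "i < d" for i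
    using posf_diag(2)[OF posf_rotf[OF A] that, of u] ev[OF that that] by simp
  have "trpair d A B = trpair d (rotf d u A) (rotf d u B)" by (rule trpair_rotf[OF u, symmetric])
  also have "\<dots> = (\<Sum>i<d. \<Sum>j<d. (if i = j then 1 else 0) * (of_real (ev i) * rotf d u B j i))"
    unfolding trpair_def by (intro sum.cong refl) (auto simp: ev)
  also have "\<dots> = (\<Sum>i<d. of_real (ev i) * rotf d u B i i)"
    by (intro sum.cong refl) (simp only: sum_delta_left lessThan_iff)
  finally have "Re (trpair d A B) = (\<Sum>i<d. ev i * Re (rotf d u B i i))" by simp
  also have "\<dots> \<ge> 0"
    using evp posf_diag(2)[OF posf_rotf[OF B]] by (intro sum_nonneg) auto
  finally show ?thesis .
qed

lemma densfD:
  assumes "densf d A"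
  shows "posf d A" "(\<Sum>i<d. A i i) = 1" "hermf d A" "i < d \<Longrightarrow> 0 \<le> Re (A i i)" "i < d \<Longrightarrow> Im (A i i) = 0" "(\<Sum>i<d. Re (A i i)) = 1"
proof -
  show p: "posf d A" "(\<Sum>i<d. A i i) = 1" using assms by (auto simp: densf_def)
  show "hermf d A" by (rule posf_imp_hermf[OF p(1)])
  show "i < d \<Longrightarrow> 0 \<le> Re (A i i)" "i < d \<Longrightarrow> Im (A i i) = 0" using posf_diag[OF p(1)] by auto
  show "(\<Sum>i<d. Re (A i i)) = 1" unfolding Re_sum[symmetric] p by simp
qed

lemma densf_rotf: "unitaryf d u \<Longrightarrow> densf d A \<Longrightarrow> densf d (rotf d u A)"
  unfolding densf_def by (simp add: posf_rotf trace_rotf)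

text \<open>In an eigenbasis of \<open>A\<close> the pairing is a convex combination of diagonal
  entries of a contraction.\<close>

lemma trpair_densf_le:
  assumes V: "V \<in> contractions d" and A: "densf d A"
  shows "cmod (trpair d V A) \<le> 1"
proof -
  obtain u ev where u: "unitaryf d u"
    and ev: "\<And>i j. i < d \<Longrightarrow> j < d \<Longrightarrow> rotf d u A i j = (if i = j then of_real (ev i) else 0)"
    using spectral_hermf[OF densfD(3)[OF A]] by blast
  note A' = densf_rotf[OF u A]
  have evp: "0 \<le> ev i" if "i < d" for i
    using densfD(4)[OF A' that] ev[OF that that] by simp
  have Vi: "cmod (rotf d u V i i) \<le> 1" if "i < d" for i
  proof -
    have "(cmod (rotf d u V i i))\<^sup>2 \<le> (\<Sum>j<d. (cmod (rotf d u V i j))\<^sup>2)"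
      using that by (intro member_le_sum) auto
    also have "\<dots> \<le> 1" by (rule contraction_row[OF contraction_rotf[OF u V] that])
    finally show ?thesis by (simp add: abs_square_le_1)
  qed
  have "trpair d V A = trpair d (rotf d u V) (rotf d u A)" by (rule trpair_rotf[OF u, symmetric])
  also have "\<dots> = (\<Sum>i<d. \<Sum>j<d. (if i = j then 1 else 0) * (rotf d u V i j * of_real (ev j)))"
    unfolding trpair_def by (intro sum.cong refl) (auto simp: ev)
  also have "\<dots> = (\<Sum>i<d. rotf d u V i i * of_real (ev i))"
    by (intro sum.cong refl) (simp only: sum_delta_left lessThan_iff)
  finally have "cmod (trpair d V A) = cmod (\<Sum>i<d. rotf d u V i i * of_real (ev i))" by simp
  also have "\<dots> \<le> (\<Sum>i<d. cmod (rotf d u V i i * of_real (ev i)))" by (rule norm_sum)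
  also have "\<dots> \<le> (\<Sum>i<d. ev i)"
  proof (rule sum_mono)
    fix i assume "i \<in> {..<d}"
    then have "cmod (rotf d u V i i) * ev i \<le> 1 * ev i" "0 \<le> ev i"
      using Vi evp by (auto intro!: mult_left_le_one_le)
    then show "cmod (rotf d u V i i * of_real (ev i)) \<le> ev i" by (simp add: norm_mult)
  qed
  also have "\<dots> = (\<Sum>i<d. Re (rotf d u A i i))" using ev by (intro sum.cong) auto
  also have "\<dots> = 1" by (rule densfD(6)[OF A'])
  finally show ?thesis .
qed

lemma trpair_sum_right:
  "trpair d V (\<lambda>i j. \<Sum>w\<in>A. c w * r w i j) = (\<Sum>w\<in>A. c w * trpair d V (r w))"
proof -
  have "trpair d V (\<lambda>i j. \<Sum>w\<in>A. c w * r w i j) = (\<Sum>i<d. \<Sum>j<d. \<Sum>w\<in>A. c w * (V i j * r w j i))"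
    unfolding trpair_def by (simp add: sum_distrib_left mult_ac)
  also have "\<dots> = (\<Sum>w\<in>A. \<Sum>i<d. \<Sum>j<d. c w * (V i j * r w j i))"
    by (rule sum3_swap[symmetric])
  also have "\<dots> = (\<Sum>w\<in>A. c w * trpair d V (r w))"
    unfolding trpair_def by (simp add: sum_distrib_left)
  finally show ?thesis .
qed

lemma trpair_sum_left:
  "trpair d (\<lambda>i j. (\<Sum>e\<in>E. V e i j) / r) A = (\<Sum>e\<in>E. trpair d (V e) A) / r"
proof -
  have "trpair d (\<lambda>i j. (\<Sum>e\<in>E. V e i j) / r) A = (\<Sum>i<d. \<Sum>j<d. \<Sum>e\<in>E. V e i j * A j i) / r"
    unfolding trpair_def by (simp add: sum_divide_distrib sum_distrib_right)
  also have "(\<Sum>i<d. \<Sum>j<d. \<Sum>e\<in>E. V e i j * A j i) = (\<Sum>e\<in>E. trpair d (V e) A)"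
    unfolding trpair_def by (rule sum3_swap[symmetric])
  finally show ?thesis .
qed

text \<open>The weights \<open>\<mu>\<close> regularise the average state \<open>\<sigma>\<close>; dividing by their square roots is the
  usual conjugation with \<open>\<sigma>\<close> to the power \<open>- 1/4\<close>, written in an eigenbasis of \<open>\<sigma>\<close>.\<close>

lemma trpair_weighted_bound:
  assumes V: "V \<in> contractions d" and H: "hermf d H" and mu: "\<And>i. i < d \<Longrightarrow> 0 < mu i"
  shows "(cmod (trpair d V H))\<^sup>2 \<le> (\<Sum>i<d. mu i) *
     (\<Sum>i<d. \<Sum>j<d. Re (H i j * H j i) / (sqrt (mu i) * sqrt (mu j)))"
proof -
  let ?I = "{..<d} \<times> {..<d}"
  define m where "m = (\<lambda>i j. sqrt (mu i) * sqrt (mu j))"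
  have m: "0 < m i j" if "i < d" "j < d" for i j using mu that unfolding m_def by simp
  have "cmod (trpair d V H) \<le> (\<Sum>(i,j)\<in>?I. cmod (V i j * H j i))"
    unfolding trpair_def sum.cartesian_product by (rule order.trans[OF norm_sum]) (simp add: case_prod_beta)
  \<comment> \<open>Each product is multiplied and divided by the square root of \<open>m\<close>,
    so that Cauchy-Schwarz separates \<open>V\<close> from \<open>H\<close> and leaves the weights
    on both sides.\<close>
  also have "\<dots> = (\<Sum>p\<in>?I. (cmod (V (fst p) (snd p)) * sqrt (m (fst p) (snd p))) * (cmod (H (snd p) (fst p)) / sqrt (m (fst p) (snd p))))"
    by (intro sum.cong refl) (use m in \<open>force simp: norm_mult\<close>)
  finally have "(cmod (trpair d V H))\<^sup>2 \<le> (\<Sum>p\<in>?I. (cmod (V (fst p) (snd p)) * sqrt (m (fst p) (snd p))) * (cmod (H (snd p) (fst p)) / sqrt (m (fst p) (snd p))))\<^sup>2"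
    by (rule power_mono) simp
  also have "\<dots> \<le> (\<Sum>p\<in>?I. (cmod (V (fst p) (snd p)) * sqrt (m (fst p) (snd p)))\<^sup>2) * (\<Sum>p\<in>?I. (cmod (H (snd p) (fst p)) / sqrt (m (fst p) (snd p)))\<^sup>2)"
    by (rule Cauchy_Schwarz_ineq_sum)
  finally have cs: "(cmod (trpair d V H))\<^sup>2 \<le> (\<Sum>p\<in>?I. (cmod (V (fst p) (snd p)) * sqrt (m (fst p) (snd p)))\<^sup>2) * (\<Sum>p\<in>?I. (cmod (H (snd p) (fst p)) / sqrt (m (fst p) (snd p)))\<^sup>2)" .
  have X2: "(\<Sum>p\<in>?I. (cmod (H (snd p) (fst p)) / sqrt (m (fst p) (snd p)))\<^sup>2) = (\<Sum>i<d. \<Sum>j<d. Re (H i j * H j i) / m i j)"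
    unfolding sum.cartesian_product
  proof (intro sum.cong refl, clarsimp)
    fix i j assume ij: "i < d" "j < d"
    have "H i j * H j i = of_real ((cmod (H j i))\<^sup>2)"
      unfolding complex_norm_square using hermfD[OF H ij(2,1)] by simp
    then have "Re (H i j * H j i) = (cmod (H j i))\<^sup>2" by (simp only: Re_complex_of_real)
    then show "(cmod (H j i) / sqrt (m i j))\<^sup>2 = (Re (H i j) * Re (H j i) - Im (H i j) * Im (H j i)) / m i j"
      using m[OF ij] by (simp add: power_divide)
  qed
  have "(\<Sum>p\<in>?I. (cmod (V (fst p) (snd p)) * sqrt (m (fst p) (snd p)))\<^sup>2) = (\<Sum>i<d. \<Sum>j<d. (cmod (V i j))\<^sup>2 * m i j)"
    unfolding sum.cartesian_product
    by (intro sum.cong refl) (use m in \<open>force simp: power_mult_distrib less_imp_le\<close>)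
  also have "\<dots> \<le> (\<Sum>i<d. mu i)"
  proof -
    \<comment> \<open>Passing to the arithmetic mean splits the weighted sum into one over rows and
      one over columns of \<open>V\<close>, whose squared norms are at most 1.\<close>
    have amgm: "m i j \<le> mu i / 2 + mu j / 2" if "i < d" "j < d" for i j
      using arith_geo_mean_sqrt[of "mu i" "mu j"] mu[OF that(1)] mu[OF that(2)]
      by (simp add: m_def real_sqrt_mult add_divide_distrib)
    have "(\<Sum>i<d. \<Sum>j<d. (cmod (V i j))\<^sup>2 * m i j) \<le> (\<Sum>i<d. \<Sum>j<d. (cmod (V i j))\<^sup>2 * (mu i / 2 + mu j / 2))"
      using amgm by (intro sum_mono mult_left_mono) auto
    also have "\<dots> = (\<Sum>i<d. \<Sum>j<d. (cmod (V i j))\<^sup>2 * (mu i / 2)) + (\<Sum>j<d. \<Sum>i<d. (cmod (V i j))\<^sup>2 * (mu j / 2))"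
      by (subst (3) sum.swap) (simp only: distrib_left sum.distrib)
    also have "\<dots> = (\<Sum>i<d. (\<Sum>j<d. (cmod (V i j))\<^sup>2) * (mu i / 2)) + (\<Sum>j<d. (\<Sum>i<d. (cmod (V i j))\<^sup>2) * (mu j / 2))"
      by (simp only: sum_distrib_right)
    also have "\<dots> \<le> (\<Sum>i<d. 1 * (mu i / 2)) + (\<Sum>j<d. 1 * (mu j / 2))"
      using contraction_row[OF V] contraction_row[OF contraction_transpose[OF V]] mu
      by (intro add_mono sum_mono mult_right_mono) (auto intro: less_imp_le)
    also have "\<dots> = (\<Sum>i<d. mu i)" by (simp flip: sum.distrib)
    finally show ?thesis .
  qed
  finally have V2: "(\<Sum>p\<in>?I. (cmod (V (fst p) (snd p)) * sqrt (m (fst p) (snd p)))\<^sup>2) \<le> (\<Sum>i<d. mu i)" .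
  have "0 \<le> (\<Sum>p\<in>?I. (cmod (H (snd p) (fst p)) / sqrt (m (fst p) (snd p)))\<^sup>2)"
    by (intro sum_nonneg) simp
  from order.trans[OF cs mult_right_mono[OF V2 this]] show ?thesis unfolding X2 unfolding m_def .
qed

section \<open>One-bit extraction against quantum side information\<close>

text \<open>The eigenvalues of a state are nonnegative and sum to 1, so none exceeds 1.\<close>

lemma densf_contraction:
  assumes A: "densf d A"
  shows "A \<in> contractions d"
proof -
  obtain u ev where u: "unitaryf d u"
    and ev: "\<And>i j. i < d \<Longrightarrow> j < d \<Longrightarrow> rotf d u A i j = (if i = j then of_real (ev i) else 0)"
    using spectral_hermf[OF densfD(3)[OF A]] by blast
  note A' = densf_rotf[OF u A]
  have evp: "0 \<le> ev i" if "i < d" for i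
    using densfD(4)[OF A' that] ev[OF that that] by simp
  have "(\<Sum>i<d. Re (rotf d u A i i)) = (\<Sum>i<d. ev i)" using ev by (intro sum.cong) auto
  then have s: "(\<Sum>i<d. ev i) = 1" using densfD(6)[OF A'] by simp
  have ev1: "ev i \<le> 1" if "i < d" for i
    using member_le_sum[of i "{..<d}" ev] that evp s by auto
  have eq: "A i j = rotf d (\<lambda>i j. cnj (u j i)) (\<lambda>i j. if i = j then of_real (ev i) else 0) i j" if "i < d" "j < d" for i j
  proof -
    have "A i j = (\<Sum>k<d. \<Sum>l<d. u i k * rotf d u A k l * cnj (u j l))"
      by (rule unitaryf_rotf_inverse[OF u that, symmetric])
    also have "\<dots> = rotf d (\<lambda>i j. cnj (u j i)) (\<lambda>i j. if i = j then of_real (ev i) else 0) i j"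
      unfolding rotf_def[of d "\<lambda>i j. cnj (u j i)"] by (intro sum.cong refl) (simp add: ev)
    finally show ?thesis .
  qed
  have "rotf d (\<lambda>i j. cnj (u j i)) (\<lambda>i j. if i = j then of_real (ev i) else 0) \<in> contractions d"
    by (intro contraction_rotf[OF unitaryf_adj[OF u]] contraction_diag) (use evp ev1 in auto)
  then show ?thesis unfolding contractions_def using eq by simp
qed

text \<open>A state is at most the identity in the operator order. This later bounds the weighted
  square of a single state by its weighted trace.\<close>

lemma posf_one_minus_densf:
  assumes A: "densf d A"
  shows "posf d (\<lambda>i j. (if i = j then 1 else 0) - A i j)"
  unfolding posf_def
proof (intro allI)
  fix x
  have "qform d (\<lambda>i j. (if i = j then 1 else 0) - A i j) x
      = (\<Sum>i<d. \<Sum>j<d. (if i = j then 1 else 0) * (cnj (x i) * x j)) - qform d A x"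
    unfolding qform_def sum_subtractf[symmetric] by (intro sum.cong refl) (simp add: algebra_simps)
  also have "(\<Sum>i<d. \<Sum>j<d. (if i = j then 1 else 0) * (cnj (x i) * x j)) = (\<Sum>i<d. cnj (x i) * x i)"
    by (intro sum.cong refl) (simp only: sum_delta_left lessThan_iff)
  also have "\<dots> = of_real ((L2_set (\<lambda>i. cmod (x i)) {..<d})\<^sup>2)"
    unfolding L2_set_def using sum_nonneg[of "{..<d}" "\<lambda>i. (cmod (x i))\<^sup>2"]
    by (simp add: complex_norm_square mult.commute del: of_real_power)
  finally have eq: "qform d (\<lambda>i j. (if i = j then 1 else 0) - A i j) x = of_real ((L2_set (\<lambda>i. cmod (x i)) {..<d})\<^sup>2) - qform d A x" .
  have "Re (qform d A x) \<le> cmod (qform d A x)" by (rule complex_Re_le_cmod)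
  also have "\<dots> \<le> L2_set (\<lambda>i. cmod (cnj (x i))) {..<d} * L2_set (\<lambda>i. cmod (x i)) {..<d}"
    unfolding qform_def by (rule contractionsD[OF densf_contraction[OF A]])
  finally show "Im (qform d (\<lambda>i j. (if i = j then 1 else 0) - A i j) x) = 0 \<and> 0 \<le> Re (qform d (\<lambda>i j. (if i = j then 1 else 0) - A i j) x)"
    using densfD(1)[OF A] unfolding eq posf_def by (simp add: power2_eq_square)
qed

text \<open>With M the diagonal matrix of the weights \<open>mu\<close>, this is the real part of
  the trace of M^(-1/2) H M^(-1/2) Y, a Hilbert-Schmidt product weighted by the average
  state.\<close>

definition wip :: "nat \<Rightarrow> (nat \<Rightarrow> real) \<Rightarrow> (nat \<Rightarrow> nat \<Rightarrow> complex) \<Rightarrow> (nat \<Rightarrow> nat \<Rightarrow> complex) \<Rightarrow> real" where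
  "wip d mu H Y = (\<Sum>i<d. \<Sum>j<d. Re (H i j * Y j i) / (sqrt (mu i) * sqrt (mu j)))"

text \<open>Conjugating both matrices by the inverse fourth roots of the weights keeps them positive
  and turns the weighted product into an ordinary trace pairing.\<close>

lemma wip_nonneg:
  assumes "posf d H" "posf d Y" "\<And>i. i < d \<Longrightarrow> 0 < mu i"
  shows "0 \<le> wip d mu H Y"
proof -
  define g where "g = (\<lambda>i. 1 / sqrt (sqrt (mu i)))"
  have "0 \<le> Re (trpair d (\<lambda>i j. of_real (g i) * H i j * of_real (g j)) (\<lambda>i j. of_real (g i) * Y i j * of_real (g j)))"
    by (intro trpair_posf_nonneg posf_scale assms)
  also have "\<dots> = wip d mu H Y"
    unfolding trpair_def wip_def Re_sum
  proof (intro sum.cong refl)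
    fix i j assume "i \<in> {..<d}" "j \<in> {..<d}"
    then have g2: "g i * g i = 1 / sqrt (mu i)" "g j * g j = 1 / sqrt (mu j)"
      using assms(3)[of i] assms(3)[of j] unfolding g_def by auto
    have "Re (of_real (g i) * H i j * of_real (g j) * (of_real (g j) * Y j i * of_real (g i)))
       = Re (of_real ((g i * g i) * (g j * g j)) * (H i j * Y j i))" by (simp add: mult_ac)
    also have "\<dots> = (g i * g i) * (g j * g j) * Re (H i j * Y j i)" by simp
    finally show "Re (of_real (g i) * H i j * of_real (g j) * (of_real (g j) * Y j i * of_real (g i))) = Re (H i j * Y j i) / (sqrt (mu i) * sqrt (mu j))"
      unfolding g2 by simp
  qed
  finally show ?thesis .
qed

lemma wip_sum:
  "wip d mu (\<lambda>i j. \<Sum>w\<in>A. of_real (a w) * r w i j) (\<lambda>i j. \<Sum>w\<in>A. of_real (a w) * r w i j)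
    = (\<Sum>w\<in>A. \<Sum>w'\<in>A. a w * a w' * wip d mu (r w) (r w'))"
proof -
  have "wip d mu (\<lambda>i j. \<Sum>w\<in>A. of_real (a w) * r w i j) (\<lambda>i j. \<Sum>w\<in>A. of_real (a w) * r w i j)
    = (\<Sum>i<d. \<Sum>j<d. \<Sum>w\<in>A. \<Sum>w'\<in>A. a w * a w' * (Re (r w i j * r w' j i) / (sqrt (mu i) * sqrt (mu j))))"
    unfolding wip_def
  proof (intro sum.cong refl)
    fix i j
    have "(\<Sum>w\<in>A. of_real (a w) * r w i j) * (\<Sum>w\<in>A. of_real (a w) * r w j i) = (\<Sum>w\<in>A. \<Sum>w'\<in>A. of_real (a w * a w') * (r w i j * r w' j i))"
      unfolding sum_product by (intro sum.cong refl) (simp add: mult_ac)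
    then have "Re ((\<Sum>w\<in>A. of_real (a w) * r w i j) * (\<Sum>w\<in>A. of_real (a w) * r w j i)) = (\<Sum>w\<in>A. \<Sum>w'\<in>A. a w * a w' * Re (r w i j * r w' j i))"
      by simp
    then show "Re ((\<Sum>w\<in>A. of_real (a w) * r w i j) * (\<Sum>w\<in>A. of_real (a w) * r w j i)) / (sqrt (mu i) * sqrt (mu j))
      = (\<Sum>w\<in>A. \<Sum>w'\<in>A. a w * a w' * (Re (r w i j * r w' j i) / (sqrt (mu i) * sqrt (mu j))))"
      by (simp only: sum_divide_distrib times_divide_eq_right)
  qed
  also have "\<dots> = (\<Sum>w\<in>A. \<Sum>w'\<in>A. \<Sum>i<d. \<Sum>j<d. a w * a w' * (Re (r w i j * r w' j i) / (sqrt (mu i) * sqrt (mu j))))"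
    by (rule sum4_swap)
  also have "\<dots> = (\<Sum>w\<in>A. \<Sum>w'\<in>A. a w * a w' * wip d mu (r w) (r w'))"
    unfolding wip_def by (simp only: sum_distrib_left)
  finally show ?thesis .
qed

lemma wip_diag:
  assumes "\<And>i j. i < d \<Longrightarrow> j < d \<Longrightarrow> Y i j = (if i = j then of_real (l i) else 0)" "\<And>i. i < d \<Longrightarrow> 0 < mu i"
  shows "wip d mu H Y = (\<Sum>i<d. Re (H i i) * l i / mu i)"
proof -
  have "wip d mu H Y = (\<Sum>i<d. \<Sum>j<d. if i = j then Re (H i i) * l i / mu i else 0)"
    unfolding wip_def
  proof (intro sum.cong refl)
    fix i j assume "i \<in> {..<d}" "j \<in> {..<d}"
    moreover from this have "sqrt (mu i) * sqrt (mu i) = mu i" using assms(2)[of i] by simp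
    ultimately show "Re (H i j * Y j i) / (sqrt (mu i) * sqrt (mu j)) = (if i = j then Re (H i i) * l i / mu i else 0)"
      using assms(1)[of j i] by auto
  qed
  then show ?thesis by simp
qed

section \<open>Signed sums of states\<close>

text \<open>Quantum version of the second moment method. The weighted square of the signed sum is
  expanded into pairs of words and averaged over \<open>z\<close>: equal words contribute at most
  \<open>d\<close> in total, and distinct ones are damped by \<open>del\<close> against a total of
  at most \<open>card A\<close>.\<close>

lemma signed_sum_bound_diag:
  fixes chi :: "'z \<Rightarrow> 'w \<Rightarrow> real" and del :: real
  assumes fin: "finite A" "A \<noteq> {}" "finite Z" and "d > 0"
    and chi: "\<And>z w. \<bar>chi z w\<bar> = 1"
    and corr: "\<And>w w'. w \<in> A \<Longrightarrow> w' \<in> A \<Longrightarrow> w \<noteq> w' \<Longrightarrow> (\<Sum>z\<in>Z. chi z w * chi z w') \<le> del * card Z"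
    and del: "del \<ge> 0"
    and r: "\<And>w. w \<in> A \<Longrightarrow> densf d (r w)"
    and V: "\<And>z. z \<in> Z \<Longrightarrow> V z \<in> contractions d"
    and l: "\<And>i j. i < d \<Longrightarrow> j < d \<Longrightarrow> (\<Sum>w\<in>A. r w i j) = (if i = j then of_real (l i) else 0)"
  shows "(\<Sum>z\<in>Z. cmod (\<Sum>w\<in>A. of_real (chi z w) * trpair d (V z) (r w))) \<le> card Z * sqrt (2 * real (card A) * (d + del * card A))"
proof -
  define n where "n = real (card A)"
  have n: "n > 0" unfolding n_def using fin by (simp add: card_gt_0_iff)
  have lw: "l i = (\<Sum>w\<in>A. Re (r w i i))" if "i < d" for i
    unfolding Re_sum[symmetric] l[OF that that] by simp
  have l0: "0 \<le> l i" if "i < d" for i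
    unfolding lw[OF that] using that r by (intro sum_nonneg) (auto dest: densfD(4))
  have "(\<Sum>i<d. l i) = (\<Sum>w\<in>A. \<Sum>i<d. Re (r w i i))"
    using lw by (subst sum.swap) simp
  also have "\<dots> = n" unfolding n_def using densfD(6)[OF r] by simp
  finally have lsum: "(\<Sum>i<d. l i) = n" .
  \<comment> \<open>The extra \<open>n / d\<close> makes every weight positive even where the
    average state vanishes, and only doubles the total weight; this is the factor 2 under the square
    root.\<close>
  define mu where "mu = (\<lambda>i. l i + n / d)"
  have mu: "0 < mu i" if "i < d" for i using l0[OF that] n \<open>d > 0\<close> unfolding mu_def by (simp add: add_nonneg_pos)
  have musum: "(\<Sum>i<d. mu i) = 2 * n" unfolding mu_def using lsum \<open>d > 0\<close> by (simp add: sum.distrib)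
  define q where "q = (\<lambda>w w'. wip d mu (r w) (r w'))"
  have q0: "0 \<le> q w w'" if "w \<in> A" "w' \<in> A" for w w'
    unfolding q_def using that r mu by (intro wip_nonneg) (auto dest: densfD(1))
  have qd: "q w w \<le> (\<Sum>i<d. Re (r w i i) / mu i)" if w: "w \<in> A" for w
  proof -
    have "0 \<le> wip d mu (r w) (\<lambda>i j. (if i = j then 1 else 0) - r w i j)"
      using r[OF w] mu by (intro wip_nonneg posf_one_minus_densf) (auto dest: densfD(1))
    also have "\<dots> = wip d mu (r w) (\<lambda>i j. if i = j then of_real 1 else 0) - q w w"
      unfolding wip_def q_def sum_subtractf[symmetric] by (intro sum.cong refl) (simp add: algebra_simps diff_divide_distrib add_divide_distrib)
    also have "wip d mu (r w) (\<lambda>i j. if i = j then of_real 1 else 0) = (\<Sum>i<d. Re (r w i i) * 1 / mu i)"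
      by (rule wip_diag) (use mu in auto)
    finally show ?thesis by simp
  qed
  have "(\<Sum>w\<in>A. q w w) \<le> (\<Sum>w\<in>A. \<Sum>i<d. Re (r w i i) / mu i)" by (intro sum_mono qd)
  also have "\<dots> = (\<Sum>i<d. l i / mu i)" using lw by (subst sum.swap) (simp add: sum_divide_distrib)
  also have "\<dots> \<le> (\<Sum>i<d. 1)"
  proof (rule sum_mono)
    fix i assume "i \<in> {..<d}"
    then show "l i / mu i \<le> 1" using mu[of i] n by (simp add: mu_def)
  qed
  finally have qdiag: "(\<Sum>w\<in>A. q w w) \<le> d" by simp
  \<comment> \<open>The sum over all pairs is the weighted square of the total state, which is
    diagonal here, so each coordinate gives l i * l i / mu i \<le> l i.\<close>
  have "(\<Sum>w\<in>A. \<Sum>w'\<in>A. q w w') = wip d mu (\<lambda>i j. \<Sum>w\<in>A. of_real 1 * r w i j) (\<lambda>i j. \<Sum>w\<in>A. of_real 1 * r w i j)"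
    unfolding q_def wip_sum by simp
  also have "\<dots> = (\<Sum>i<d. Re (\<Sum>w\<in>A. of_real 1 * r w i i) * l i / mu i)"
    by (rule wip_diag) (use l mu in auto)
  also have "\<dots> \<le> (\<Sum>i<d. l i)"
  proof (rule sum_mono)
    fix i assume "i \<in> {..<d}"
    then have i: "i < d" by simp
    have "l i * l i \<le> l i * mu i" using l0[OF i] n unfolding mu_def by (intro mult_left_mono) auto
    then show "Re (\<Sum>w\<in>A. of_real 1 * r w i i) * l i / mu i \<le> l i" using mu[OF i] l[OF i i] by (simp add: divide_le_eq)
  qed
  finally have qall: "(\<Sum>w\<in>A. \<Sum>w'\<in>A. q w w') \<le> n" using lsum by simp
  define H where "H = (\<lambda>z i j. \<Sum>w\<in>A. of_real (chi z w) * r w i j)"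
  have hX: "hermf d (H z)" for z
    unfolding hermf_def H_def cnj_sum using densfD(3)[OF r] by (auto intro!: sum.cong hermfD)
  have tX: "(\<Sum>w\<in>A. of_real (chi z w) * trpair d (V z) (r w)) = trpair d (V z) (H z)" for z
    unfolding H_def trpair_sum_right ..
  have chi2: "chi z w * chi z w = 1" for z w
    using chi[of z w] by (metis abs_mult_self_eq mult_1)
  have "(\<Sum>z\<in>Z. wip d mu (H z) (H z)) = (\<Sum>z\<in>Z. \<Sum>w\<in>A. \<Sum>w'\<in>A. chi z w * chi z w' * q w w')"
    unfolding H_def q_def wip_sum ..
  also have "\<dots> = (\<Sum>w\<in>A. \<Sum>w'\<in>A. (\<Sum>z\<in>Z. chi z w * chi z w') * q w w')"
    by (subst sum3_swap) (simp only: sum_distrib_right)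
  \<comment> \<open>The \<open>del\<close> term is added on the diagonal too, which only enlarges
    the right side because \<open>q\<close> is nonnegative there.\<close>
  also have "\<dots> \<le> (\<Sum>w\<in>A. \<Sum>w'\<in>A. (if w' = w then card Z * q w w else 0) + del * card Z * q w w')"
  proof (intro sum_mono)
    fix w w' assume w: "w \<in> A" "w' \<in> A"
    show "(\<Sum>z\<in>Z. chi z w * chi z w') * q w w' \<le> (if w' = w then card Z * q w w else 0) + del * card Z * q w w'"
    proof (cases "w' = w")
      case True
      then show ?thesis using q0[OF w] del by (simp add: chi2)
    next
      case False
      then show ?thesis using mult_right_mono[OF corr[OF w] q0[OF w]] by auto
    qed
  qed
  also have "\<dots> = card Z * (\<Sum>w\<in>A. q w w) + del * card Z * (\<Sum>w\<in>A. \<Sum>w'\<in>A. q w w')"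
    using fin by (simp add: sum.distrib sum_distrib_left)
  also have "\<dots> \<le> card Z * real d + del * card Z * n"
    using qdiag qall del by (intro add_mono mult_left_mono) auto
  finally have wX: "(\<Sum>z\<in>Z. wip d mu (H z) (H z)) \<le> card Z * (d + del * n)" by (simp add: algebra_simps)
  have "(\<Sum>z\<in>Z. cmod (trpair d (V z) (H z)))\<^sup>2 = (\<Sum>z\<in>Z. 1 * cmod (trpair d (V z) (H z)))\<^sup>2" by simp
  also have "\<dots> \<le> (\<Sum>z\<in>Z. 1\<^sup>2) * (\<Sum>z\<in>Z. (cmod (trpair d (V z) (H z)))\<^sup>2)"
    by (rule Cauchy_Schwarz_ineq_sum)
  also have "\<dots> \<le> card Z * (\<Sum>z\<in>Z. 2 * n * wip d mu (H z) (H z))"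
    using trpair_weighted_bound[OF V hX, of _ mu] mu unfolding wip_def musum
    by (auto intro!: mult_left_mono sum_mono)
  also have "\<dots> = card Z * (2 * n * (\<Sum>z\<in>Z. wip d mu (H z) (H z)))" by (simp add: sum_distrib_left)
  also have "\<dots> \<le> card Z * (2 * n * (card Z * (d + del * n)))"
    using wX n by (intro mult_left_mono) auto
  finally have "(\<Sum>z\<in>Z. cmod (trpair d (V z) (H z)))\<^sup>2 \<le> (real (card Z))\<^sup>2 * (2 * n * (d + del * n))"
    by (simp add: power2_eq_square mult_ac)
  then have "(\<Sum>z\<in>Z. cmod (trpair d (V z) (H z))) \<le> sqrt ((real (card Z))\<^sup>2 * (2 * n * (d + del * n)))"
    by (rule real_le_rsqrt)
  then show ?thesis unfolding tX real_sqrt_mult[of "(real (card Z))\<^sup>2"] n_def by simp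
qed

lemma rotf_sum: "rotf d u (\<lambda>i j. \<Sum>w\<in>A. r w i j) i j = (\<Sum>w\<in>A. rotf d u (r w) i j)"
  unfolding rotf_def by (simp add: sum_distrib_left sum_distrib_right sum3_swap[where A=A])

text \<open>Rotating all states and tests into an eigenbasis of the total state leaves every pairing
  unchanged and makes that total diagonal.\<close>

lemma signed_sum_bound:
  fixes chi :: "'z \<Rightarrow> 'w \<Rightarrow> real" and del :: real
  assumes fin: "finite A" "finite Z" and "d > 0"
    and chi: "\<And>z w. \<bar>chi z w\<bar> = 1"
    and corr: "\<And>w w'. w \<in> A \<Longrightarrow> w' \<in> A \<Longrightarrow> w \<noteq> w' \<Longrightarrow> (\<Sum>z\<in>Z. chi z w * chi z w') \<le> del * card Z"
    and del: "del \<ge> 0"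
    and r: "\<And>w. w \<in> A \<Longrightarrow> densf d (r w)"
    and V: "\<And>z. z \<in> Z \<Longrightarrow> V z \<in> contractions d"
  shows "(\<Sum>z\<in>Z. cmod (\<Sum>w\<in>A. of_real (chi z w) * trpair d (V z) (r w))) \<le> card Z * sqrt (2 * real (card A) * (d + del * card A))"
proof (cases "A = {}")
  case False
  have "hermf d (\<lambda>i j. \<Sum>w\<in>A. r w i j)"
    unfolding hermf_def cnj_sum using densfD(3)[OF r] by (auto intro!: sum.cong hermfD)
  from spectral_hermf[OF this] obtain u ev where u: "unitaryf d u"
    and ev: "\<And>i j. i < d \<Longrightarrow> j < d \<Longrightarrow> rotf d u (\<lambda>i j. \<Sum>w\<in>A. r w i j) i j = (if i = j then of_real (ev i) else 0)" by blast
  have "(\<Sum>z\<in>Z. cmod (\<Sum>w\<in>A. of_real (chi z w) * trpair d (rotf d u (V z)) (rotf d u (r w)))) \<le> card Z * sqrt (2 * real (card A) * (d + del * card A))"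
  proof (rule signed_sum_bound_diag)
    show "(\<Sum>w\<in>A. rotf d u (r w) i j) = (if i = j then of_real (ev i) else 0)" if "i < d" "j < d" for i j
      using ev[OF that] unfolding rotf_sum .
  qed (use assms False in \<open>auto intro: densf_rotf[OF u] contraction_rotf[OF u]\<close>)
  then show ?thesis unfolding trpair_rotf[OF u] .
qed simp

text \<open>Words are split by their classical information \<open>c\<close>, and within one class
  the test no longer varies with the word. Cauchy-Schwarz over the classes charges \<open>G\<close>
  to the dimension only; the bias term is not multiplied, since class sizes add up to
  \<open>card W\<close>.\<close>

theorem signed_sum_bound_classes:
  fixes chi :: "'z \<Rightarrow> 'w \<Rightarrow> real" and c :: "'w \<Rightarrow> 'c" and del G :: real
  assumes fin: "finite W" "finite Z" and "d > 0"
    and chi: "\<And>z w. \<bar>chi z w\<bar> = 1"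
    and corr: "\<And>w w'. w \<in> W \<Longrightarrow> w' \<in> W \<Longrightarrow> w \<noteq> w' \<Longrightarrow> (\<Sum>z\<in>Z. chi z w * chi z w') \<le> del * card Z"
    and del: "del \<ge> 0"
    and r: "\<And>w. w \<in> W \<Longrightarrow> densf d (r w)"
    and V: "\<And>z g. V z g \<in> contractions d"
    and G: "real (card (c ` W)) \<le> G"
  shows "(\<Sum>z\<in>Z. cmod (\<Sum>w\<in>W. of_real (chi z w) * trpair d (V z (c w)) (r w))) \<le> card Z * sqrt (2 * real (card W) * (G * d + del * card W))"
proof -
  define A where "A = (\<lambda>g. {w\<in>W. c w = g})"
  define n where "n = (\<lambda>g. real (card (A g)))"
  have fA: "finite (A g)" for g using fin unfolding A_def by simp
  have nW: "(\<Sum>g\<in>c`W. n g) = card W"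
    using sum.image_gen[OF fin(1), of "\<lambda>_. 1::real" c] unfolding n_def A_def by simp
  have "(\<Sum>z\<in>Z. cmod (\<Sum>w\<in>W. of_real (chi z w) * trpair d (V z (c w)) (r w)))
     \<le> (\<Sum>z\<in>Z. \<Sum>g\<in>c`W. cmod (\<Sum>w\<in>A g. of_real (chi z w) * trpair d (V z g) (r w)))"
  proof (rule sum_mono)
    fix z
    have "(\<Sum>w\<in>W. of_real (chi z w) * trpair d (V z (c w)) (r w)) = (\<Sum>g\<in>c`W. \<Sum>w\<in>A g. of_real (chi z w) * trpair d (V z g) (r w))"
      unfolding A_def by (subst sum.image_gen[OF fin(1), of _ c]) (auto intro!: sum.cong)
    then show "cmod (\<Sum>w\<in>W. of_real (chi z w) * trpair d (V z (c w)) (r w)) \<le> (\<Sum>g\<in>c`W. cmod (\<Sum>w\<in>A g. of_real (chi z w) * trpair d (V z g) (r w)))"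
      by (simp add: norm_sum)
  qed
  also have "\<dots> = (\<Sum>g\<in>c`W. \<Sum>z\<in>Z. cmod (\<Sum>w\<in>A g. of_real (chi z w) * trpair d (V z g) (r w)))"
    by (rule sum.swap)
  also have "\<dots> \<le> (\<Sum>g\<in>c`W. card Z * sqrt (2 * n g * (d + del * n g)))"
    unfolding n_def
  proof (rule sum_mono)
    fix g
    show "(\<Sum>z\<in>Z. cmod (\<Sum>w\<in>A g. of_real (chi z w) * trpair d (V z g) (r w))) \<le> card Z * sqrt (2 * real (card (A g)) * (d + del * card (A g)))"
      by (rule signed_sum_bound[OF fA fin(2) assms(3) chi _ del]) (use corr r V in \<open>auto simp: A_def\<close>)
  qed
  also have "\<dots> = card Z * (\<Sum>g\<in>c`W. sqrt (n g) * sqrt (2 * (d + del * n g)))"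
    by (simp add: sum_distrib_left real_sqrt_mult mult_ac)
  also have "(\<Sum>g\<in>c`W. sqrt (n g) * sqrt (2 * (d + del * n g))) \<le> sqrt (2 * real (card W) * (G * d + del * card W))"
  proof (rule real_le_rsqrt)
    have "(\<Sum>g\<in>c`W. sqrt (n g) * sqrt (2 * (d + del * n g)))\<^sup>2 \<le> (\<Sum>g\<in>c`W. (sqrt (n g))\<^sup>2) * (\<Sum>g\<in>c`W. (sqrt (2 * (d + del * n g)))\<^sup>2)"
      by (rule Cauchy_Schwarz_ineq_sum)
    also have "\<dots> = (\<Sum>g\<in>c`W. n g) * (\<Sum>g\<in>c`W. 2 * (d + del * n g))"
      using del by (intro arg_cong2[where f="(*)"] sum.cong refl) (auto simp: n_def)
    also have "(\<Sum>g\<in>c`W. 2 * (d + del * n g)) = 2 * (card (c`W) * d + del * card W)"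
      by (simp add: sum.distrib sum_distrib_left[symmetric] nW)
    also have "(\<Sum>g\<in>c`W. n g) * (2 * (card (c`W) * d + del * card W)) \<le> card W * (2 * (G * d + del * card W))"
      unfolding nW using G del by (intro mult_left_mono add_mono) (auto intro: mult_right_mono)
    finally show "(\<Sum>g\<in>c`W. sqrt (n g) * sqrt (2 * (d + del * n g)))\<^sup>2 \<le> 2 * real (card W) * (G * d + del * card W)" by (simp add: mult_ac)
  qed
  finally show ?thesis by (simp add: mult_left_mono)
qed

section \<open>Finite fields, small-bias codes and Reed-Solomon codes\<close>

type_synonym gf = "bit alg_closure"

text \<open>The field with 2^b elements, as the fixed points of a Frobenius power in the algebraic
  closure of the two-element field. This avoids choosing an irreducible polynomial for each
  \<open>b\<close>.\<close>

definition GF :: "nat \<Rightarrow> gf set" where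
  "GF b = {x. x ^ (2 ^ b) = x}"

lemma gf_two: "(x :: gf) + x = 0"
proof -
  have "(1 :: bit) + 1 = 0" by simp
  then have "to_ac (1 + 1 :: bit) = 0" by simp
  then have "(1 :: gf) + 1 = 0" unfolding to_ac_add by simp
  then have "x * (1 + 1) = 0" by (simp only: mult_zero_right)
  then show ?thesis by (simp only: distrib_left mult_1_right)
qed

lemma gf_minus: "- (x :: gf) = x"
  by (rule minus_unique) (rule gf_two)

lemma gf_diff: "(x :: gf) - y = x + y"
  unfolding diff_conv_add_uminus gf_minus ..

lemma gf_power_add: "((x :: gf) + y) ^ (2 ^ i) = x ^ (2 ^ i) + y ^ (2 ^ i)"
proof (induction i)
  case (Suc i)
  have sq: "(a + b)\<^sup>2 = a\<^sup>2 + b\<^sup>2" for a b :: gf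
    using gf_two[of "a * b"] by (simp add: power2_eq_square algebra_simps)
  have "(x + y) ^ (2 ^ Suc i) = ((x + y) ^ (2 ^ i))\<^sup>2" by (simp add: power_mult[symmetric] mult.commute)
  also have "\<dots> = (x ^ 2 ^ i)\<^sup>2 + (y ^ 2 ^ i)\<^sup>2" unfolding Suc sq ..
  also have "\<dots> = x ^ (2 ^ Suc i) + y ^ (2 ^ Suc i)" by (simp add: power_mult[symmetric] mult.commute)
  finally show ?case .
qed simp

lemma GF_closed:
  "0 \<in> GF b" "1 \<in> GF b" "x \<in> GF b \<Longrightarrow> y \<in> GF b \<Longrightarrow> x + y \<in> GF b"
  "x \<in> GF b \<Longrightarrow> y \<in> GF b \<Longrightarrow> x * y \<in> GF b" "x \<in> GF b \<Longrightarrow> x ^ n \<in> GF b"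
proof -
  have "(x ^ n) ^ (2 ^ b) = (x ^ (2 ^ b)) ^ n" by (simp only: power_mult[symmetric] mult.commute)
  then show "x \<in> GF b \<Longrightarrow> x ^ n \<in> GF b" unfolding GF_def by simp
qed (auto simp: GF_def gf_power_add power_mult_distrib zero_power)

lemma GF_sum: "(\<And>i. i \<in> I \<Longrightarrow> f i \<in> GF b) \<Longrightarrow> sum f I \<in> GF b"
  by (induction I rule: infinite_finite_induct) (auto intro: GF_closed)

definition frob_poly :: "nat \<Rightarrow> gf poly" where
  "frob_poly b = Polynomial.monom 1 (2 ^ b) + Polynomial.monom 1 1"

lemma frob_poly: "poly (frob_poly b) x = x ^ (2 ^ b) + x"
  unfolding frob_poly_def by (simp add: poly_monom)

lemma frob_poly_roots: "{x. poly (frob_poly b) x = 0} = GF b"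
  unfolding frob_poly GF_def gf_diff[symmetric] by simp

lemma degree_frob_poly: "b > 0 \<Longrightarrow> Polynomial.degree (frob_poly b) = 2 ^ b"
  unfolding frob_poly_def
  by (subst degree_add_eq_left) (auto simp: degree_monom_eq one_less_power simp flip: One_nat_def)

lemma pderiv_frob_poly:
  assumes "b > 0" shows "pderiv (frob_poly b) = 1"
proof -
  have "(of_nat (2 ^ b) :: gf) = 0"
    using gf_two[of 1] assms by (cases b) auto
  then show ?thesis unfolding frob_poly_def pderiv_add pderiv_monom by simp
qed

text \<open>A linear factor occurring twice would also divide the derivative, so the multiset of
  roots has no repetitions.\<close>

lemma card_roots_separable:
  fixes p :: "'a :: alg_closed_field poly"
  assumes p: "p \<noteq> 0" and sep: "\<And>x. poly p x = 0 \<Longrightarrow> poly (pderiv p) x \<noteq> 0"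
  shows "card {x. poly p x = 0} = Polynomial.degree p"
proof -
  define c where "c = Polynomial.lead_coeff p"
  obtain A where A: "size A = Polynomial.degree p" and "p = smult (Polynomial.lead_coeff p) (\<Prod>x\<in>#A. [:-x, 1:])"
    using alg_closed_imp_factorization[OF p] by (elim exE conjE) (rule that)
  then have pA: "p = smult c (\<Prod>x\<in>#A. [:-x, 1:])" unfolding c_def by (intro \<open>p = smult _ _\<close>)
  have c: "c \<noteq> 0" unfolding c_def using p by simp
  have "poly (\<Prod>x\<in>#B. [:-x, 1:]) y = 0 \<longleftrightarrow> y \<in># B" for B and y :: 'a
    by (induction B) auto
  then have "poly p y = 0 \<longleftrightarrow> y \<in># A" for y
    by (subst pA) (simp add: c)
  then have roots: "{x. poly p x = 0} = set_mset A" by blast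
  have count: "count A x = 1" if x: "x \<in># A" for x
  proof (rule ccontr)
    assume 1: "count A x \<noteq> 1"
    obtain B where B: "A = add_mset x B" using multi_member_split[OF x] by blast
    have xB: "x \<in># B" using 1 by (simp add: B count_eq_zero_iff[symmetric] del: count_eq_zero_iff)
    obtain B' where B': "B = add_mset x B'" using multi_member_split[OF xB] by blast
    define q where "q = smult c (\<Prod>x\<in>#B'. [:-x, 1:])"
    have pq: "p = [:-x, 1:] * ([:-x, 1:] * q)"
      unfolding q_def mult_smult_right
      by (subst pA) (simp only: B B' image_mset_add_mset prod_mset.add_mset)
    have e: "poly ([:-x, 1:] * r) x = 0" for r by (simp only: poly_mult) simp
    have d: "poly (pderiv ([:-x, 1:] * ([:-x, 1:] * q))) x = 0"
      by (simp only: pderiv_mult poly_add poly_mult) simp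
    have "poly p x = 0" by (subst pq) (rule e)
    moreover have "poly (pderiv p) x = 0" by (subst pq) (rule d)
    ultimately show False using notE[OF sep[of x]] by iprover
  qed
  have "size A = (\<Sum>x\<in>set_mset A. count A x)" by (rule size_multiset_overloaded_eq)
  also have "\<dots> = (\<Sum>x\<in>set_mset A. 1)" by (rule sum.cong[OF refl count])
  also have "\<dots> = card (set_mset A)" by (rule card_eq_sum[symmetric])
  finally have "size A = card (set_mset A)" .
  then show ?thesis by (simp only: roots A)
qed

text \<open>In characteristic 2 the derivative of \<open>frob_poly b\<close> is the constant 1, so
  its 2^b roots are simple.\<close>

lemma card_GF:
  assumes "b > 0"
  shows "finite (GF b)" "card (GF b) = 2 ^ b"
proof -
  have nz: "frob_poly b \<noteq> 0" using degree_frob_poly[OF assms] by auto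
  show "finite (GF b)" unfolding frob_poly_roots[symmetric] by (rule poly_roots_finite[OF nz])
  show "card (GF b) = 2 ^ b"
    using card_roots_separable[OF nz] unfolding pderiv_frob_poly[OF assms] frob_poly_roots degree_frob_poly[OF assms] by simp
qed

lemma card_polyfun_roots:
  fixes c :: "nat \<Rightarrow> 'a :: idom"
  assumes "j < n" "c j \<noteq> 0"
  shows "finite {x. (\<Sum>i<n. c i * x ^ i) = 0}" "card {x. (\<Sum>i<n. c i * x ^ i) = 0} < n"
proof -
  define q where "q = (\<Sum>i<n. Polynomial.monom (c i) i)"
  have q: "poly q x = (\<Sum>i<n. c i * x ^ i)" for x unfolding q_def by (simp add: poly_sum poly_monom)
  have "Polynomial.coeff q j = c j" unfolding q_def using assms by (simp add: coeff_sum)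
  then have nz: "q \<noteq> 0" using assms by auto
  have "Polynomial.degree q \<le> n - 1"
    unfolding q_def by (intro degree_sum_le) (auto intro: order.trans[OF degree_monom_le])
  then show "finite {x. (\<Sum>i<n. c i * x ^ i) = 0}" "card {x. (\<Sum>i<n. c i * x ^ i) = 0} < n"
    using poly_roots_finite[OF nz] card_poly_roots_bound[OF nz] assms unfolding q by auto
qed

section \<open>The additive character of the field\<close>

text \<open>The absolute trace onto the two-element field.\<close>

definition gtr :: "nat \<Rightarrow> gf \<Rightarrow> gf" where
  "gtr b x = (\<Sum>i<b. x ^ (2 ^ i))"

lemma gtr_add: "gtr b (x + y) = gtr b x + gtr b y"
  unfolding gtr_def gf_power_add by (rule sum.distrib)

text \<open>Squaring shifts the summands by one, and on \<open>GF b\<close> the last one wraps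
  around to the first, so the trace equals its own square.\<close>

lemma gtr_bit:
  assumes "x \<in> GF b" shows "gtr b x = 0 \<or> gtr b x = 1"
proof -
  have sq: "(\<Sum>i\<in>I. f i)\<^sup>2 = (\<Sum>i\<in>I. (f i)\<^sup>2)" for I and f :: "nat \<Rightarrow> gf"
    using gf_power_add[of _ _ 1] by (induction I rule: infinite_finite_induct) auto
  have "(gtr b x)\<^sup>2 = (\<Sum>i<b. x ^ (2 ^ Suc i))"
    unfolding gtr_def sq by (simp add: power_mult[symmetric] mult.commute)
  also have "\<dots> = (\<Sum>i<Suc b. x ^ (2 ^ i)) - x" by (subst sum.lessThan_Suc_shift) simp
  also have "\<dots> = gtr b x" using assms unfolding gtr_def GF_def by simp
  finally have "gtr b x * (gtr b x - 1) = 0" by (simp add: power2_eq_square algebra_simps)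
  then show ?thesis by auto
qed

definition gchar :: "nat \<Rightarrow> gf \<Rightarrow> bool" where
  "gchar b x \<longleftrightarrow> gtr b x = 1"

definition sg :: "bool \<Rightarrow> real" where "sg c = (if c then -1 else 1)"

lemma abs_sg: "\<bar>sg c\<bar> = 1" by (simp add: sg_def)

lemma gchar_add:
  assumes "x \<in> GF b" "y \<in> GF b"
  shows "sg (gchar b (x + y)) = sg (gchar b x) * sg (gchar b y)"
  using gtr_bit[OF assms(1)] gtr_bit[OF assms(2)] gf_two[of 1] unfolding gchar_def gtr_add sg_def by auto

text \<open>As a polynomial the trace is nonzero of degree 2^(b-1), too small a degree to vanish on
  all 2^b elements. The bound \<open>n\<close> is one more than that degree.\<close>

lemma gchar_nontrivial:
  assumes "b > 0" shows "\<exists>x\<in>GF b. gchar b x"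
proof (rule ccontr)
  assume "\<not> (\<exists>x\<in>GF b. gchar b x)"
  then have z: "gtr b x = 0" if "x \<in> GF b" for x using gtr_bit[OF that] that unfolding gchar_def by auto
  define c :: "nat \<Rightarrow> gf" where "c = (\<lambda>j. if j \<in> (\<lambda>i. 2 ^ i) ` {..<b} then 1 else 0)"
  define n :: nat where "n = Suc (2 ^ (b - 1))"
  have c: "(\<Sum>j<n. c j * x ^ j) = gtr b x" for x
  proof -
    have sub: "(\<lambda>i. 2 ^ i) ` {..<b} \<subseteq> {..<n}"
    proof
      fix j :: nat assume "j \<in> (\<lambda>i. 2 ^ i) ` {..<b}"
      then obtain i where "i < b" "j = 2 ^ i" by auto
      then have "j \<le> 2 ^ (b - 1)" by (auto intro!: power_increasing)
      then show "j \<in> {..<n}" unfolding n_def by simp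
    qed
    have "(\<Sum>j<n. c j * x ^ j) = (\<Sum>j\<in>(\<lambda>i. 2 ^ i) ` {..<b}. x ^ j)"
      by (rule sum.mono_neutral_cong_right) (use sub in \<open>auto simp: c_def\<close>)
    also have "\<dots> = gtr b x" unfolding gtr_def by (subst sum.reindex) (auto simp: inj_on_def)
    finally show ?thesis .
  qed
  have "c 1 \<noteq> 0" "1 < n" using assms unfolding c_def n_def by (auto intro: image_eqI[of _ _ 0])
  then have r: "finite {x. gtr b x = 0}" "card {x. gtr b x = 0} < n"
    using card_polyfun_roots[of 1 n c] unfolding c by auto
  have "2 ^ b \<le> card {x. gtr b x = 0}"
    using card_mono[OF r(1), of "GF b"] z card_GF[OF assms] by auto
  moreover have "n \<le> 2 ^ b" unfolding n_def using assms by (cases b) auto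
  ultimately show False using r(2) by simp
qed

text \<open>Translating \<open>y\<close> by an \<open>s\<close> with \<open>gchar b (s * x)\<close>
  permutes the field and flips every sign, so the sum equals its negative.\<close>

lemma gchar_orthogonal:
  assumes "b > 0" "x \<in> GF b" "x \<noteq> 0"
  shows "(\<Sum>y\<in>GF b. sg (gchar b (y * x))) = 0"
proof -
  obtain v where v: "v \<in> GF b" "gchar b v" using gchar_nontrivial[OF assms(1)] by blast
  define s where "s = v * inverse x"
  have s: "s \<in> GF b" "s * x = v"
    using v assms unfolding s_def GF_def by (auto simp: power_mult_distrib power_inverse)
  have "bij_betw (\<lambda>y. y + s) (GF b) (GF b)"
    by (rule bij_betw_byWitness[where f'="\<lambda>y. y + s"]) (auto simp: add.assoc gf_two intro: GF_closed s)
  then have "(\<Sum>y\<in>GF b. sg (gchar b (y * x))) = (\<Sum>y\<in>GF b. sg (gchar b ((y + s) * x)))"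
    by (rule sum.reindex_bij_betw[symmetric])
  also have "\<dots> = (\<Sum>y\<in>GF b. - sg (gchar b (y * x)))"
  proof (intro sum.cong refl)
    fix y assume "y \<in> GF b"
    then have "sg (gchar b ((y + s) * x)) = sg (gchar b (y * x)) * sg (gchar b v)"
      unfolding distrib_right s(2) using v assms by (intro gchar_add) (auto intro: GF_closed)
    then show "sg (gchar b ((y + s) * x)) = - sg (gchar b (y * x))" using v by (simp add: sg_def)
  qed
  also have "\<dots> = - (\<Sum>y\<in>GF b. sg (gchar b (y * x)))" by (rule sum_negf)
  finally show ?thesis by simp
qed

text \<open>The powering construction of small-bias spaces: the bit of a word \<open>w\<close> at position
  \<open>(\<alpha>, \<beta>)\<close> is a character of \<open>\<beta> * w(\<alpha>)\<close>, with \<open>w\<close> read as a 0/1 polynomial.\<close>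

definition word_poly :: "bool list \<Rightarrow> gf \<Rightarrow> gf" where
  "word_poly w x = (\<Sum>i<length w. of_bool (w ! i) * x ^ i)"

definition sbcode :: "nat \<Rightarrow> bool list \<Rightarrow> gf \<times> gf \<Rightarrow> bool" where
  "sbcode b w = (\<lambda>(x, y). gchar b (y * word_poly w x))"

text \<open>The product of signs is the character of \<open>y * D x\<close>, with \<open>D\<close> a
  nonzero polynomial of degree below \<open>n\<close>. Its fewer than \<open>n\<close> roots
  contribute 2^b each, and at every other \<open>x\<close> the inner sum vanishes by
  orthogonality.\<close>

lemma sbcode_bias:
  assumes b: "b > 0" and w: "length w = n" "length w' = n" "w \<noteq> w'"
  shows "(\<Sum>z\<in>GF b \<times> GF b. sg (sbcode b w z) * sg (sbcode b w' z)) \<le> real n / 2 ^ b * card (GF b \<times> GF b)"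
proof -
  define D where "D = (\<lambda>x. word_poly w x + word_poly w' x)"
  define c :: "nat \<Rightarrow> gf" where "c = (\<lambda>i. of_bool (w ! i) - of_bool (w' ! i))"
  have D: "D x = (\<Sum>i<n. c i * x ^ i)" for x
    unfolding D_def word_poly_def c_def gf_diff w by (simp add: distrib_right sum.distrib)
  obtain j where j: "j < n" "w ! j \<noteq> w' ! j" using w nth_equalityI[of w w'] by auto
  then have "c j \<noteq> 0" unfolding c_def by auto
  then have r: "finite {x. D x = 0}" "card {x. D x = 0} < n"
    using card_polyfun_roots[of j n c] j(1) unfolding D by auto
  have wp: "word_poly v x \<in> GF b" if "x \<in> GF b" for v x
    unfolding word_poly_def by (intro GF_sum GF_closed that) (auto intro: GF_closed)
  have "(\<Sum>z\<in>GF b \<times> GF b. sg (sbcode b w z) * sg (sbcode b w' z)) = (\<Sum>x\<in>GF b. \<Sum>y\<in>GF b. sg (gchar b (y * D x)))"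
    unfolding sum.cartesian_product D_def sbcode_def
    by (intro sum.cong refl) (auto simp: distrib_left gchar_add wp GF_closed)
  also have "\<dots> \<le> (\<Sum>x\<in>GF b. if D x = 0 then 2 ^ b else 0)"
  proof (rule sum_mono)
    fix x assume x: "x \<in> GF b"
    show "(\<Sum>y\<in>GF b. sg (gchar b (y * D x))) \<le> (if D x = 0 then 2 ^ b else 0)"
    proof (cases "D x = 0")
      case True
      have "(\<Sum>y\<in>GF b. sg (gchar b (y * D x))) \<le> (\<Sum>y\<in>GF b. 1)" by (rule sum_mono) (simp add: sg_def)
      then show ?thesis using True card_GF[OF b] by simp
    next
      case False
      moreover have "D x \<in> GF b" unfolding D_def by (intro GF_closed wp x)
      ultimately show ?thesis using gchar_orthogonal[OF b] by simp
    qed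
  qed
  also have "\<dots> = 2 ^ b * real (card (GF b \<inter> {x. D x = 0}))"
    using card_GF[OF b] by (simp add: sum.If_cases)
  also have "card (GF b \<inter> {x. D x = 0}) \<le> n"
    using card_mono[OF r(1), of "GF b \<inter> {x. D x = 0}"] r(2) by auto
  finally show ?thesis using card_GF[OF b] by (simp add: card_cartesian_product mult.commute)
qed

section \<open>Codes with arbitrary information sets\<close>

text \<open>Maximum distance separable codes in terms of information sets. There are p + 1
  coordinates: the parties are the indices below \<open>p\<close>, and index \<open>p\<close> is
  kept for the secret.\<close>

definition mds :: "nat \<Rightarrow> nat \<Rightarrow> 'a set \<Rightarrow> (nat \<Rightarrow> 'a) set \<Rightarrow> bool" where
  "mds p t B C \<longleftrightarrow> C \<subseteq> PiE {..p} (\<lambda>_. B) \<and>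
     (\<forall>T \<subseteq> {..p}. card T = t \<longrightarrow> (\<forall>v \<in> PiE T (\<lambda>_. B). \<exists>!c. c \<in> C \<and> restrict c T = v))"

text \<open>Shamir's scheme; the secret is one more coordinate of the Reed-Solomon codeword.\<close>

lemma mds_exists:
  fixes B :: "'a set"
  assumes B: "finite B" "card B = 2 ^ L" and p: "p < 2 ^ L" "L > 0"
  shows "\<exists>C. mds p t B C"
proof -
  obtain h where h: "bij_betw h (GF L) B"
    using finite_same_card_bij[OF card_GF(1)[OF p(2)] B(1)] B(2) card_GF(2)[OF p(2)] by auto
  have "card {..p} \<le> card (GF L)" using p card_GF[OF p(2)] by simp
  then obtain pt where pt: "pt ` {..p} \<subseteq> GF L" "inj_on pt {..p}"
    using card_le_inj[OF finite_atMost card_GF(1)[OF p(2)]] by blast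
  define ev where "ev = (\<lambda>a i. \<Sum>j<t. a j * pt i ^ j)"
  define A where "A = PiE {..<t} (\<lambda>_. GF L)"
  define enc where "enc = (\<lambda>T a. restrict (\<lambda>i. h (ev a i)) T)"
  have ev: "ev a i \<in> GF L" if "a \<in> A" "i \<le> p" for a i
    unfolding ev_def using that pt(1) by (intro GF_sum GF_closed) (auto simp: A_def)
  \<comment> \<open>Injectivity holds because a nonzero polynomial of degree below \<open>t\<close>
    has fewer than \<open>t\<close> roots; counting both sides then gives surjectivity.\<close>
  have bij: "bij_betw (enc T) A (PiE T (\<lambda>_. B))" if T: "T \<subseteq> {..p}" "card T = t" for T
  proof -
    have fT: "finite T" using T(1) finite_subset by blast
    have inj: "inj_on (enc T) A"
    proof (rule inj_onI)
      fix a a' assume a: "a \<in> A" "a' \<in> A" "enc T a = enc T a'"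
      have z: "(\<Sum>j<t. (a j - a' j) * x ^ j) = 0" if x: "x \<in> pt ` T" for x
      proof -
        obtain i where i: "i \<in> T" "x = pt i" using x by auto
        have "h (ev a i) = h (ev a' i)" using fun_cong[OF a(3), of i] i unfolding enc_def by simp
        then have "ev a i = ev a' i"
          using bij_betw_imp_inj_on[OF h] ev[OF a(1), of i] ev[OF a(2), of i] i T by (auto dest: inj_onD)
        then show ?thesis unfolding ev_def i by (simp add: left_diff_distrib sum_subtractf)
      qed
      have cT: "card (pt ` T) = t" using card_image[of pt T] inj_on_subset[OF pt(2) T(1)] T(2) by simp
      have "a j = a' j" if "j < t" for j
      proof (rule ccontr)
        assume "a j \<noteq> a' j"
        then have "a j - a' j \<noteq> 0" by simp
        from card_polyfun_roots[of j t "\<lambda>j. a j - a' j", OF that this]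
        have r: "finite {x. (\<Sum>i<t. (a i - a' i) * x ^ i) = 0}" "card {x. (\<Sum>i<t. (a i - a' i) * x ^ i) = 0} < t" by auto
        have "card (pt ` T) \<le> card {x. (\<Sum>i<t. (a i - a' i) * x ^ i) = 0}"
          by (rule card_mono[OF r(1)]) (use z in blast)
        then show False using r(2) cT by simp
      qed
      then show "a = a'" using a(1,2) unfolding A_def by (intro PiE_ext) auto
    qed
    have sub: "enc T ` A \<subseteq> PiE T (\<lambda>_. B)"
      using bij_betwE[OF h] ev T unfolding enc_def by (auto intro!: restrict_PiE_iff[THEN iffD2])
    have fin: "finite (PiE T (\<lambda>_. B))" using fT B by (intro finite_PiE) auto
    have "card (enc T ` A) = card (PiE T (\<lambda>_. B))"
      unfolding card_image[OF inj] unfolding A_def using fT T B card_GF[OF p(2)] by (simp add: card_PiE)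
    then have "enc T ` A = PiE T (\<lambda>_. B)" by (rule card_subset_eq[OF fin sub])
    then show ?thesis using inj by (simp add: bij_betw_def)
  qed
  have "mds p t B (enc {..p} ` A)"
    unfolding mds_def
  proof (intro conjI allI impI ballI)
    show "enc {..p} ` A \<subseteq> PiE {..p} (\<lambda>_. B)"
      using bij_betwE[OF h] ev unfolding enc_def by (auto intro!: restrict_PiE_iff[THEN iffD2])
    fix T v assume T: "T \<subseteq> {..p}" "card T = t" and v: "v \<in> PiE T (\<lambda>_. B)"
    have res: "restrict (enc {..p} a) T = enc T a" for a
      unfolding enc_def using T(1) by (auto simp: restrict_def fun_eq_iff)
    obtain a where a: "a \<in> A" "enc T a = v" 
    proof -
      have "v \<in> enc T ` A" using bij[OF T] v unfolding bij_betw_def by simp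
      then show thesis using that by blast
    qed
    show "\<exists>!c. c \<in> enc {..p} ` A \<and> restrict c T = v"
    proof (rule ex1I[of _ "enc {..p} a"])
      show "enc {..p} a \<in> enc {..p} ` A \<and> restrict (enc {..p} a) T = v" using a res by simp
      fix c assume "c \<in> enc {..p} ` A \<and> restrict c T = v"
      then obtain a' where "a' \<in> A" "c = enc {..p} a'" "enc T a' = v" using res by auto
      moreover from this have "a' = a"
        using inj_onD[OF bij_betw_imp_inj_on[OF bij[OF T]], of a' a] a by simp
      ultimately show "c = enc {..p} a" by simp
    qed
  qed
  then show ?thesis by blast
qed

section \<open>Trevisan extractor\<close>

text \<open>Probabilistic method: a uniform \<open>c\<close> meets a given set in each row with
  probability 1/q, independently, so the mean of 2 to the overlap is (1 + 1/q)^a, and some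
  \<open>c\<close> does not exceed the mean of the sum. The factor \<open>q ^ a\<close> clears
  denominators.\<close>

lemma design_extend:
  fixes D :: "nat \<Rightarrow> nat \<Rightarrow> nat"
  assumes q: "q > 0"
  shows "\<exists>c \<in> PiE {..<a} (\<lambda>_. {..<q}). (\<Sum>i<m. 2 ^ card {j. j < a \<and> c j = D i j}) * q ^ a \<le> m * (q + 1) ^ a"
proof (rule ccontr)
  assume neg: "\<not> ?thesis"
  let ?P = "PiE {..<a} (\<lambda>_. {..<q})"
  let ?h = "\<lambda>c i. 2 ^ card {j. j < a \<and> c j = D i j} :: nat"
  have fin: "finite ?P" and cP: "card ?P = q ^ a" by (auto simp: finite_PiE card_PiE)
  have ne: "?P \<noteq> {}" using cP q by (metis card.empty power_not_zero not_gr_zero)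
  have one: "(\<Sum>c\<in>?P. ?h c i) \<le> (q + 1) ^ a" for i
  proof -
    have "?h c i = (\<Prod>j<a. if c j = D i j then 2 else 1)" for c
      by (simp add: prod.If_cases Int_def)
    then have "(\<Sum>c\<in>?P. ?h c i) = (\<Sum>c\<in>?P. \<Prod>j<a. if c j = D i j then 2 else 1)" by simp
    also have "\<dots> = (\<Prod>j<a. \<Sum>y<q. if y = D i j then 2 else 1)"
      by (rule prod_sum_PiE[symmetric]) auto
    also have "\<dots> \<le> (\<Prod>j<a. q + 1)"
    proof (rule prod_mono)
      fix j
      have "(\<Sum>y<q. if y = D i j then 2 else 1 :: nat) = (\<Sum>y<q. 1 + (if y = D i j then 1 else 0))"
        by (intro sum.cong) auto
      also have "\<dots> \<le> q + 1" unfolding sum.distrib by simp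
      finally show "0 \<le> (\<Sum>y<q. if y = D i j then 2 else 1 :: nat) \<and> (\<Sum>y<q. if y = D i j then 2 else 1) \<le> q + 1" by simp
    qed
    finally show ?thesis by simp
  qed
  have "(\<Sum>c\<in>?P. m * (q + 1) ^ a) < (\<Sum>c\<in>?P. (\<Sum>i<m. ?h c i) * q ^ a)"
    using neg by (intro sum_strict_mono fin ne) (auto simp: not_le)
  also have "\<dots> = (\<Sum>i<m. \<Sum>c\<in>?P. ?h c i) * q ^ a"
    by (subst sum.swap) (simp only: sum_distrib_right)
  also have "\<dots> \<le> (\<Sum>i<m. (q + 1) ^ a) * q ^ a"
    by (intro mult_right_mono sum_mono one) auto
  finally show False by (simp add: cP mult_ac)
qed

text \<open>Greedy choice: each new set is selected against those already fixed. Only overlaps with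
  earlier sets are controlled, as the extractor compares an output bit with its predecessors
  only.\<close>

lemma design_exists:
  fixes m :: nat
  assumes q: "q > 0"
  shows "\<exists>D. \<forall>i<m. D i \<in> PiE {..<a} (\<lambda>_. {..<q}) \<and>
     (\<Sum>i'<i. 2 ^ card {j. j < a \<and> D i j = D i' j}) * q ^ a \<le> i * (q + 1) ^ a"
proof (induction m)
  case (Suc m)
  then obtain D where D: "\<And>i. i < m \<Longrightarrow> D i \<in> PiE {..<a} (\<lambda>_. {..<q})"
     "\<And>i. i < m \<Longrightarrow> (\<Sum>i'<i. 2 ^ card {j. j < a \<and> D i j = D i' j}) * q ^ a \<le> i * (q + 1) ^ a" by blast
  obtain c where c: "c \<in> PiE {..<a} (\<lambda>_. {..<q})"
    "(\<Sum>i<m. 2 ^ card {j. j < a \<and> c j = D i j}) * q ^ a \<le> m * (q + 1) ^ a"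
    using design_extend[OF q, where a = a and m = m and D = D] by blast
  have "(D(m := c)) i \<in> PiE {..<a} (\<lambda>_. {..<q}) \<and>
     (\<Sum>i'<i. 2 ^ card {j. j < a \<and> (D(m := c)) i j = (D(m := c)) i' j}) * q ^ a \<le> i * (q + 1) ^ a" if "i < Suc m" for i
  proof (cases "i = m")
    case True
    have "(\<Sum>i'<m. 2 ^ card {j. j < a \<and> (D(m := c)) m j = (D(m := c)) i' j}) = (\<Sum>i'<m. 2 ^ card {j. j < a \<and> c j = D i' j} :: nat)"
      by (intro sum.cong) auto
    then show ?thesis using c True by simp
  next
    case False
    then have im: "i < m" using that by simp
    have "(\<Sum>i'<i. 2 ^ card {j. j < a \<and> (D(m := c)) i j = (D(m := c)) i' j}) = (\<Sum>i'<i. 2 ^ card {j. j < a \<and> D i j = D i' j} :: nat)"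
      using im by (intro sum.cong) auto
    then show ?thesis using D[OF im] False by simp
  qed
  then show ?case by blast
qed simp

section \<open>Seeds and output bits\<close>

text \<open>A seed is a table with \<open>a\<close> rows of \<open>q\<close> bits, and a design set
  consists of one cell per row, so it is encoded by the column \<open>c j\<close> used in row
  \<open>j\<close>.\<close>

definition design_ix :: "nat \<Rightarrow> (nat \<Rightarrow> nat) \<Rightarrow> (nat \<times> nat \<Rightarrow> bool) \<Rightarrow> nat \<Rightarrow> bool" where
  "design_ix a c s = restrict (\<lambda>j. s (j, c j)) {..<a}"

text \<open>Exclusive or with \<open>z\<close> on the cells of one design set. Averaging over
  \<open>z\<close> rerandomises exactly the bits that one output bit reads.\<close>

definition design_shift :: "nat \<Rightarrow> nat \<Rightarrow> (nat \<Rightarrow> nat) \<Rightarrow> (nat \<Rightarrow> bool) \<Rightarrow> (nat \<times> nat \<Rightarrow> bool) \<Rightarrow> nat \<times> nat \<Rightarrow> bool" where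
  "design_shift a q c z s = restrict (\<lambda>x. if c (fst x) = snd x then s x \<noteq> z (fst x) else s x) ({..<a} \<times> {..<q})"

abbreviation "bitfuns I \<equiv> PiE I (\<lambda>_. UNIV :: bool set)"

lemma card_bitfuns: "finite I \<Longrightarrow> card (bitfuns I) = 2 ^ card I" "finite I \<Longrightarrow> finite (bitfuns I)"
  by (auto simp: card_PiE intro: finite_PiE)

lemma design_shift_bij: "bij_betw (design_shift a q c z) (bitfuns ({..<a} \<times> {..<q})) (bitfuns ({..<a} \<times> {..<q}))"
proof (rule bij_betw_byWitness[where f' = "design_shift a q c z"])
  have "design_shift a q c z (design_shift a q c z s) = s" if "s \<in> bitfuns ({..<a} \<times> {..<q})" for s
  proof (rule ext)
    fix x show "design_shift a q c z (design_shift a q c z s) x = s x"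
      using PiE_arb[OF that, of x] unfolding design_shift_def restrict_def by auto
  qed
  then show "\<forall>s\<in>bitfuns ({..<a} \<times> {..<q}). design_shift a q c z (design_shift a q c z s) = s"
    "\<forall>s\<in>bitfuns ({..<a} \<times> {..<q}). design_shift a q c z (design_shift a q c z s) = s" by auto
qed (auto simp: design_shift_def)

lemma design_ix_shift:
  assumes "c \<in> PiE {..<a} (\<lambda>_. {..<q})"
  shows "design_ix a c (design_shift a q c z s) = restrict (\<lambda>j. design_ix a c s j \<noteq> z j) {..<a}"
  using assms unfolding design_ix_def design_shift_def by (auto simp: fun_eq_iff restrict_def)

text \<open>Only the cells common to both design sets are changed, so \<open>z\<close> matters only
  in the rows where \<open>c\<close> and \<open>c'\<close> agree.\<close>

lemma design_ix_shift_restrict: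
  assumes "c' \<in> PiE {..<a} (\<lambda>_. {..<q})"
  shows "design_ix a c' (design_shift a q c z s) = design_ix a c' (design_shift a q c (restrict z {j. j < a \<and> c j = c' j}) s)"
  using assms unfolding design_ix_def design_shift_def by (auto simp: fun_eq_iff restrict_def)

definition trev_bit :: "nat \<Rightarrow> (nat \<Rightarrow> nat \<Rightarrow> nat) \<Rightarrow> ('w \<Rightarrow> (nat \<Rightarrow> bool) \<Rightarrow> bool) \<Rightarrow> nat \<Rightarrow> (nat \<times> nat \<Rightarrow> bool) \<Rightarrow> 'w \<Rightarrow> bool" where
  "trev_bit a D code i s w = code w (design_ix a (D i) s)"

definition trev :: "nat \<Rightarrow> (nat \<Rightarrow> nat \<Rightarrow> nat) \<Rightarrow> ('w \<Rightarrow> (nat \<Rightarrow> bool) \<Rightarrow> bool) \<Rightarrow> nat \<Rightarrow> (nat \<times> nat \<Rightarrow> bool) \<Rightarrow> 'w \<Rightarrow> bool list" where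
  "trev a D code i s w = map (\<lambda>i'. trev_bit a D code i' s w) [0..<i]"

text \<open>As a function of the seed bits read by output bit \<open>i\<close>, an earlier output bit only depends on
  the positions shared by the two design sets, so few functions arise.\<close>

lemma trev_card_classes:
  fixes code :: "'w \<Rightarrow> (nat \<Rightarrow> bool) \<Rightarrow> bool"
  assumes D: "\<And>i'. i' < i \<Longrightarrow> D i' \<in> PiE {..<a} (\<lambda>_. {..<q})" and fin: "finite W"
    and E: "(\<Sum>i'<i. 2 ^ card {j. j < a \<and> D i j = D i' j}) \<le> E"
  shows "card ((\<lambda>w. restrict (\<lambda>z. trev a D code i (design_shift a q (D i) z s) w) (bitfuns {..<a})) ` W) \<le> 2 ^ E"
proof -
  define Ov where "Ov = (\<lambda>i'. {j. j < a \<and> D i j = D i' j})"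
  have fO: "finite (Ov i')" for i' unfolding Ov_def by simp
  define T where "T = PiE {..<i} (\<lambda>i'. bitfuns (bitfuns (Ov i')))"
  \<comment> \<open>\<open>Phi\<close> rebuilds the earlier output bits, as a function of
    \<open>z\<close>, from one function of the shared rows per bit. Hence classes are at most as
    many as such tables.\<close>
  define Phi where "Phi = (\<lambda>g. restrict (\<lambda>z. map (\<lambda>i'. g i' (restrict z (Ov i'))) [0..<i]) (bitfuns {..<a}) :: (nat \<Rightarrow> bool) \<Rightarrow> bool list)"
  define gw where "gw = (\<lambda>w. restrict (\<lambda>i'. restrict (\<lambda>u. trev_bit a D code i' (design_shift a q (D i) u s) w) (bitfuns (Ov i'))) {..<i})"
  have fT: "finite T" unfolding T_def using fO by (intro finite_PiE card_bitfuns) auto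
  have "restrict (\<lambda>z. trev a D code i (design_shift a q (D i) z s) w) (bitfuns {..<a}) = Phi (gw w)" for w
  proof -
    have "trev a D code i (design_shift a q (D i) z s) w = map (\<lambda>i'. gw w i' (restrict z (Ov i'))) [0..<i]" for z
      unfolding trev_def
    proof (rule map_cong[OF refl])
      fix i' assume "i' \<in> set [0..<i]"
      then have i': "i' < i" by simp
      have eq: "design_ix a (D i') (design_shift a q (D i) z s) = design_ix a (D i') (design_shift a q (D i) (restrict z (Ov i')) s)"
        unfolding Ov_def by (rule design_ix_shift_restrict[OF D[OF i']])
      show "trev_bit a D code i' (design_shift a q (D i) z s) w = gw w i' (restrict z (Ov i'))"
        unfolding gw_def trev_bit_def eq using i' by simp
    qed
    then show ?thesis unfolding Phi_def by simp
  qed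
  moreover have "gw w \<in> T" for w unfolding gw_def T_def by auto
  ultimately have "(\<lambda>w. restrict (\<lambda>z. trev a D code i (design_shift a q (D i) z s) w) (bitfuns {..<a})) ` W \<subseteq> Phi ` T" by auto
  then have "card ((\<lambda>w. restrict (\<lambda>z. trev a D code i (design_shift a q (D i) z s) w) (bitfuns {..<a})) ` W) \<le> card (Phi ` T)"
    using fT by (intro card_mono) auto
  also have "\<dots> \<le> card T" by (rule card_image_le[OF fT])
  \<comment> \<open>There are 2^(2^m) Boolean functions on m shared cells; this is why the design
    controls a sum of powers of 2 and not a sum of overlaps.\<close>
  also have "\<dots> = (\<Prod>i'<i. 2 ^ (2 ^ card (Ov i')))"
    unfolding T_def using fO by (subst card_PiE) (auto simp: card_bitfuns)
  also have "\<dots> = 2 ^ (\<Sum>i'<i. 2 ^ card (Ov i'))" by (simp add: power_sum)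
  also have "\<dots> \<le> 2 ^ E" using E unfolding Ov_def by (intro power_increasing) auto
  finally show ?thesis .
qed

text \<open>The sum over seeds is averaged over shifts \<open>z\<close> of the cells that bit
  \<open>i\<close> reads. For a fixed table the bit is then the code at a uniform position, and the
  earlier bits, as a function of \<open>z\<close>, are classical information with at most 2^E
  values, which is the setting of \<open>signed_sum_bound_classes\<close>.\<close>

lemma trev_one_bit:
  fixes code :: "'w \<Rightarrow> (nat \<Rightarrow> bool) \<Rightarrow> bool" and del :: real and a q :: nat
  defines "S \<equiv> bitfuns ({..<a} \<times> {..<q})" and "Z \<equiv> bitfuns {..<a}"
  assumes D: "\<And>i'. i' \<le> i \<Longrightarrow> D i' \<in> PiE {..<a} (\<lambda>_. {..<q})"
    and E: "(\<Sum>i'<i. 2 ^ card {j. j < a \<and> D i j = D i' j}) \<le> E"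
    and fin: "finite W" and d: "d > 0" and del: "del \<ge> 0"
    and corr: "\<And>w w'. w \<in> W \<Longrightarrow> w' \<in> W \<Longrightarrow> w \<noteq> w' \<Longrightarrow> (\<Sum>z\<in>Z. sg (code w z) * sg (code w' z)) \<le> del * card Z"
    and r: "\<And>w. w \<in> W \<Longrightarrow> densf d (r w)"
    and V: "\<And>s y. V s y \<in> contractions d"
  shows "cmod (\<Sum>s\<in>S. \<Sum>w\<in>W. of_real (sg (trev_bit a D code i s w)) * trpair d (V s (trev a D code i s w)) (r w))
     \<le> card S * sqrt (2 * real (card W) * (2 ^ E * real d + del * card W))"
proof -
  define F where "F = (\<lambda>s. \<Sum>w\<in>W. of_real (sg (trev_bit a D code i s w)) * trpair d (V s (trev a D code i s w)) (r w))"
  define B where "B = sqrt (2 * real (card W) * (2 ^ E * real d + del * card W))"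
  let ?sh = "\<lambda>z s. design_shift a q (D i) z s"
  have fZ: "finite Z" "card Z > 0" unfolding Z_def by (auto simp: card_bitfuns)
  have "of_nat (card Z) * (\<Sum>s\<in>S. F s) = (\<Sum>z\<in>Z. \<Sum>s\<in>S. F (?sh z s))"
  proof -
    have "(\<Sum>s\<in>S. F (?sh z s)) = (\<Sum>s\<in>S. F s)" for z
      unfolding S_def by (rule sum.reindex_bij_betw[OF design_shift_bij])
    then show ?thesis by simp
  qed
  also have "\<dots> = (\<Sum>s\<in>S. \<Sum>z\<in>Z. F (?sh z s))" by (rule sum.swap)
  finally have eq: "of_nat (card Z) * (\<Sum>s\<in>S. F s) = (\<Sum>s\<in>S. \<Sum>z\<in>Z. F (?sh z s))" .
  have "card Z * cmod (\<Sum>s\<in>S. F s) = cmod (of_nat (card Z) * (\<Sum>s\<in>S. F s))"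
    by (simp add: norm_mult)
  also have "\<dots> = cmod (\<Sum>s\<in>S. \<Sum>z\<in>Z. F (?sh z s))" unfolding eq ..
  also have "\<dots> \<le> (\<Sum>s\<in>S. \<Sum>z\<in>Z. cmod (F (?sh z s)))"
    by (rule order.trans[OF norm_sum sum_mono[OF norm_sum]])
  also have "\<dots> \<le> (\<Sum>s\<in>S. card Z * B)"
  proof (rule sum_mono)
    fix s
    define c where "c = (\<lambda>w. restrict (\<lambda>z. trev a D code i (?sh z s) w) Z)"
    \<comment> \<open>The position read after the shift is \<open>z\<close> exclusive or the bits
      already in the table, an involution on positions; averages over \<open>z\<close> are therefore
      averages over all positions.\<close>
    define mask where "mask = (\<lambda>z. restrict (\<lambda>j. design_ix a (D i) s j \<noteq> z j) {..<a})"
    have bit: "trev_bit a D code i (?sh z s) w = code w (mask z)" for z w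
      unfolding trev_bit_def mask_def design_ix_shift[OF D[OF order_refl]] ..
    have maskZ: "mask z \<in> Z" for z unfolding mask_def Z_def by (simp add: restrict_PiE_iff)
    have mask2: "mask (mask z) = z" if z: "z \<in> Z" for z
    proof (rule ext)
      fix j show "mask (mask z) j = z j"
        using PiE_arb[OF z[unfolded Z_def], of j] unfolding mask_def by (cases "j < a") auto
    qed
    have mask: "bij_betw mask Z Z"
      by (rule bij_betw_byWitness[where f' = mask]) (simp_all add: mask2 maskZ image_subset_iff)
    have "(\<Sum>z\<in>Z. cmod (F (?sh z s))) = (\<Sum>z\<in>Z. cmod (\<Sum>w\<in>W. of_real (sg (code w (mask z))) * trpair d (V (?sh z s) (c w z)) (r w)))"
      unfolding F_def bit by (intro sum.cong refl arg_cong[where f=cmod]) (simp add: c_def)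
    also have "\<dots> \<le> card Z * B"
      unfolding B_def
    proof (rule signed_sum_bound_classes[where V = "\<lambda>z g. V (?sh z s) (g z)" and chi = "\<lambda>z w. sg (code w (mask z))" and c = c and G = "2 ^ E", OF fin fZ(1) d _ _ del r])
      show "\<bar>sg (code w (mask z))\<bar> = 1" for z w by (rule abs_sg)
      show "V (?sh z s) (g z) \<in> contractions d" for z g by (rule V)
      fix w w' assume w: "w \<in> W" "w' \<in> W" "w \<noteq> w'"
      have "(\<Sum>z\<in>Z. sg (code w (mask z)) * sg (code w' (mask z))) = (\<Sum>z\<in>Z. sg (code w z) * sg (code w' z))"
        by (rule sum.reindex_bij_betw[OF mask])
      then show "(\<Sum>z\<in>Z. sg (code w (mask z)) * sg (code w' (mask z))) \<le> del * card Z"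
        using corr[OF w] by simp
    next
      have "card (c ` W) \<le> 2 ^ E" unfolding c_def Z_def using D by (intro trev_card_classes fin E) auto
      then have "real (card (c ` W)) \<le> real (2 ^ E)" by (rule of_nat_mono)
      then show "real (card (c ` W)) \<le> 2 ^ E" by simp
    qed
    finally show "(\<Sum>z\<in>Z. cmod (F (?sh z s))) \<le> card Z * B" .
  qed
  finally have "card Z * cmod (\<Sum>s\<in>S. F s) \<le> card Z * (card S * B)" by (simp add: mult_ac)
  then show ?thesis using fZ unfolding F_def B_def by simp
qed

section \<open>Security against families of tests\<close>

abbreviation "gap d S W Y f V r \<equiv> (\<Sum>s\<in>S. \<Sum>w\<in>W.
    trpair d (V s (f s w)) (r w) - (\<Sum>y\<in>Y. trpair d (V s y) (r w)) / of_nat (card Y))"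

text \<open>A strong extractor against quantum side information of dimension \<open>d\<close> for a
  uniform source. One contraction for each pair of seed and output is a test that knows both; since
  \<open>gap\<close> is linear in the tests, no trace norm appears.\<close>

definition secure :: "nat \<Rightarrow> 's set \<Rightarrow> 'w set \<Rightarrow> 'y set \<Rightarrow> ('s \<Rightarrow> 'w \<Rightarrow> 'y) \<Rightarrow> real \<Rightarrow> bool" where
  "secure d S W Y f eps \<longleftrightarrow> (\<forall>r V. (\<forall>w\<in>W. densf d (r w)) \<longrightarrow> (\<forall>s y. V s y \<in> contractions d) \<longrightarrow>
     cmod (gap d S W Y f V r)
       \<le> eps * card S * card W)"

abbreviation "words n \<equiv> {y :: bool list. length y = n}"

abbreviation "vecs n I \<equiv> PiE I (\<lambda>_. words n)"

lemma words_card: "finite (words n)" "card (words n) = 2 ^ n"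
  using finite_lists_length_eq[of "UNIV :: bool set" n] card_lists_length_eq[of "UNIV :: bool set" n] by auto

lemma sum_words_Suc:
  fixes h :: "bool list \<Rightarrow> complex"
  shows "(\<Sum>y\<in>words (Suc k). h y) = (\<Sum>y\<in>words k. h (y @ [False])) + (\<Sum>y\<in>words k. h (y @ [True]))"
proof -
  have "words (Suc k) = (\<lambda>y. y @ [False]) ` words k \<union> (\<lambda>y. y @ [True]) ` words k"
  proof (intro Set.set_eqI iffI)
    fix y assume "y \<in> words (Suc k)"
    then have "y = butlast y @ [last y]" "length (butlast y) = k" by (auto simp: append_butlast_last_id length_greater_0_conv[symmetric] simp del: length_greater_0_conv)
    then show "y \<in> (\<lambda>y. y @ [False]) ` words k \<union> (\<lambda>y. y @ [True]) ` words k"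
      by (cases "last y") (auto intro: image_eqI[of _ _ "butlast y"])
  qed auto
  moreover have "(\<lambda>y. y @ [False]) ` words k \<inter> (\<lambda>y. y @ [True]) ` words k = {}" by auto
  ultimately show ?thesis
    using words_card(1)[of k] by (simp add: sum.union_disjoint sum.reindex inj_on_def)
qed

lemma norm_sum4:
  fixes x :: complex
  shows "cmod (x - y + z + w) \<le> cmod x + cmod y + cmod z + cmod w"
  using norm_triangle_ineq[of "x - y + z" w] norm_triangle_ineq[of "x - y" z] norm_triangle_ineq4[of x y] by linarith

text \<open>Hybrid over the output bits. The indicator of the last bit is half of 1 plus or minus
  its sign, so the gap for k + 1 bits is half the combination of two signed sums for bit
  \<open>k\<close> and two gaps for \<open>k\<close> bits. The errors satisfy (e + e + k e + k e) /
  2 = (k + 1) e.\<close>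

lemma secure_trev:
  fixes code :: "'w \<Rightarrow> (nat \<Rightarrow> bool) \<Rightarrow> bool" and e eps :: real
  assumes one: "\<And>i r V. i < m \<Longrightarrow> (\<And>w. w \<in> W \<Longrightarrow> densf d (r w)) \<Longrightarrow> (\<And>s y. V s y \<in> contractions d) \<Longrightarrow>
     cmod (\<Sum>s\<in>S. \<Sum>w\<in>W. of_real (sg (trev_bit a D code i s w)) * trpair d (V s (trev a D code i s w)) (r w)) \<le> e"
    and e: "m * e \<le> eps * card S * card W"
  shows "secure d S W (words m) (trev a D code m) eps"
  unfolding secure_def
proof (intro allI impI)
  fix r :: "'w \<Rightarrow> nat \<Rightarrow> nat \<Rightarrow> complex" and V :: "(nat \<times> nat \<Rightarrow> bool) \<Rightarrow> bool list \<Rightarrow> nat \<Rightarrow> nat \<Rightarrow> complex"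
  assume r: "\<forall>w\<in>W. densf d (r w)" and "\<forall>s y. V s y \<in> contractions d"
  then have V: "\<And>s y. V s y \<in> contractions d" by blast
  have "cmod (gap d S W (words k) (trev a D code k) V r) \<le> k * e"
    if "k \<le> m" "\<And>s y. V s y \<in> contractions d" for k V
    using that
  proof (induction k arbitrary: V)
    case 0
    then show ?case by (simp add: trev_def)
  next
    case (Suc k)
    define t where "t = (\<lambda>b s w. trpair d (V s (trev a D code k s w @ [b])) (r w))"
    define av where "av = (\<lambda>b s w. (\<Sum>y\<in>words k. trpair d (V s (y @ [b])) (r w)) / of_nat (card (words k)))"
    define bt where "bt = (\<lambda>s w. complex_of_real (sg (trev_bit a D code k s w)))"
    have step: "trpair d (V s (trev a D code (Suc k) s w)) (r w) - (\<Sum>y\<in>words (Suc k). trpair d (V s y) (r w)) / of_nat (card (words (Suc k)))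
       = (bt s w * t False s w - bt s w * t True s w + (t False s w - av False s w) + (t True s w - av True s w)) / 2" for s w
      unfolding sum_words_Suc words_card t_def av_def bt_def sg_def
      by (cases "trev_bit a D code k s w") (simp_all add: trev_def field_simps)
    have eq: "(gap d S W (words (Suc k)) (trev a D code (Suc k)) V r)
       = ((\<Sum>s\<in>S. \<Sum>w\<in>W. bt s w * t False s w) - (\<Sum>s\<in>S. \<Sum>w\<in>W. bt s w * t True s w)
          + (\<Sum>s\<in>S. \<Sum>w\<in>W. t False s w - av False s w) + (\<Sum>s\<in>S. \<Sum>w\<in>W. t True s w - av True s w)) / 2"
      unfolding step by (simp only: sum_divide_distrib[symmetric] sum.distrib sum_subtractf)
    have "cmod (gap d S W (words (Suc k)) (trev a D code (Suc k)) V r)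
       = cmod ((\<Sum>s\<in>S. \<Sum>w\<in>W. bt s w * t False s w) - (\<Sum>s\<in>S. \<Sum>w\<in>W. bt s w * t True s w)
          + (\<Sum>s\<in>S. \<Sum>w\<in>W. t False s w - av False s w) + (\<Sum>s\<in>S. \<Sum>w\<in>W. t True s w - av True s w)) / 2"
      unfolding eq norm_divide by simp
    also have "\<dots> \<le> (e + e + k * e + k * e) / 2"
    proof (intro divide_right_mono order.trans[OF norm_sum4] add_mono)
      show "cmod (\<Sum>s\<in>S. \<Sum>w\<in>W. bt s w * t False s w) \<le> e" unfolding bt_def t_def
        by (rule one[where V = "\<lambda>s y. V s (y @ [False])"]) (use Suc.prems r in auto)
      show "cmod (\<Sum>s\<in>S. \<Sum>w\<in>W. bt s w * t True s w) \<le> e" unfolding bt_def t_def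
        by (rule one[where V = "\<lambda>s y. V s (y @ [True])"]) (use Suc.prems r in auto)
      show "cmod (\<Sum>s\<in>S. \<Sum>w\<in>W. t False s w - av False s w) \<le> k * e" unfolding t_def av_def
        by (rule Suc.IH[where V = "\<lambda>s y. V s (y @ [False])"]) (use Suc.prems in auto)
      show "cmod (\<Sum>s\<in>S. \<Sum>w\<in>W. t True s w - av True s w) \<le> k * e" unfolding t_def av_def
        by (rule Suc.IH[where V = "\<lambda>s y. V s (y @ [True])"]) (use Suc.prems in auto)
    qed auto
    finally show ?case by (simp add: algebra_simps)
  qed
  from order.trans[OF this[OF order_refl V] e]
  show "cmod (gap d S W (words m) (trev a D code m) V r) \<le> eps * card S * card W" .
qed

section \<open>Balanced fibres and several sources\<close>

lemma secureD:
  "secure d S W Y f eps \<Longrightarrow> (\<And>w. w \<in> W \<Longrightarrow> densf d (r w)) \<Longrightarrow> (\<And>s y. V s y \<in> contractions d) \<Longrightarrow>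
     cmod (gap d S W Y f V r)
       \<le> eps * card S * card W"
  unfolding secure_def by blast

section \<open>Redistribution to equal fibres\<close>

lemma exists_fun_fibres:
  fixes n :: "'y \<Rightarrow> nat"
  assumes "finite Y" "finite L" "(\<Sum>y\<in>Y. n y) = card L"
  shows "\<exists>g. g ` L \<subseteq> Y \<and> (\<forall>y\<in>Y. card {w\<in>L. g w = y} = n y)"
  using assms
proof (induction Y arbitrary: L rule: finite_induct)
  case (insert y Y)
  then have "n y \<le> card L" by simp
  then obtain B where B: "B \<subseteq> L" "card B = n y" by (meson obtain_subset_with_card_n)
  have fB: "finite B" using B insert.prems finite_subset by blast
  have "(\<Sum>y\<in>Y. n y) = card (L - B)"
    using insert B fB by (simp add: card_Diff_subset)
  then obtain g where g: "g ` (L - B) \<subseteq> Y" "\<forall>y\<in>Y. card {w\<in>L - B. g w = y} = n y"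
    using insert.IH[of "L - B"] insert.prems by auto
  define g' where "g' = (\<lambda>w. if w \<in> B then y else g w)"
  have yY: "y \<notin> Y" by fact
  have "{w\<in>L. g' w = y} = B" using B(1) g(1) yY unfolding g'_def by auto
  moreover have "{w\<in>L. g' w = y'} = {w\<in>L - B. g w = y'}" if "y' \<in> Y" for y'
    using B(1) that yY unfolding g'_def by auto
  moreover have "g' ` L \<subseteq> insert y Y" using g(1) unfolding g'_def by auto
  ultimately show ?case using g(2) B(2) by (intro exI[of _ g']) auto
qed auto

text \<open>Up to \<open>k\<close> elements of every fibre keep their value. The remaining ones are
  exactly as many as are missing elsewhere and are distributed over the gaps; only they can change,
  and their number is the total excess.\<close>

lemma exists_balanced_fun:
  fixes f :: "'w \<Rightarrow> 'y"
  assumes fin: "finite W" "finite Y" and f: "f ` W \<subseteq> Y" and card: "card W = k * card Y"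
  shows "\<exists>g. g ` W \<subseteq> Y \<and> (\<forall>y\<in>Y. card {w\<in>W. g w = y} = k) \<and>
    card {w\<in>W. f w \<noteq> g w} \<le> (\<Sum>y\<in>Y. card {w\<in>W. f w = y} - k)"
proof -
  define F where "F = (\<lambda>y. {w\<in>W. f w = y})"
  have fF: "finite (F y)" for y unfolding F_def using fin by simp
  have ex: "\<exists>B. B \<subseteq> F y \<and> card B = min k (card (F y))" for y
    by (rule obtain_subset_with_card_n[OF min.cobounded2[of k "card (F y)"]]) blast
  define A where "A = (\<lambda>y. SOME B. B \<subseteq> F y \<and> card B = min k (card (F y)))"
  have A: "A y \<subseteq> F y" "card (A y) = min k (card (F y))" for y
    using someI_ex[OF ex[of y]] unfolding A_def by auto
  define L where "L = W - (\<Union>y\<in>Y. A y)"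
  have fA: "finite (A y)" for y using A(1) fF finite_subset by blast
  have AW: "(\<Union>y\<in>Y. A y) \<subseteq> W" using A(1) unfolding F_def by blast
  have disj: "A y \<inter> A y' = {}" if "y \<noteq> y'" for y y' using A(1)[of y] A(1)[of y'] that unfolding F_def by auto
  have cA: "card (\<Union>y\<in>Y. A y) = (\<Sum>y\<in>Y. min k (card (F y)))"
    using fin fA disj by (subst card_UN_disjoint) (auto simp: A(2))
  have cW: "card W = (\<Sum>y\<in>Y. card (F y))"
  proof -
    have "W = (\<Union>y\<in>Y. F y)" using f unfolding F_def by auto
    then have "card W = card (\<Union>y\<in>Y. F y)" by simp
    also have "\<dots> = (\<Sum>y\<in>Y. card (F y))" by (rule card_UN_disjoint) (use fin fF in \<open>auto simp: F_def\<close>)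
    finally show ?thesis .
  qed
  have cL: "card L + (\<Sum>y\<in>Y. min k (card (F y))) = card W"
    unfolding L_def cA[symmetric]
    using card_Diff_subset[OF finite_subset[OF AW fin(1)] AW] card_mono[OF fin(1) AW] by simp
  have "(\<Sum>y\<in>Y. k - min k (card (F y))) + (\<Sum>y\<in>Y. min k (card (F y))) = card W"
    unfolding sum.distrib[symmetric] card by simp
  then have defi: "(\<Sum>y\<in>Y. k - min k (card (F y))) = card L" using cL by linarith
  have "(\<Sum>y\<in>Y. card (F y) - k) + (\<Sum>y\<in>Y. min k (card (F y))) = (\<Sum>y\<in>Y. card (F y))"
    unfolding sum.distrib[symmetric] by (intro sum.cong) auto
  then have exc: "card L = (\<Sum>y\<in>Y. card (F y) - k)" using cL cW by linarith
  have fL: "finite L" unfolding L_def using fin by simp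
  obtain g where g: "g ` L \<subseteq> Y" "\<forall>y\<in>Y. card {w\<in>L. g w = y} = k - min k (card (F y))"
    using exists_fun_fibres[OF fin(2) fL defi] by blast
  define h where "h = (\<lambda>w. if w \<in> L then g w else f w)"
  have "card {w\<in>W. h w = y} = k" if y: "y \<in> Y" for y
  proof -
    have "{w\<in>W. h w = y} = {w\<in>L. g w = y} \<union> A y"
    proof (intro Set.set_eqI iffI)
      fix w assume w: "w \<in> {w\<in>W. h w = y}"
      show "w \<in> {w\<in>L. g w = y} \<union> A y"
      proof (cases "w \<in> L")
        case False
        then obtain y' where y': "y' \<in> Y" "w \<in> A y'" using w unfolding L_def by auto
        then have "f w = y'" using A(1)[of y'] unfolding F_def by auto
        then show ?thesis using False w y' unfolding h_def by simp
      qed (use w in \<open>simp add: h_def\<close>)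
    next
      fix w assume w: "w \<in> {w\<in>L. g w = y} \<union> A y"
      show "w \<in> {w\<in>W. h w = y}"
      proof (cases "w \<in> L")
        case True
        then have "g w = y" using w y unfolding L_def by auto
        then show ?thesis using True unfolding h_def L_def by simp
      next
        case False
        then have "w \<in> A y" using w by simp
        then show ?thesis using False A(1)[of y] unfolding h_def F_def by auto
      qed
    qed
    moreover have "{w\<in>L. g w = y} \<inter> A y = {}" using y unfolding L_def by auto
    ultimately have "card {w\<in>W. h w = y} = card {w\<in>L. g w = y} + card (A y)"
      using fL fA by (simp add: card_Un_disjoint)
    then show ?thesis using g(2) y A(2) by simp
  qed
  moreover have "h ` W \<subseteq> Y" using g(1) f unfolding h_def by auto
  moreover have "card {w\<in>W. f w \<noteq> h w} \<le> card L"
    by (rule card_mono[OF fL]) (auto simp: h_def)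
  ultimately show ?thesis unfolding exc F_def by blast
qed

lemma densf_exists: "d > 0 \<Longrightarrow> \<exists>r. densf d r"
proof -
  assume d: "d > 0"
  define r :: "nat \<Rightarrow> nat \<Rightarrow> complex" where "r = (\<lambda>i j. (if i = 0 then 1 else 0) * (if j = 0 then 1 else 0))"
  have "qform d r x = of_real ((cmod (x 0))\<^sup>2)" for x
  proof -
    have "qform d r x = (\<Sum>i<d. (if i = 0 then 1 else 0) * (cnj (x i) * (\<Sum>j<d. (if j = 0 then 1 else 0) * x j)))"
      unfolding qform_def r_def by (simp only: sum_distrib_left mult_ac)
    also have "\<dots> = x 0 * cnj (x 0)" using d by (simp only: sum_delta_left mult.commute)
    finally show ?thesis unfolding complex_norm_square .
  qed
  moreover have "(\<Sum>i<d. r i i) = 1"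
    unfolding r_def by (subst sum_delta_left) (use d in auto)
  ultimately have "densf d r" unfolding densf_def posf_def by simp
  then show ?thesis by blast
qed

text \<open>Security itself bounds the imbalance: for the test that is the identity on overfull
  values and zero elsewhere, applied to a constant state, the gap equals the total excess.\<close>

lemma secure_excess:
  fixes eps :: real
  assumes sec: "secure d S W Y f eps" and d: "d > 0" and fin: "finite W" "finite Y" "Y \<noteq> {}"
    and card: "card W = k * card Y"
  shows "(\<Sum>s\<in>S. \<Sum>y\<in>Y. real (card {w\<in>W. f s w = y} - k)) \<le> eps * card S * card W"
proof -
  obtain r where r: "densf d r" using densf_exists[OF d] by blast
  define big where "big = (\<lambda>s y. y \<in> Y \<and> card {w\<in>W. f s w = y} > k)"
  define V where "V = (\<lambda>s y (i::nat) j. if i = j then (if big s y then 1 else 0) else 0 :: complex)"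
  have V: "V s y \<in> contractions d" for s y unfolding V_def by (rule contraction_diag) auto
  have t: "trpair d (V s y) r = of_real (if big s y then 1 else 0)" for s y
  proof -
    have "trpair d (V s y) r = (\<Sum>i<d. \<Sum>j<d. (if i = j then 1 else 0) * ((if big s y then 1 else 0) * r j i))"
      unfolding trpair_def V_def by (intro sum.cong refl) auto
    also have "\<dots> = (\<Sum>i<d. (if big s y then 1 else 0) * r i i)"
      by (intro sum.cong refl) (simp only: sum_delta_left lessThan_iff)
    also have "\<dots> = (if big s y then 1 else 0)" using densfD(2)[OF r] by (simp add: sum_distrib_left[symmetric])
    finally show ?thesis by simp
  qed
  have inner: "(\<Sum>w\<in>W. (if big s (f s w) then 1 else 0) - (\<Sum>y\<in>Y. if big s y then 1 else 0) / real (card Y)) = (\<Sum>y\<in>Y. real (card {w\<in>W. f s w = y} - k))" for s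
  proof -
    have "(\<Sum>w\<in>W. if big s (f s w) then 1 else 0 :: real) = (\<Sum>w\<in>W. \<Sum>y\<in>Y. if f s w = y \<and> big s y then 1 else 0)"
    proof (intro sum.cong refl)
      fix w
      have "(\<Sum>y\<in>Y. if f s w = y \<and> big s y then 1 else 0 :: real) = (\<Sum>y\<in>Y. if y = f s w then (if big s (f s w) then 1 else 0) else 0)"
        by (intro sum.cong) auto
      also have "\<dots> = (if big s (f s w) then 1 else 0)" using fin by (auto simp: big_def)
      finally show "(if big s (f s w) then 1 else 0 :: real) = (\<Sum>y\<in>Y. if f s w = y \<and> big s y then 1 else 0)" ..
    qed
    also have "\<dots> = (\<Sum>y\<in>Y. \<Sum>w\<in>W. if f s w = y \<and> big s y then 1 else 0)" by (rule sum.swap)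
    also have "\<dots> = (\<Sum>y\<in>Y. if big s y then real (card {w\<in>W. f s w = y}) else 0)"
    proof (intro sum.cong refl)
      fix y
      have "(\<Sum>w\<in>W. if f s w = y then 1 else 0 :: real) = card {w\<in>W. f s w = y}"
        using fin by (simp add: sum.If_cases Int_def)
      then show "(\<Sum>w\<in>W. if f s w = y \<and> big s y then 1 else 0 :: real) = (if big s y then real (card {w\<in>W. f s w = y}) else 0)" by simp
    qed
    finally have a: "(\<Sum>w\<in>W. if big s (f s w) then 1 else 0 :: real) = (\<Sum>y\<in>Y. if big s y then real (card {w\<in>W. f s w = y}) else 0)" .
    have "(\<Sum>w\<in>W. (\<Sum>y\<in>Y. if big s y then 1 else 0) / real (card Y)) = k * (\<Sum>y\<in>Y. if big s y then 1 else 0 :: real)"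
      unfolding sum_constant card using fin by (simp add: card_gt_0_iff)
    also have "\<dots> = (\<Sum>y\<in>Y. if big s y then real k else 0)"
      unfolding sum_distrib_left by (intro sum.cong) auto
    finally have b: "(\<Sum>w\<in>W. (\<Sum>y\<in>Y. if big s y then 1 else 0) / real (card Y)) = (\<Sum>y\<in>Y. if big s y then real k else 0)" .
    show ?thesis unfolding sum_subtractf a b
      unfolding sum_subtractf[symmetric] by (intro sum.cong refl) (auto simp: big_def of_nat_diff)
  qed
  have "(\<Sum>s\<in>S. \<Sum>w\<in>W. trpair d (V s (f s w)) r - (\<Sum>y\<in>Y. trpair d (V s y) r) / of_nat (card Y))
     = of_real (\<Sum>s\<in>S. \<Sum>w\<in>W. (if big s (f s w) then 1 else 0) - (\<Sum>y\<in>Y. if big s y then 1 else 0) / real (card Y))"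
    unfolding t by simp
  then have "cmod (of_real (\<Sum>s\<in>S. \<Sum>y\<in>Y. real (card {w\<in>W. f s w = y} - k))) \<le> eps * card S * card W"
    using secureD[OF sec, of "\<lambda>_. r" V] r V unfolding inner by simp
  then show ?thesis unfolding norm_of_real by linarith
qed

text \<open>A changed word moves its pairing by at most 2, and on average over the seed at most a
  fraction \<open>eps\<close> of the words is changed; together with the original error this makes 3
  * eps.\<close>

lemma secure_balanced:
  fixes eps :: real and f :: "'s \<Rightarrow> 'w \<Rightarrow> 'y"
  assumes sec: "secure d S W Y f eps" and d: "d > 0" and fin: "finite W" "finite Y" "Y \<noteq> {}"
    and card: "card W = k * card Y" and f: "\<And>s. f s ` W \<subseteq> Y"
  shows "\<exists>g. (\<forall>s. g s ` W \<subseteq> Y \<and> (\<forall>y\<in>Y. card {w\<in>W. g s w = y} = k)) \<and> secure d S W Y g (3 * eps)"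
proof -
  have "\<forall>s. \<exists>g. g ` W \<subseteq> Y \<and> (\<forall>y\<in>Y. card {w\<in>W. g w = y} = k) \<and>
    card {w\<in>W. f s w \<noteq> g w} \<le> (\<Sum>y\<in>Y. card {w\<in>W. f s w = y} - k)"
    using exists_balanced_fun[OF fin(1,2) f card] by blast
  from choice[OF this] obtain g where
    g0: "\<forall>s. g s ` W \<subseteq> Y \<and> (\<forall>y\<in>Y. card {w\<in>W. g s w = y} = k) \<and>
      card {w\<in>W. f s w \<noteq> g s w} \<le> (\<Sum>y\<in>Y. card {w\<in>W. f s w = y} - k)" by blast
  have g: "\<And>s. g s ` W \<subseteq> Y" "\<And>s y. y \<in> Y \<Longrightarrow> card {w\<in>W. g s w = y} = k"
    "\<And>s. card {w\<in>W. f s w \<noteq> g s w} \<le> (\<Sum>y\<in>Y. card {w\<in>W. f s w = y} - k)" using g0 by blast+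
  have "(\<Sum>s\<in>S. real (card {w\<in>W. f s w \<noteq> g s w})) \<le> (\<Sum>s\<in>S. \<Sum>y\<in>Y. real (card {w\<in>W. f s w = y} - k))"
  proof (rule sum_mono)
    fix s
    have "real (card {w\<in>W. f s w \<noteq> g s w}) \<le> real (\<Sum>y\<in>Y. card {w\<in>W. f s w = y} - k)" using g(3) by (rule of_nat_mono)
    then show "real (card {w\<in>W. f s w \<noteq> g s w}) \<le> (\<Sum>y\<in>Y. real (card {w\<in>W. f s w = y} - k))" by simp
  qed
  also have "\<dots> \<le> eps * card S * card W" by (rule secure_excess[OF sec d fin card])
  finally have diff: "(\<Sum>s\<in>S. real (card {w\<in>W. f s w \<noteq> g s w})) \<le> eps * card S * card W" .
  have "secure d S W Y g (3 * eps)"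
    unfolding secure_def
  proof (intro allI impI)
    fix r and V :: "'s \<Rightarrow> 'y \<Rightarrow> nat \<Rightarrow> nat \<Rightarrow> complex"
    assume r: "\<forall>w\<in>W. densf d (r w)" and V: "\<forall>s y. V s y \<in> contractions d"
    have V': "V s y \<in> contractions d" for s y using V by simp
    let ?av = "\<lambda>s w. (\<Sum>y\<in>Y. trpair d (V s y) (r w)) / of_nat (card Y)"
    let ?e = "\<lambda>s w. trpair d (V s (g s w)) (r w) - trpair d (V s (f s w)) (r w)"
    have e: "cmod (\<Sum>s\<in>S. \<Sum>w\<in>W. ?e s w) \<le> (\<Sum>s\<in>S. 2 * real (card {w\<in>W. f s w \<noteq> g s w}))"
    proof (rule order.trans[OF norm_sum sum_mono])
      fix s
      have "(\<Sum>w\<in>W. ?e s w) = (\<Sum>w\<in>{w\<in>W. f s w \<noteq> g s w}. ?e s w)"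
        using fin by (intro sum.mono_neutral_right) auto
      also have "cmod \<dots> \<le> (\<Sum>w\<in>{w\<in>W. f s w \<noteq> g s w}. 2)"
      proof (rule order.trans[OF norm_sum sum_mono])
        fix w assume "w \<in> {w\<in>W. f s w \<noteq> g s w}"
        then have rw: "densf d (r w)" using r by simp
        have 1: "cmod (trpair d (V s y) (r w)) \<le> 1" for y by (rule trpair_densf_le[OF V' rw])
        show "cmod (?e s w) \<le> 2"
          using norm_triangle_ineq4[of "trpair d (V s (g s w)) (r w)" "trpair d (V s (f s w)) (r w)"] 1[of "g s w"] 1[of "f s w"] by linarith
      qed
      finally show "cmod (\<Sum>w\<in>W. ?e s w) \<le> 2 * real (card {w\<in>W. f s w \<noteq> g s w})" by simp
    qed
    have "(\<Sum>s\<in>S. \<Sum>w\<in>W. trpair d (V s (g s w)) (r w) - ?av s w) = (\<Sum>s\<in>S. \<Sum>w\<in>W. trpair d (V s (f s w)) (r w) - ?av s w) + (\<Sum>s\<in>S. \<Sum>w\<in>W. ?e s w)"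
      unfolding sum.distrib[symmetric] by (intro sum.cong refl) simp
    then have "cmod (\<Sum>s\<in>S. \<Sum>w\<in>W. trpair d (V s (g s w)) (r w) - ?av s w) \<le> cmod (\<Sum>s\<in>S. \<Sum>w\<in>W. trpair d (V s (f s w)) (r w) - ?av s w) + cmod (\<Sum>s\<in>S. \<Sum>w\<in>W. ?e s w)"
      by (simp only: norm_triangle_ineq)
    also have "\<dots> \<le> eps * card S * card W + 2 * (eps * card S * card W)"
    proof (rule add_mono)
      show "cmod (\<Sum>s\<in>S. \<Sum>w\<in>W. trpair d (V s (f s w)) (r w) - ?av s w) \<le> eps * card S * card W"
        by (rule secureD[OF sec, where r = r and V = V]) (use r V' in auto)
      show "cmod (\<Sum>s\<in>S. \<Sum>w\<in>W. ?e s w) \<le> 2 * (eps * card S * card W)"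
        using e diff unfolding sum_distrib_left[symmetric] by linarith
    qed
    finally show "cmod (\<Sum>s\<in>S. \<Sum>w\<in>W. trpair d (V s (g s w)) (r w) - ?av s w) \<le> 3 * eps * card S * card W" by simp
  qed
  then show ?thesis using g(1,2) by blast
qed

section \<open>Extraction from several sources with one seed\<close>

lemma sum_PiE_insert:
  fixes h :: "('i \<Rightarrow> 'w) \<Rightarrow> 'c :: comm_monoid_add"
  assumes "j \<notin> J"
  shows "(\<Sum>w\<in>PiE (insert j J) B. h w) = (\<Sum>w\<in>PiE J B. \<Sum>x\<in>B j. h (w(j := x)))"
proof -
  have "inj_on (\<lambda>(y, g). g(j := y)) (B j \<times> PiE J B)" by (rule inj_combinator[OF assms])
  then have "(\<Sum>w\<in>PiE (insert j J) B. h w) = (\<Sum>p\<in>B j \<times> PiE J B. h ((\<lambda>(y, g). g(j := y)) p))"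
    unfolding PiE_insert_eq by (rule sum.reindex_cong) auto
  also have "\<dots> = (\<Sum>x\<in>B j. \<Sum>w\<in>PiE J B. h (w(j := x)))"
    unfolding sum.cartesian_product by (intro sum.cong) auto
  also have "\<dots> = (\<Sum>w\<in>PiE J B. \<Sum>x\<in>B j. h (w(j := x)))" by (rule sum.swap)
  finally show ?thesis .
qed

text \<open>Hybrid over the coordinates. With the other words fixed, the joint state is a
  \<open>d\<close>-dimensional encoding of one word, however many words there are. One seed suffices
  because the outputs at the fixed words are functions of the seed, on which the test may
  depend.\<close>

lemma secure_product:
  fixes eps :: real and f :: "'s \<Rightarrow> 'w \<Rightarrow> 'y" and J :: "'i set"
  assumes sec: "secure d S W Y f eps" and fin: "finite W" "finite Y" "Y \<noteq> {}" and J: "finite J"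
  shows "secure d S (PiE J (\<lambda>_. W)) (PiE J (\<lambda>_. Y)) (\<lambda>s w. restrict (\<lambda>j. f s (w j)) J) (card J * eps)"
  using J
proof (induction J rule: finite_induct)
  case empty
  then show ?case by (simp add: secure_def)
next
  case (insert j J)
  let ?W = "\<lambda>J. PiE J (\<lambda>_. W)" and ?Y = "\<lambda>J. PiE J (\<lambda>_. Y)"
  let ?F = "\<lambda>J s w. restrict (\<lambda>j. f s (w j)) J"
  have cW: "card (?W J) = card W ^ card J" "card (?W (insert j J)) = card W * card (?W J)"
    using insert.hyps by (auto simp: card_PiE)
  have cY: "card (?Y (insert j J)) = card Y * card (?Y J)"
    using insert.hyps by (auto simp: card_PiE)
  show ?case
    unfolding secure_def
  proof (intro allI impI)
    fix r and V :: "'s \<Rightarrow> ('i \<Rightarrow> 'y) \<Rightarrow> nat \<Rightarrow> nat \<Rightarrow> complex"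
    assume r: "\<forall>w\<in>?W (insert j J). densf d (r w)" and V: "\<forall>s y. V s y \<in> contractions d"
    have r': "densf d (r (w(j := x)))" if "w \<in> ?W J" "x \<in> W" for w x
      using r that by (auto intro!: PiE_fun_upd)
    define t where "t = (\<lambda>s y w x. trpair d (V s y) (r (w(j := x))))"
    \<comment> \<open>\<open>A\<close> replaces the value at \<open>j\<close> by a uniform one while
      the other words are fixed; \<open>B b\<close> then replaces the remaining values with the
      value at \<open>j\<close> fixed to \<open>b\<close>.\<close>
    define A where "A = (\<lambda>s w x. t s ((?F J s w)(j := f s x)) w x - (\<Sum>b\<in>Y. t s ((?F J s w)(j := b)) w x) / of_nat (card Y))"
    define B where "B = (\<lambda>b s w x. t s ((?F J s w)(j := b)) w x - (\<Sum>y\<in>?Y J. t s (y(j := b)) w x) / of_nat (card (?Y J)))"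
    have F: "?F (insert j J) s (w(j := x)) = (?F J s w)(j := f s x)" for s w x
      using insert.hyps by (auto simp: fun_eq_iff restrict_def)
    have step: "trpair d (V s (?F (insert j J) s (w(j := x)))) (r (w(j := x))) - (\<Sum>y\<in>?Y (insert j J). trpair d (V s y) (r (w(j := x)))) / of_nat (card (?Y (insert j J)))
       = A s w x + (\<Sum>b\<in>Y. B b s w x) / of_nat (card Y)" for s w x
    proof -
      have "(\<Sum>b\<in>Y. B b s w x) = (\<Sum>b\<in>Y. t s ((?F J s w)(j := b)) w x) - (\<Sum>y\<in>?Y J. \<Sum>b\<in>Y. t s (y(j := b)) w x) / of_nat (card (?Y J))"
        unfolding B_def sum_subtractf sum_divide_distrib[symmetric] by (subst sum.swap) (rule refl)
      then show ?thesis unfolding F A_def cY sum_PiE_insert[OF insert.hyps(2)] t_def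
        by (simp add: diff_divide_distrib mult.commute)
    qed
    have "(gap d S (?W (insert j J)) (?Y (insert j J)) (?F (insert j J)) V r)
      = (\<Sum>s\<in>S. \<Sum>w\<in>?W J. \<Sum>x\<in>W. A s w x) + (\<Sum>s\<in>S. \<Sum>w\<in>?W J. \<Sum>x\<in>W. (\<Sum>b\<in>Y. B b s w x) / of_nat (card Y))"
      unfolding sum_PiE_insert[OF insert.hyps(2), of _ "\<lambda>_. W"] step sum.distrib ..
    also have "(\<Sum>s\<in>S. \<Sum>w\<in>?W J. \<Sum>x\<in>W. A s w x) = (\<Sum>w\<in>?W J. \<Sum>s\<in>S. \<Sum>x\<in>W. A s w x)" by (rule sum.swap)
    also have "(\<Sum>s\<in>S. \<Sum>w\<in>?W J. \<Sum>x\<in>W. (\<Sum>b\<in>Y. B b s w x) / of_nat (card Y)) = (\<Sum>x\<in>W. \<Sum>b\<in>Y. \<Sum>s\<in>S. \<Sum>w\<in>?W J. B b s w x) / of_nat (card Y)"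
      unfolding sum_divide_distrib[symmetric] by (subst sum4_swap) (rule refl)
    finally have eq: "(gap d S (?W (insert j J)) (?Y (insert j J)) (?F (insert j J)) V r)
      = (\<Sum>w\<in>?W J. \<Sum>s\<in>S. \<Sum>x\<in>W. A s w x) + (\<Sum>x\<in>W. \<Sum>b\<in>Y. \<Sum>s\<in>S. \<Sum>w\<in>?W J. B b s w x) / of_nat (card Y)" .
    have 1: "cmod (\<Sum>w\<in>?W J. \<Sum>s\<in>S. \<Sum>x\<in>W. A s w x) \<le> (\<Sum>w\<in>?W J. eps * card S * card W)"
    proof (rule order.trans[OF norm_sum sum_mono])
      fix w assume w: "w \<in> ?W J"
      show "cmod (\<Sum>s\<in>S. \<Sum>x\<in>W. A s w x) \<le> eps * card S * card W"
        unfolding A_def t_def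
        by (rule secureD[OF sec, where V = "\<lambda>s b. V s ((?F J s w)(j := b))" and r = "\<lambda>x. r (w(j := x))"]) (use r' w V in auto)
    qed
    have 2: "cmod (\<Sum>x\<in>W. \<Sum>b\<in>Y. \<Sum>s\<in>S. \<Sum>w\<in>?W J. B b s w x) \<le> (\<Sum>x\<in>W. \<Sum>b\<in>Y. card J * eps * card S * card (?W J))"
    proof (rule order.trans[OF norm_sum sum_mono], rule order.trans[OF norm_sum sum_mono])
      fix x b assume x: "x \<in> W"
      show "cmod (\<Sum>s\<in>S. \<Sum>w\<in>?W J. B b s w x) \<le> card J * eps * card S * card (?W J)"
        unfolding B_def t_def
        by (rule secureD[OF insert.IH, where V = "\<lambda>s y. V s (y(j := b))" and r = "\<lambda>w. r (w(j := x))"]) (use r' x V in auto)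
    qed
    have Y0: "real (card Y) > 0" using fin by (simp add: card_gt_0_iff)
    have "cmod ((\<Sum>x\<in>W. \<Sum>b\<in>Y. \<Sum>s\<in>S. \<Sum>w\<in>?W J. B b s w x) / of_nat (card Y)) \<le> card W * (card J * eps * card S * card (?W J))"
      using 2 Y0 by (simp add: norm_divide divide_le_eq mult_ac)
    then have "cmod ((\<Sum>w\<in>?W J. \<Sum>s\<in>S. \<Sum>x\<in>W. A s w x) + (\<Sum>x\<in>W. \<Sum>b\<in>Y. \<Sum>s\<in>S. \<Sum>w\<in>?W J. B b s w x) / of_nat (card Y))
       \<le> card (?W J) * (eps * card S * card W) + card W * (card J * eps * card S * card (?W J))"
      using 1 by (intro order.trans[OF norm_triangle_ineq] add_mono) simp_all
    also have "\<dots> = card (insert j J) * eps * card S * card (?W (insert j J))"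
      unfolding cW(2) using insert.hyps by (simp add: algebra_simps)
    finally show "cmod (gap d S (?W (insert j J)) (?Y (insert j J)) (?F (insert j J)) V r) \<le> card (insert j J) * eps * card S * card (?W (insert j J))"
      unfolding eq .
  qed
qed

section \<open>The secret sharing scheme\<close>

lemma mds_unique:
  assumes C: "mds p t A C" and c: "c \<in> C" "c' \<in> C" and I: "I \<subseteq> {..p}" "card I = t" and eq: "\<And>i. i \<in> I \<Longrightarrow> c i = c' i"
  shows "c = c'"
proof -
  have "c \<in> PiE {..p} (\<lambda>_. A)" using C c unfolding mds_def by blast
  then have "restrict c I \<in> PiE I (\<lambda>_. A)" using I by (auto intro!: restrict_PiE_iff[THEN iffD2])
  then have "\<exists>!c''. c'' \<in> C \<and> restrict c'' I = restrict c I" using C I unfolding mds_def by blast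
  moreover have "restrict c' I = restrict c I" using eq by (auto simp: restrict_def fun_eq_iff)
  ultimately show ?thesis using c by blast
qed

lemma mds_in: "mds p t A C \<Longrightarrow> c \<in> C \<Longrightarrow> i \<le> p \<Longrightarrow> c i \<in> A"
  unfolding mds_def by blast

text \<open>The secret and t - 1 parties form an information set, so for such \<open>I\<close> the
  described codeword exists and is unique.\<close>

definition mdsw :: "nat \<Rightarrow> (nat \<Rightarrow> 'a) set \<Rightarrow> nat set \<Rightarrow> 'a \<Rightarrow> (nat \<Rightarrow> 'a) \<Rightarrow> nat \<Rightarrow> 'a" where
  "mdsw p C I m v = (THE c. c \<in> C \<and> c p = m \<and> restrict c I = v)"

lemma mds_insert:
  assumes C: "mds p t A C" and I: "I \<subseteq> {..<p}" "card I = t - 1" and t: "t \<ge> 1"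
  shows "insert p I \<subseteq> {..p}" "card (insert p I) = t"
proof -
  have "finite I" using I finite_subset by blast
  then show "insert p I \<subseteq> {..p}" "card (insert p I) = t" using I t by (auto simp: card_insert_if)
qed

lemma mdsw_eq:
  assumes C: "mds p t A C" and I: "I \<subseteq> {..<p}" "card I = t - 1" and t: "t \<ge> 1" and c: "c \<in> C"
  shows "mdsw p C I (c p) (restrict c I) = c"
  unfolding mdsw_def
proof (rule the_equality)
  fix c' assume c': "c' \<in> C \<and> c' p = c p \<and> restrict c' I = restrict c I"
  show "c' = c"
  proof (rule mds_unique[OF C _ c mds_insert[OF C I t]])
    fix i assume i: "i \<in> insert p I"
    have r: "restrict c' I i = restrict c I i" using c' by simp
    show "c' i = c i"
    proof (cases "i \<in> I")
      case True
      then show ?thesis using r by simp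
    qed (use c' i in simp)
  qed (use c' in simp)
qed (use c in simp)

lemma mdsw_props:
  assumes C: "mds p t A C" and I: "I \<subseteq> {..<p}" "card I = t - 1" and t: "t \<ge> 1"
    and m: "m \<in> A" and v: "v \<in> PiE I (\<lambda>_. A)"
  shows "mdsw p C I m v \<in> C" "mdsw p C I m v p = m" "restrict (mdsw p C I m v) I = v"
proof -
  have pI: "p \<notin> I" using I by auto
  have "v(p := m) \<in> PiE (insert p I) (\<lambda>_. A)" using m v by (auto intro!: PiE_fun_upd)
  then obtain c where c: "c \<in> C" "restrict c (insert p I) = v(p := m)"
    using C mds_insert[OF C I t] unfolding mds_def by blast
  have "c p = m" using fun_cong[OF c(2), of p] by simp
  moreover have "restrict c I = v"
  proof (rule ext)
    fix i show "restrict c I i = v i"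
      using fun_cong[OF c(2), of i] pI PiE_arb[OF v, of i] by (cases "i \<in> I") auto
  qed
  ultimately have "mdsw p C I m v = c" using mdsw_eq[OF C I t c(1)] by simp
  then show "mdsw p C I m v \<in> C" "mdsw p C I m v p = m" "restrict (mdsw p C I m v) I = v"
    using c(1) \<open>c p = m\<close> \<open>restrict c I = v\<close> by auto
qed

text \<open>Coordinates on \<open>I\<close> and the secret vary freely and independently. For the
  code of the seed this says that t - 1 seed shares carry no information about the seed.\<close>

lemma mds_sum:
  assumes C: "mds p t A C" and I: "I \<subseteq> {..<p}" "card I = t - 1" and t: "t \<ge> 1"
  shows "(\<Sum>c\<in>C. g c) = (\<Sum>v\<in>PiE I (\<lambda>_. A). \<Sum>m\<in>A. g (mdsw p C I m v))"
proof -
  have "(\<Sum>c\<in>C. g c) = (\<Sum>x\<in>PiE I (\<lambda>_. A) \<times> A. g (mdsw p C I (snd x) (fst x)))"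
  proof (rule sum.reindex_bij_witness[where i = "\<lambda>x. mdsw p C I (snd x) (fst x)" and j = "\<lambda>c. (restrict c I, c p)"])
    fix c assume c: "c \<in> C"
    have "c i \<in> A" if "i \<in> I" for i using mds_in[OF C c, of i] I(1) that by force
    then show "(restrict c I, c p) \<in> PiE I (\<lambda>_. A) \<times> A" using mds_in[OF C c, of p] by (simp add: restrict_PiE_iff)
    show "mdsw p C I (snd (restrict c I, c p)) (fst (restrict c I, c p)) = c"
      using mdsw_eq[OF C I t c] by simp
    show "g (mdsw p C I (snd (restrict c I, c p)) (fst (restrict c I, c p))) = g c"
      using mdsw_eq[OF C I t c] by simp
  next
    fix x assume "x \<in> PiE I (\<lambda>_. A) \<times> A"
    then have x: "fst x \<in> PiE I (\<lambda>_. A)" "snd x \<in> A" by auto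
    note pr = mdsw_props[OF C I t x(2,1)]
    show "(restrict (mdsw p C I (snd x) (fst x)) I, mdsw p C I (snd x) (fst x) p) = x" using pr by simp
    show "mdsw p C I (snd x) (fst x) \<in> C" by (rule pr(1))
  qed
  then show ?thesis unfolding sum.cartesian_product by (simp add: case_prod_beta)
qed

definition glue :: "'i set \<Rightarrow> ('i \<Rightarrow> 'a) \<Rightarrow> ('i \<Rightarrow> 'a) \<Rightarrow> 'i \<Rightarrow> 'a" where
  "glue I u v = (\<lambda>i. if i \<in> I then u i else v i)"

lemma sum_PiE_glue:
  assumes "I \<inter> J = {}"
  shows "(\<Sum>w\<in>PiE (I \<union> J) B. g w) = (\<Sum>u\<in>PiE I B. \<Sum>v\<in>PiE J B. g (glue I u v))"
proof -
  have "(\<Sum>w\<in>PiE (I \<union> J) B. g w) = (\<Sum>x\<in>PiE I B \<times> PiE J B. g (glue I (fst x) (snd x)))"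
  proof (rule sum.reindex_bij_witness[where i = "\<lambda>x. glue I (fst x) (snd x)" and j = "\<lambda>w. (restrict w I, restrict w J)"])
    fix w assume w: "w \<in> PiE (I \<union> J) B"
    have eq: "glue I (restrict w I) (restrict w J) = w"
      using PiE_arb[OF w] unfolding glue_def by (auto simp: fun_eq_iff restrict_def)
    then show "glue I (fst (restrict w I, restrict w J)) (snd (restrict w I, restrict w J)) = w" by simp
    show "g (glue I (fst (restrict w I, restrict w J)) (snd (restrict w I, restrict w J))) = g w" using eq by simp
    show "(restrict w I, restrict w J) \<in> PiE I B \<times> PiE J B" using w by (auto intro!: restrict_PiE_iff[THEN iffD2])
  next
    fix x assume "x \<in> PiE I B \<times> PiE J B"
    then have x: "fst x \<in> PiE I B" "snd x \<in> PiE J B" by auto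
    show "glue I (fst x) (snd x) \<in> PiE (I \<union> J) B"
      using x PiE_arb[OF x(2)] unfolding glue_def by (auto intro!: PiE_I dest: PiE_mem)
    have "restrict (glue I (fst x) (snd x)) I = fst x"
    proof (rule ext)
      fix i show "restrict (glue I (fst x) (snd x)) I i = fst x i"
        using PiE_arb[OF x(1), of i] unfolding glue_def by (cases "i \<in> I") auto
    qed
    moreover have "restrict (glue I (fst x) (snd x)) J = snd x"
    proof (rule ext)
      fix i show "restrict (glue I (fst x) (snd x)) J i = snd x i"
        using PiE_arb[OF x(2), of i] assms unfolding glue_def by (cases "i \<in> J") auto
    qed
    ultimately show "(restrict (glue I (fst x) (snd x)) I, restrict (glue I (fst x) (snd x)) J) = x" by simp
  qed
  then show ?thesis unfolding sum.cartesian_product by (simp add: case_prod_beta)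
qed

section \<open>The dealer\<close>

text \<open>\<open>CM\<close> shares the message and \<open>CS\<close> the seed. Since all fibres of
  \<open>f s\<close> have size \<open>r\<close>, a uniform value followed by a uniform word of its
  fibre is the same as a uniform word.\<close>

locale scheme =
  fixes p t l nw ns r :: nat and f :: "bool list \<Rightarrow> bool list \<Rightarrow> bool list"
    and CM CS :: "(nat \<Rightarrow> bool list) set"
  assumes t: "1 \<le> t" "t \<le> p"
    and CM: "mds p t (words l) CM" and CS: "mds p t (words ns) CS"
    and f: "\<And>s w. w \<in> words nw \<Longrightarrow> f s w \<in> words l"
    and fibre: "\<And>s y. y \<in> words l \<Longrightarrow> card {w \<in> words nw. f s w = y} = r"
    and nw: "2 ^ nw = r * (2 ^ l :: nat)"
begin

definition fib :: "bool list \<Rightarrow> bool list \<Rightarrow> bool list set" where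
  "fib s y = {w \<in> words nw. f s w = y}"

definition deal :: "(nat \<Rightarrow> bool list) \<Rightarrow> (nat \<Rightarrow> bool list) \<Rightarrow> nat \<Rightarrow> bool list" where
  "deal sig w = (\<lambda>i. if i < p then w i @ sig i else [])"

definition codes :: "bool list \<Rightarrow> (nat \<Rightarrow> bool list) set" where
  "codes m = {y \<in> CM. y p = m}"

text \<open>The random choices of the dealer. All products of fibres have equal size, so choosing
  the seed codeword, the value codeword and the words in turn gives the uniform distribution on this
  set.\<close>

definition triples :: "bool list \<Rightarrow> ((nat \<Rightarrow> bool list) \<times> (nat \<Rightarrow> bool list) \<times> (nat \<Rightarrow> bool list)) set" where
  "triples m = (SIGMA sig:CS. SIGMA y:codes m. PiE {..<p} (\<lambda>i. fib (sig p) (y i)))"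

definition Om :: "bool list \<Rightarrow> (nat \<Rightarrow> bool list) set" where
  "Om m = (\<lambda>(sig, y, w). deal sig w) ` triples m"

lemma extend_set:
  assumes "T \<subseteq> {..<p}" "card T < t"
  shows "\<exists>T'. T \<subseteq> T' \<and> T' \<subseteq> {..<p} \<and> card T' = t - 1"
proof -
  have fT: "finite T" using assms finite_subset by blast
  have "t - 1 - card T \<le> card ({..<p} - T)" using assms t fT by (simp add: card_Diff_subset)
  then obtain U where U: "U \<subseteq> {..<p} - T" "card U = t - 1 - card T" "finite U" by (rule obtain_subset_with_card_n)
  have "card (T \<union> U) = t - 1" using U assms fT by (subst card_Un_disjoint) auto
  then show ?thesis using U assms by (intro exI[of _ "T \<union> U"]) auto
qed

lemma r_pos: "r > 0" using nw by (cases "r = 0") auto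

lemma finite_fib: "finite (fib s y)" unfolding fib_def using words_card(1)[of nw] by simp

lemma card_fib: "y \<in> words l \<Longrightarrow> card (fib s y) = r" unfolding fib_def by (rule fibre)

lemma card_fib_le: "card (fib s y) \<le> r"
proof (cases "y \<in> words l")
  case False
  then have "fib s y = {}" using f unfolding fib_def by blast
  then show ?thesis by simp
qed (simp add: card_fib)

lemma finite_CM: "finite CM" "finite CS"
proof -
  have fin: "finite (vecs n {..p})" for n by (intro finite_PiE words_card finite_atMost)
  have sub: "CM \<subseteq> vecs l {..p}" "CS \<subseteq> vecs ns {..p}"
    using CM CS by (auto simp only: mds_def)
  show "finite CM" by (rule finite_subset[OF sub(1) fin])
  show "finite CS" by (rule finite_subset[OF sub(2) fin])
qed

text \<open>The seed parts held by \<open>t\<close> parties determine the seed, the seed turns their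
  words into values, and these values determine the message codeword. The messages may differ, so
  this yields correctness as well as injectivity of \<open>deal\<close>.\<close>

lemma triples_deal_eq:
  assumes x: "(sig, y, w) \<in> triples m" and x': "(sig', y', w') \<in> triples m'"
    and I: "I \<subseteq> {..<p}" "card I \<ge> t" and eq: "\<And>i. i \<in> I \<Longrightarrow> deal sig w i = deal sig' w' i"
  shows "sig = sig' \<and> y = y' \<and> (\<forall>i\<in>I. w i = w' i)"
proof -
  have w: "w i \<in> fib (sig p) (y i)" "w' i \<in> fib (sig' p) (y' i)" if "i < p" for i
    using x x' that unfolding triples_def by auto
  have len: "length (w i) = nw" "length (w' i) = nw" if "i < p" for i using w[OF that] unfolding fib_def by auto
  have eq': "w i = w' i" "sig i = sig' i" if "i \<in> I" for i
  proof -
    have i: "i < p" using I that by auto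
    then have "w i @ sig i = w' i @ sig' i" using eq[OF that] unfolding deal_def by simp
    then show "w i = w' i" "sig i = sig' i" using len[OF i] by auto
  qed
  obtain I' where I': "I' \<subseteq> I" "card I' = t" by (rule obtain_subset_with_card_n[OF I(2)])
  have I'p: "I' \<subseteq> {..p}" using I' I by force
  have sig: "sig = sig'"
    by (rule mds_unique[OF CS _ _ I'p I'(2)]) (use x x' I' eq' in \<open>auto simp: triples_def\<close>)
  have "y = y'"
  proof (rule mds_unique[OF CM _ _ I'p I'(2)])
    fix i assume i: "i \<in> I'"
    then have "i < p" using I' I by auto
    have "y i = f (sig p) (w i)" using w(1)[OF \<open>i < p\<close>] unfolding fib_def by simp
    moreover have "y' i = f (sig' p) (w' i)" using w(2)[OF \<open>i < p\<close>] unfolding fib_def by simp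
    ultimately show "y i = y' i" using sig eq'(1) i I' by auto
  qed (use x x' in \<open>auto simp: triples_def codes_def\<close>)
  then show ?thesis using sig eq' by blast
qed

lemma deal_inj: "inj_on (\<lambda>(sig, y, w). deal sig w) (triples m)"
proof (rule inj_onI)
  fix x x' assume xx: "x \<in> triples m" "x' \<in> triples m" and eqx: "(case x of (sig, y, w) \<Rightarrow> deal sig w) = (case x' of (sig, y, w) \<Rightarrow> deal sig w)"
  obtain sig y w where xe: "x = (sig, y, w)" by (cases x)
  obtain sig' y' w' where xe': "x' = (sig', y', w')" by (cases x')
  have x: "(sig, y, w) \<in> triples m" "(sig', y', w') \<in> triples m" and eq: "deal sig w = deal sig' w'"
    using xx eqx unfolding xe xe' by auto
  have e: "sig = sig' \<and> y = y' \<and> (\<forall>i\<in>{..<p}. w i = w' i)"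
    by (rule triples_deal_eq[OF x]) (use t eq in auto)
  then have "w = w'" using x unfolding triples_def by (intro PiE_ext[of w "{..<p}" _ w']) auto
  then show "x = x'" using e unfolding xe xe' by blast
qed

lemma finite_triples: "finite (triples m)"
  unfolding triples_def codes_def using finite_CM by (intro finite_SigmaI finite_PiE finite_fib) auto

lemma finite_Om: "finite (Om m)" unfolding Om_def using finite_triples by simp

text \<open>A codeword hiding \<open>m\<close> is determined by its coordinates in a set \<open>K\<close> of \<open>t - 1\<close> parties, and
  these coordinates are arbitrary.\<close>

lemma sum_Om:
  fixes F :: "(nat \<Rightarrow> bool list) \<Rightarrow> 'c :: comm_monoid_add"
  assumes m: "m \<in> words l" and K: "K \<subseteq> {..<p}" "card K = t - 1"
  shows "(\<Sum>z\<in>Om m. F z) = (\<Sum>sig\<in>CS. \<Sum>w\<in>vecs nw K.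
      \<Sum>w'\<in>PiE ({..<p} - K) (\<lambda>i. fib (sig p) (mdsw p CM K m (restrict (\<lambda>j. f (sig p) (w j)) K) i)). F (deal sig (glue K w w')))"
proof -
  have fc: "finite (codes m)" unfolding codes_def using finite_CM by simp
  have fP: "finite (PiE I (\<lambda>i. fib s (y i)))" if "I \<subseteq> {..<p}" for I s y
    using that finite_subset by (intro finite_PiE finite_fib) blast
  have "(\<Sum>z\<in>Om m. F z) = (\<Sum>x\<in>triples m. F (case x of (sig, y, w) \<Rightarrow> deal sig w))"
    unfolding Om_def by (rule sum.reindex[OF deal_inj, unfolded o_def])
  also have "\<dots> = (\<Sum>sig\<in>CS. \<Sum>y\<in>codes m. \<Sum>w\<in>PiE {..<p} (\<lambda>i. fib (sig p) (y i)). F (deal sig w))"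
  proof -
    have "(\<Sum>y\<in>codes m. \<Sum>w\<in>PiE {..<p} (\<lambda>i. fib (sig p) (y i)). F (deal sig w))
       = (\<Sum>x\<in>(SIGMA y:codes m. PiE {..<p} (\<lambda>i. fib (sig p) (y i))). F (deal sig (snd x)))" for sig
      by (subst sum.Sigma) (auto simp: fc fP case_prod_beta)
    moreover have "finite (SIGMA y:codes m. PiE {..<p} (\<lambda>i. fib (sig p) (y i)))" for sig
      by (intro finite_SigmaI fc fP) auto
    ultimately show ?thesis
      unfolding triples_def by (simp add: sum.Sigma finite_CM case_prod_beta)
  qed
  also have "\<dots> = (\<Sum>sig\<in>CS. \<Sum>w\<in>vecs nw K.
      \<Sum>w'\<in>PiE ({..<p} - K) (\<lambda>i. fib (sig p) (mdsw p CM K m (restrict (\<lambda>j. f (sig p) (w j)) K) i)). F (deal sig (glue K w w')))"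
  proof (rule sum.cong[OF refl])
    fix sig :: "nat \<Rightarrow> bool list"
    let ?s = "sig p"
    let ?Y = "\<lambda>w. mdsw p CM K m (restrict (\<lambda>j. f ?s (w j)) K)"
    define G where "G = (\<lambda>y w. \<Sum>w'\<in>PiE ({..<p} - K) (\<lambda>i. fib ?s (y i)). F (deal sig (glue K w w')))"
    have "(\<Sum>w\<in>PiE {..<p} (\<lambda>i. fib ?s (y i)). F (deal sig w)) = (\<Sum>w\<in>PiE K (\<lambda>i. fib ?s (y i)). G y w)" for y
    proof -
      have e: "PiE {..<p} (\<lambda>i. fib ?s (y i)) = PiE (K \<union> ({..<p} - K)) (\<lambda>i. fib ?s (y i))"
        using K by (simp add: Un_absorb1)
      show ?thesis unfolding G_def e by (rule sum_PiE_glue[OF Diff_disjoint])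
    qed
    then have "(\<Sum>y\<in>codes m. \<Sum>w\<in>PiE {..<p} (\<lambda>i. fib ?s (y i)). F (deal sig w)) = (\<Sum>x\<in>(SIGMA y:codes m. PiE K (\<lambda>i. fib ?s (y i))). G (fst x) (snd x))"
      using fc fP[OF K(1)] by (simp add: sum.Sigma case_prod_beta)
    \<comment> \<open>The words on \<open>K\<close> determine the values on \<open>K\<close> and,
      together with \<open>m\<close>, the whole codeword; so summing over codewords and fibres is
      summing over free words.\<close>
    also have "\<dots> = (\<Sum>w\<in>vecs nw K. G (?Y w) w)"
    proof (rule sum.reindex_bij_witness[where i = "\<lambda>w. (?Y w, w)" and j = snd])
      fix x assume "x \<in> (SIGMA y:codes m. PiE K (\<lambda>i. fib ?s (y i)))"
      then have y: "fst x \<in> CM" "fst x p = m" and w: "snd x \<in> PiE K (\<lambda>i. fib ?s (fst x i))" unfolding codes_def by auto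
      have fw: "f ?s (snd x i) = fst x i" if "i \<in> K" for i using PiE_mem[OF w that] unfolding fib_def by simp
      then have "restrict (\<lambda>j. f ?s (snd x j)) K = restrict (fst x) K" by (auto simp: restrict_def fun_eq_iff)
      then have Y: "?Y (snd x) = fst x" using mdsw_eq[OF CM K t(1) y(1)] y(2) by simp
      then show "(?Y (snd x), snd x) = x" "G (?Y (snd x)) (snd x) = G (fst x) (snd x)" by auto
      show "snd x \<in> vecs nw K" using w unfolding fib_def by (auto simp: PiE_iff)
    next
      fix w assume w: "w \<in> vecs nw K"
      have "restrict (\<lambda>j. f ?s (w j)) K \<in> vecs l K" using w f by (auto simp: PiE_iff)
      note pr = mdsw_props[OF CM K t(1) m this]
      have "?Y w i = f ?s (w i)" if "i \<in> K" for i using fun_cong[OF pr(3), of i] that by simp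
      then have "w \<in> PiE K (\<lambda>i. fib ?s (?Y w i))" using w unfolding fib_def by (auto simp: PiE_iff)
      then show "(?Y w, w) \<in> (SIGMA y:codes m. PiE K (\<lambda>i. fib ?s (y i)))" using pr(1,2) unfolding codes_def by simp
    qed simp_all
    finally show "(\<Sum>y\<in>codes m. \<Sum>w\<in>PiE {..<p} (\<lambda>i. fib ?s (y i)). F (deal sig w)) = (\<Sum>w\<in>vecs nw K. \<Sum>w'\<in>PiE ({..<p} - K) (\<lambda>i. fib ?s (?Y w i)). F (deal sig (glue K w w')))"
      unfolding G_def .
  qed
  finally show ?thesis .
qed

lemma mdsw_word:
  assumes m: "m \<in> words l" and K: "K \<subseteq> {..<p}" "card K = t - 1" and v: "v \<in> vecs l K" and i: "i \<le> p"
  shows "mdsw p CM K m v i \<in> words l"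
  by (rule mds_in[OF CM mdsw_props(1)[OF CM K t(1) m v] i])

lemma restrict_f: "w \<in> vecs nw K \<Longrightarrow> restrict (\<lambda>j. f s (w j)) K \<in> vecs l K"
  using f by (auto simp: PiE_iff)

lemma card_PiE_fib:
  assumes m: "m \<in> words l" and K: "K \<subseteq> {..<p}" "card K = t - 1" and v: "v \<in> vecs l K" and I: "I \<subseteq> {..<p}"
  shows "card (PiE I (\<lambda>i. fib s (mdsw p CM K m v i))) = r ^ card I"
proof -
  have fI: "finite I" using I finite_subset by blast
  have "card (PiE I (\<lambda>i. fib s (mdsw p CM K m v i))) = (\<Prod>i\<in>I. card (fib s (mdsw p CM K m v i)))"
    by (rule card_PiE[OF fI])
  also have "\<dots> = (\<Prod>i\<in>I. r)"
    using I by (intro prod.cong refl card_fib mdsw_word[OF m K v]) auto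
  finally show ?thesis by simp
qed

text \<open>Given the seed codeword, words on \<open>K\<close> fix the message codeword and leave
  \<open>r\<close> choices for each of the other p - (t - 1) parties. The number of completions does
  not depend on the message, which gives privacy and the size of \<open>Om m\<close>.\<close>

lemma sum_Om_proj:
  fixes h :: "(nat \<Rightarrow> bool list) \<Rightarrow> real"
  assumes m: "m \<in> words l" and K: "K \<subseteq> {..<p}" "card K = t - 1"
  shows "(\<Sum>z\<in>Om m. h (proj K z)) = real (r ^ (p - (t - 1))) * (\<Sum>sig\<in>CS. \<Sum>w\<in>vecs nw K. h (proj K (deal sig w)))"
proof -
  have fK: "finite K" using K finite_subset by blast
  have pg: "proj K (deal sig (glue K w w')) = proj K (deal sig w)" for sig w w'
    using K unfolding proj_def deal_def glue_def by (auto simp: fun_eq_iff)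
  have cR: "card ({..<p} - K) = p - (t - 1)" using K fK by (simp add: card_Diff_subset)
  have "(\<Sum>z\<in>Om m. h (proj K z)) = (\<Sum>sig\<in>CS. \<Sum>w\<in>vecs nw K. real (r ^ (p - (t - 1))) * h (proj K (deal sig w)))"
    unfolding sum_Om[OF m K] pg
    by (intro sum.cong refl) (simp add: card_PiE_fib[OF m K restrict_f] cR)
  then show ?thesis by (simp only: sum_distrib_left)
qed

lemma card_CS: "card CS = (2 ^ ns) ^ t"
proof -
  obtain K where K: "K \<subseteq> {..<p}" "card K = t - 1" using extend_set[of "{}"] t by auto
  have fK: "finite K" using K finite_subset by blast
  have "card CS = (\<Sum>c\<in>CS. 1)" by simp
  also have "\<dots> = (2 ^ ns) ^ (t - 1) * 2 ^ ns"
    unfolding mds_sum[OF CS K t(1)] using fK K words_card[of ns] by (simp add: card_PiE)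
  also have "\<dots> = (2 ^ ns) ^ t" using t by (cases t) auto
  finally show ?thesis .
qed

lemma card_Om:
  assumes m: "m \<in> words l"
  shows "real (card (Om m)) = real (r ^ (p - (t - 1))) * (2 ^ ns) ^ t * (2 ^ nw) ^ (t - 1)"
proof -
  obtain K where K: "K \<subseteq> {..<p}" "card K = t - 1" using extend_set[of "{}"] t by auto
  have fK: "finite K" using K finite_subset by blast
  have "real (card (Om m)) = (\<Sum>z\<in>Om m. 1)" by simp
  also have "\<dots> = real (r ^ (p - (t - 1))) * (\<Sum>sig\<in>CS. \<Sum>w\<in>vecs nw K. 1)"
    by (rule sum_Om_proj[OF m K, where h = "\<lambda>_. 1"])
  finally show ?thesis using fK K words_card[of nw] by (simp add: card_PiE card_CS)
qed

lemma Om_nonempty: "m \<in> words l \<Longrightarrow> Om m \<noteq> {}"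
  using card_Om[of m] r_pos by auto

section \<open>Correctness and privacy\<close>

definition Share :: "bool list \<Rightarrow> (nat \<Rightarrow> bool list) pmf" where
  "Share m = pmf_of_set (Om m)"

lemma set_Share: "m \<in> words l \<Longrightarrow> set_pmf (Share m) = Om m"
  unfolding Share_def using Om_nonempty finite_Om by simp

lemma Share_wf: "share_wf p l (nw + ns) Share"
  unfolding share_wf_def
proof (intro allI impI ballI conjI)
  fix m s i assume m: "length m = l" and s: "s \<in> set_pmf (Share m)"
  then have "s \<in> Om m" using set_Share[of m] by simp
  then obtain sig y w where x: "(sig, y, w) \<in> triples m" "s = deal sig w" unfolding Om_def by auto
  show "length (s i) = nw + ns" if "i < p"
  proof -
    have "w i \<in> fib (sig p) (y i)" "sig \<in> CS" using x(1) that unfolding triples_def by auto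
    then have "length (w i) = nw" "length (sig i) = ns" using mds_in[OF CS, of sig i] that unfolding fib_def by auto
    then show ?thesis using that unfolding x(2) deal_def by simp
  qed
  show "s i = []" if "p \<le> i" using that unfolding x(2) deal_def by simp
qed

text \<open>Any message consistent with the given shares may be chosen: by
  \<open>triples_deal_eq\<close>, \<open>t\<close> shares leave only one.\<close>

definition Rec :: "nat set \<Rightarrow> (nat \<Rightarrow> bool list) \<Rightarrow> bool list" where
  "Rec T c = (SOME m. length m = l \<and> (\<exists>z\<in>Om m. proj T z = c))"

lemma Share_correct: "perfectly_correct p t l Share Rec"
  unfolding perfectly_correct_def
proof (intro allI impI)
  fix m :: "bool list" and T assume m: "length m = l" and T: "T \<subseteq> {..<p}" "t \<le> card T"
  have "Rec T (proj T z) = m" if z: "z \<in> Om m" for z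
  proof -
    have "length m = l \<and> (\<exists>z'\<in>Om m. proj T z' = proj T z)" using m z by blast
    then have "length (Rec T (proj T z)) = l \<and> (\<exists>z'\<in>Om (Rec T (proj T z)). proj T z' = proj T z)"
      unfolding Rec_def by (rule someI)
    then obtain z' where z': "z' \<in> Om (Rec T (proj T z))" "proj T z' = proj T z" by blast
    obtain sig y w where x: "(sig, y, w) \<in> triples m" "z = deal sig w" using z unfolding Om_def by auto
    obtain sig' y' w' where x': "(sig', y', w') \<in> triples (Rec T (proj T z))" "z' = deal sig' w'" using z'(1) unfolding Om_def by auto
    have "sig' = sig \<and> y' = y \<and> (\<forall>i\<in>T. w' i = w i)"
    proof (rule triples_deal_eq[OF x'(1) x(1) T])
      fix i assume "i \<in> T"
      then show "deal sig' w' i = deal sig w i" using fun_cong[OF z'(2), of i] unfolding x(2) x'(2) proj_def by simp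
    qed
    then show ?thesis using x(1) x'(1) unfolding triples_def codes_def by auto
  qed
  then have "set_pmf (Share m) \<subseteq> {s. Rec T (proj T s) = m}" using set_Share m by auto
  then show "measure_pmf.prob (Share m) {s. Rec T (proj T s) = m} = 1"
    by (intro measure_pmf.prob_eq_1[THEN iffD2]) (auto simp: AE_measure_pmf_iff)
qed

lemma pmf_Share: "m \<in> words l \<Longrightarrow> pmf (Share m) z = (if z \<in> Om m then 1 / card (Om m) else 0)"
  unfolding Share_def using Om_nonempty finite_Om by (simp add: indicator_def)

lemma Share_private: "perfectly_private p t l Share"
  unfolding perfectly_private_def
proof (intro allI impI)
  fix m0 m1 :: "bool list" and T assume m: "length m0 = l" "length m1 = l" and T: "T \<subseteq> {..<p}" "card T < t"
  \<comment> \<open>The count is available for exactly t - 1 parties; the view of \<open>T\<close>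
    is a function of the view of \<open>T'\<close>.\<close>
  obtain T' where T': "T \<subseteq> T'" "T' \<subseteq> {..<p}" "card T' = t - 1" using extend_set[OF T] by blast
  have pp: "proj T z = proj T (proj T' z)" for z using T'(1) unfolding proj_def by (auto simp: fun_eq_iff)
  show "map_pmf (proj T) (Share m0) = map_pmf (proj T) (Share m1)"
  proof (rule pmf_eqI)
    fix c
    have *: "pmf (map_pmf (proj T) (Share m)) c = (\<Sum>z\<in>Om m. if proj T (proj T' z) = c then 1 else 0) / card (Om m)" if "length m = l" for m :: "bool list"
    proof -
      have mw: "m \<in> words l" using that by simp
      have "pmf (map_pmf (proj T) (Share m)) c = measure (pmf_of_set (Om m)) (proj T -` {c})"
        unfolding pmf_map Share_def ..
      also have "\<dots> = card (Om m \<inter> proj T -` {c}) / card (Om m)"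
        by (rule measure_pmf_of_set[OF Om_nonempty[OF mw] finite_Om])
      also have "real (card (Om m \<inter> proj T -` {c})) = (\<Sum>z\<in>Om m. if proj T (proj T' z) = c then 1 else 0)"
        using finite_Om by (simp add: sum.If_cases pp[symmetric] vimage_def Int_def)
      finally show ?thesis .
    qed
    have "(\<Sum>z\<in>Om m0. if proj T (proj T' z) = c then 1 else 0 :: real) = (\<Sum>z\<in>Om m1. if proj T (proj T' z) = c then 1 else 0)"
      using sum_Om_proj[OF _ T'(2,3), of _ "\<lambda>x. if proj T x = c then 1 else 0"] m by simp
    then show "pmf (map_pmf (proj T) (Share m0)) c = pmf (map_pmf (proj T) (Share m1)) c"
      unfolding *[OF m(1)] *[OF m(2)] using card_Om[of m0] card_Om[of m1] m by simp
  qed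
qed

section \<open>Leakage resilience\<close>

text \<open>A partial share vector whose words come from two sources: with C = K \<inter> T, the
  second set is T - K for the view of \<open>T\<close> and K - T for the view of
  \<open>K\<close>.\<close>

definition cpart :: "nat set \<Rightarrow> nat set \<Rightarrow> (nat \<Rightarrow> bool list) \<Rightarrow> (nat \<Rightarrow> bool list) \<Rightarrow> (nat \<Rightarrow> bool list) \<Rightarrow> nat \<Rightarrow> bool list" where
  "cpart C J sig u v = (\<lambda>i. if i \<in> C then u i @ sig i else if i \<in> J then v i @ sig i else [])"

lemma proj_deal_glue2:
  assumes "T \<subseteq> {..<p}" "C = K \<inter> T" "H = T - K"
  shows "proj T (deal sig (glue K (glue C u v) (glue H w w'))) = cpart C H sig u w"
  using assms unfolding proj_def deal_def glue_def cpart_def by (auto simp: fun_eq_iff)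

text \<open>With the seed and the sources in \<open>C\<close> fixed, the sources in \<open>H\<close> are summed over the fibres of
  the codeword determined by \<open>C\<close> and \<open>J\<close>; letting the coordinates in \<open>J\<close> range freely, every source
  vector on \<open>H\<close> occurs exactly once, whatever the message is.\<close>

lemma sum_fibres_free:
  fixes g :: "(nat \<Rightarrow> bool list) \<Rightarrow> complex"
  assumes m: "m \<in> words l" and K: "K \<subseteq> {..<p}" "card K = t - 1" and T: "T \<subseteq> {..<p}" "card T = t - 1"
    and u: "u \<in> vecs nw (K \<inter> T)"
  shows "(\<Sum>y\<in>vecs l (K - T).
       \<Sum>w\<in>PiE (T - K) (\<lambda>i. fib s (mdsw p CM K m (glue (K \<inter> T) (restrict (\<lambda>j. f s (u j)) (K \<inter> T)) y) i)). g w)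
     = (\<Sum>w\<in>vecs nw (T - K). g w)"
proof -
  define C where "C = K \<inter> T"
  define J where "J = K - T"
  define H where "H = T - K"
  define fu where "fu = restrict (\<lambda>j. f s (u j)) C"
  have KC: "K = C \<union> J" "C \<inter> J = {}" and TC: "T = C \<union> H" "C \<inter> H = {}" unfolding C_def J_def H_def by auto
  have fin: "finite J" "finite H" using K(1) T(1) finite_subset unfolding J_def H_def by blast+
  have u': "u i \<in> words nw" if "i \<in> C" for i using PiE_mem[OF u, of i] that unfolding C_def by blast
  have fu: "fu i \<in> words l" if "i \<in> C" for i using f[OF u'[OF that]] that unfolding fu_def by simp
  have gK: "glue C fu y \<in> vecs l K" if y: "y \<in> vecs l J" for y
    unfolding PiE_iff extensional_def glue_def KC(1) using fu PiE_mem[OF y] PiE_arb[OF y] by auto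
  define fw where "fw = (\<lambda>w. restrict (\<lambda>j. f s (w j)) H)"
  have fw: "fw w i \<in> words l" if "w \<in> vecs nw H" "i \<in> H" for w i
    using f[of "w i" s] PiE_mem[OF that] that(2) unfolding fw_def by simp
  have gT: "glue C fu (fw w) \<in> vecs l T" if w: "w \<in> vecs nw H" for w
    unfolding PiE_iff extensional_def glue_def TC(1) using fu fw[OF w] unfolding fw_def by auto
  \<comment> \<open>\<open>?Y\<close> reads the codeword off its coordinates on \<open>K\<close>,
    \<open>?Z\<close> off those on \<open>T\<close>. Passing from one description to the other
    exchanges free values on \<open>J\<close> for free words on \<open>H\<close>.\<close>
  let ?Y = "\<lambda>y. mdsw p CM K m (glue C fu y)"
  let ?Z = "\<lambda>w. mdsw p CM T m (glue C fu (fw w))"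
  have fP: "finite (PiE H (\<lambda>i. fib s (?Y y i)))" for y by (intro finite_PiE fin finite_fib)
  have "(\<Sum>y\<in>vecs l J. \<Sum>w\<in>PiE H (\<lambda>i. fib s (?Y y i)). g w)
     = (\<Sum>x\<in>(SIGMA y:vecs l J. PiE H (\<lambda>i. fib s (?Y y i))). g (snd x))"
    by (subst sum.Sigma) (auto simp: fP case_prod_beta intro!: finite_PiE fin words_card)
  also have "\<dots> = (\<Sum>w\<in>vecs nw H. g w)"
  proof (rule sum.reindex_bij_witness[where i = "\<lambda>w. (restrict (?Z w) J, w)" and j = snd])
    fix x assume "x \<in> (SIGMA y:vecs l J. PiE H (\<lambda>i. fib s (?Y y i)))"
    then have y: "fst x \<in> vecs l J" and w: "snd x \<in> PiE H (\<lambda>i. fib s (?Y (fst x) i))" by auto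
    show w': "snd x \<in> vecs nw H" using w unfolding fib_def by (auto simp: PiE_iff)
    note pr = mdsw_props[OF CM K t(1) m gK[OF y]]
    have Yi: "?Y (fst x) i = glue C fu (fst x) i" if "i \<in> K" for i using fun_cong[OF pr(3), of i] that by simp
    have "restrict (?Y (fst x)) T = glue C fu (fw (snd x))"
    proof (rule ext)
      fix i
      consider "i \<in> C" | "i \<in> H" | "i \<notin> T" using TC by blast
      then show "restrict (?Y (fst x)) T i = glue C fu (fw (snd x)) i"
      proof cases
        case 1
        then show ?thesis using Yi[of i] TC KC by (simp add: glue_def)
      next
        case 2
        then have "f s (snd x i) = ?Y (fst x) i" using PiE_mem[OF w 2] unfolding fib_def by simp
        then show ?thesis using 2 TC by (auto simp: glue_def fw_def)
      next
        case 3
        then show ?thesis using TC by (simp add: glue_def fw_def)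
      qed
    qed
    then have YZ: "?Z (snd x) = ?Y (fst x)" using mdsw_eq[OF CM T t(1) pr(1)] pr(2) by simp
    have "restrict (?Y (fst x)) J = fst x"
    proof (rule ext)
      fix i show "restrict (?Y (fst x)) J i = fst x i"
        using Yi[of i] KC PiE_arb[OF y, of i] by (cases "i \<in> J") (auto simp: glue_def)
    qed
    then show "(restrict (?Z (snd x)) J, snd x) = x" unfolding YZ by simp
  next
    fix w assume w: "w \<in> vecs nw H"
    note pr = mdsw_props[OF CM T t(1) m gT[OF w]]
    have Zi: "?Z w i = glue C fu (fw w) i" if "i \<in> T" for i using fun_cong[OF pr(3), of i] that by simp
    have Zw: "?Z w i \<in> words l" if "i \<in> J" for i
      using mds_in[OF CM pr(1), of i] that K(1) KC by force
    have "restrict (?Z w) K = glue C fu (restrict (?Z w) J)"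
    proof (rule ext)
      fix i show "restrict (?Z w) K i = glue C fu (restrict (?Z w) J) i"
        using Zi[of i] KC TC by (auto simp: glue_def restrict_def)
    qed
    then have YZ: "?Y (restrict (?Z w) J) = ?Z w" using mdsw_eq[OF CM K t(1) pr(1)] pr(2) by simp
    have "w i \<in> fib s (?Z w i)" if i: "i \<in> H" for i
    proof -
      have "?Z w i = f s (w i)" using Zi[of i] i TC by (auto simp: glue_def fw_def)
      then show ?thesis using PiE_mem[OF w i] unfolding fib_def by simp
    qed
    then have "w \<in> PiE H (\<lambda>i. fib s (?Y (restrict (?Z w) J) i))" using w unfolding YZ by (auto simp: PiE_iff)
    moreover have "restrict (?Z w) J \<in> vecs l J" using Zw by (simp add: restrict_PiE_iff)
    ultimately show "(restrict (?Z w) J, w) \<in> (SIGMA y:vecs l J. PiE H (\<lambda>i. fib s (?Y y i)))" by simp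
  qed simp_all
  finally show ?thesis unfolding C_def[symmetric] J_def[symmetric] H_def[symmetric] fu_def[symmetric] .
qed

text \<open>The quantifiers matter: one value \<open>M\<close> serves all messages. Once the seed
  shares on \<open>K\<close> and the words on \<open>K\<close> \<inter> \<open>T\<close> are fixed,
  the leaked state encodes the words on \<open>K - T\<close> without reference to the seed, and the
  rest is a test on seed and extracted values, so \<open>secure_product\<close> applies to
  \<open>K - T\<close>.\<close>

lemma leakage_sum:
  fixes V Lam :: "(nat \<Rightarrow> bool list) \<Rightarrow> nat \<Rightarrow> nat \<Rightarrow> complex" and eps :: real
  assumes sec: "secure d (words ns) (words nw) (words l) f eps" and eps: "eps \<ge> 0"
    and K: "K \<subseteq> {..<p}" "card K = t - 1" and T: "T \<subseteq> {..<p}" "card T = t - 1"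
    and V: "\<And>c. V c \<in> contractions d" and Lam: "\<And>c. densf d (Lam c)"
  shows "\<exists>M. \<forall>m\<in>words l. cmod ((\<Sum>z\<in>Om m. trpair d (V (proj T z)) (Lam (proj K z))) - M) \<le> t * eps * card (Om m)"
proof -
  \<comment> \<open>\<open>C\<close> is in both views, \<open>J\<close> only leaks, \<open>H\<close>
    is only seen classically, and \<open>R\<close> is in neither view and contributes just a
    count.\<close>
  define C where "C = K \<inter> T"
  define J where "J = K - T"
  define H where "H = T - K"
  define R where "R = {..<p} - K - H"
  have KC: "K = C \<union> J" "C \<inter> J = {}" and TC: "T = C \<union> H" "C \<inter> H = {}" and KR: "{..<p} - K = H \<union> R" "H \<inter> R = {}"
    using T unfolding C_def J_def H_def R_def by auto
  have fin: "finite K" "finite T" "finite C" "finite J" "finite H" "finite R"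
    using K(1) T(1) finite_subset unfolding C_def J_def H_def R_def by blast+
  have cK: "card K = card C + card J" unfolding KC(1) using fin KC(2) by (intro card_Un_disjoint)
  have cT: "card T = card C + card H" unfolding TC(1) using fin TC(2) by (intro card_Un_disjoint)
  have cR: "p - (t - 1) = card H + card R"
  proof -
    have "card ({..<p} - K) = p - (t - 1)" using K fin by (simp add: card_Diff_subset)
    then show ?thesis unfolding KR(1) using fin KR(2) by (simp add: card_Un_disjoint)
  qed
  let ?W = "\<lambda>I. vecs nw I" and ?A = "\<lambda>I. vecs l I" and ?B = "\<lambda>I. vecs ns I"
  let ?sig = "\<lambda>k s. mdsw p CS K s k"
  let ?rH = "complex_of_real (real (r ^ card H))"
  have rH: "real (r ^ card H) > 0" using r_pos by simp
  \<comment> \<open>The ideal value: the values on \<open>J\<close> are uniform and unrelated to the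
    leaking words \<open>v\<close>. Summing the fibres over all such values lets the words on
    \<open>H\<close> range freely, so no message occurs here.\<close>
  define M where "M = (\<Sum>k\<in>?B K. \<Sum>u\<in>?W C. \<Sum>s\<in>words ns. \<Sum>v\<in>?W J.
      (\<Sum>w\<in>?W H. trpair d (V (cpart C H (?sig k s) u w)) (Lam (cpart C J k u v))) / of_nat (card (?A J)))"
  have main: "cmod ((\<Sum>z\<in>Om m. trpair d (V (proj T z)) (Lam (proj K z))) - of_nat (r ^ card R) * M) \<le> t * eps * card (Om m)"
    if m: "m \<in> words l" for m
  proof -
    define Y where "Y = (\<lambda>s u y. mdsw p CM K m (glue C (restrict (\<lambda>j. f s (u j)) C) y))"
    define E where "E = (\<lambda>s u y. PiE H (\<lambda>i. fib s (Y s u y i)))"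
    \<comment> \<open>Words on \<open>H\<close> reach the test but not the leaked state, so the
      tests over a product of fibres are merged into one, normalised by the number of word vectors
      in a full product.\<close>
    define V' where "V' = (\<lambda>k u s y i j. (\<Sum>w\<in>E s u y. V (cpart C H (?sig k s) u w) i j) / ?rH)"
    have fE: "finite (E s u y)" for s u y unfolding E_def by (intro finite_PiE fin finite_fib)
    have cE: "card (E s u y) \<le> r ^ card H" for s u y
    proof -
      have "card (E s u y) = (\<Prod>i\<in>H. card (fib s (Y s u y i)))" unfolding E_def by (rule card_PiE[OF fin(5)])
      also have "\<dots> \<le> (\<Prod>i\<in>H. r)" by (rule prod_mono) (simp add: card_fib_le)
      finally show ?thesis by simp
    qed
    have V': "V' k u s y \<in> contractions d" for k u s y
      unfolding V'_def by (rule contraction_sum[OF fE V of_nat_mono[OF cE] rH])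
    have tV': "?rH * trpair d (V' k u s y) B = (\<Sum>w\<in>E s u y. trpair d (V (cpart C H (?sig k s) u w)) B)" for k u s y B
      unfolding V'_def trpair_sum_left using rH by simp
    define Lk where "Lk = (\<lambda>k u v. Lam (cpart C J k u v))"
    \<comment> \<open>With \<open>k\<close> and \<open>u\<close> fixed this is the gap of the
      product extractor on \<open>J\<close>; the seed \<open>s\<close> is still free.\<close>
    define D where "D = (\<lambda>k u. \<Sum>s\<in>words ns. \<Sum>v\<in>?W J.
        trpair d (V' k u s (restrict (\<lambda>j. f s (v j)) J)) (Lk k u v) - (\<Sum>y\<in>?A J. trpair d (V' k u s y) (Lk k u v)) / of_nat (card (?A J)))"
    have D: "cmod (D k u) \<le> card J * eps * card (words ns) * card (?W J)" for k u
      unfolding D_def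
      by (rule secureD[OF secure_product[OF sec words_card(1) words_card(1) _ fin(4)], where V = "V' k u" and r = "Lk k u"])
         (use V' Lam in \<open>auto simp: Lk_def intro: exI[of _ "replicate l True"]\<close>)
    have inner: "(\<Sum>w'\<in>PiE ({..<p} - K) (\<lambda>i. fib (sig p) (mdsw p CM K m (restrict (\<lambda>j. f (sig p) (glue C u v j)) K) i)).
          trpair d (V (proj T (deal sig (glue K (glue C u v) w')))) (Lam (proj K (deal sig (glue K (glue C u v) w')))))
        = of_nat (r ^ card R) * (\<Sum>w\<in>E (sig p) u (restrict (\<lambda>j. f (sig p) (v j)) J). trpair d (V (cpart C H sig u w)) (Lam (cpart C J sig u v)))"
      if u: "u \<in> ?W C" and v: "v \<in> ?W J" for sig u v
    proof -
      have gl: "restrict (\<lambda>j. f (sig p) (glue C u v j)) K = glue C (restrict (\<lambda>j. f (sig p) (u j)) C) (restrict (\<lambda>j. f (sig p) (v j)) J)"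
        using KC by (auto simp: glue_def restrict_def fun_eq_iff)
      have gv: "glue C u v \<in> ?W K"
        unfolding PiE_iff extensional_def glue_def KC(1) using PiE_mem[OF u] PiE_mem[OF v] PiE_arb[OF v] by auto
      have pT: "proj T (deal sig (glue K (glue C u v) (glue H w w'))) = cpart C H sig u w" for w w'
        by (rule proj_deal_glue2[OF T(1) C_def H_def])
      have pK: "proj K (deal sig (glue K (glue C u v) w')) = cpart C J sig u v" for w'
        using K(1) KC unfolding proj_def deal_def glue_def cpart_def by (auto simp: fun_eq_iff)
      have cRfib: "card (PiE R (\<lambda>i. fib (sig p) (mdsw p CM K m (restrict (\<lambda>j. f (sig p) (glue C u v j)) K) i))) = r ^ card R"
        by (rule card_PiE_fib[OF m K restrict_f[OF gv]]) (auto simp: R_def)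
      show ?thesis
        unfolding KR(1) sum_PiE_glue[OF KR(2)] pT pK sum_constant cRfib
        unfolding E_def Y_def gl by (simp add: sum_distrib_left)
    qed
    have "(\<Sum>z\<in>Om m. trpair d (V (proj T z)) (Lam (proj K z)))
       = (\<Sum>sig\<in>CS. \<Sum>u\<in>?W C. \<Sum>v\<in>?W J. of_nat (r ^ card R) *
           (\<Sum>w\<in>E (sig p) u (restrict (\<lambda>j. f (sig p) (v j)) J). trpair d (V (cpart C H sig u w)) (Lam (cpart C J sig u v))))"
      unfolding sum_Om[OF m K]
    proof (rule sum.cong[OF refl])
      fix sig
      define G where "G = (\<lambda>w. \<Sum>w'\<in>PiE ({..<p} - K) (\<lambda>i. fib (sig p) (mdsw p CM K m (restrict (\<lambda>j. f (sig p) (w j)) K) i)).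
          trpair d (V (proj T (deal sig (glue K w w')))) (Lam (proj K (deal sig (glue K w w')))))"
      have "(\<Sum>w\<in>?W K. G w) = (\<Sum>u\<in>?W C. \<Sum>v\<in>?W J. G (glue C u v))"
        unfolding KC(1) by (rule sum_PiE_glue[OF KC(2)])
      also have "\<dots> = (\<Sum>u\<in>?W C. \<Sum>v\<in>?W J. of_nat (r ^ card R) *
           (\<Sum>w\<in>E (sig p) u (restrict (\<lambda>j. f (sig p) (v j)) J). trpair d (V (cpart C H sig u w)) (Lam (cpart C J sig u v))))"
        unfolding G_def by (intro sum.cong refl inner)
      finally show "(\<Sum>w\<in>?W K. \<Sum>w'\<in>PiE ({..<p} - K) (\<lambda>i. fib (sig p) (mdsw p CM K m (restrict (\<lambda>j. f (sig p) (w j)) K) i)).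
          trpair d (V (proj T (deal sig (glue K w w')))) (Lam (proj K (deal sig (glue K w w')))))
        = (\<Sum>u\<in>?W C. \<Sum>v\<in>?W J. of_nat (r ^ card R) *
           (\<Sum>w\<in>E (sig p) u (restrict (\<lambda>j. f (sig p) (v j)) J). trpair d (V (cpart C H sig u w)) (Lam (cpart C J sig u v))))"
        unfolding G_def .
    qed
    also have "\<dots> = (\<Sum>k\<in>?B K. \<Sum>s\<in>words ns. \<Sum>u\<in>?W C. \<Sum>v\<in>?W J. of_nat (r ^ card R) *
           (?rH * trpair d (V' k u s (restrict (\<lambda>j. f s (v j)) J)) (Lk k u v)))"
      unfolding mds_sum[OF CS K t(1)]
    proof (intro sum.cong refl)
      fix k s u v assume k: "k \<in> ?B K" and s: "s \<in> words ns"
      note pr = mdsw_props[OF CS K t(1) s k]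
      \<comment> \<open>The seed shares inside \<open>K\<close> are \<open>k\<close> whatever the
        seed is, so the state does not depend on \<open>s\<close>, as the extractor
        requires.\<close>
      have "?sig k s i = k i" if "i \<in> K" for i using fun_cong[OF pr(3), of i] that by simp
      then have "cpart C J (?sig k s) u v = cpart C J k u v" using KC unfolding cpart_def by (auto simp: fun_eq_iff)
      then show "of_nat (r ^ card R) * (\<Sum>w\<in>E (?sig k s p) u (restrict (\<lambda>j. f (?sig k s p) (v j)) J). trpair d (V (cpart C H (?sig k s) u w)) (Lam (cpart C J (?sig k s) u v)))
         = of_nat (r ^ card R) * (?rH * trpair d (V' k u s (restrict (\<lambda>j. f s (v j)) J)) (Lk k u v))"
        unfolding tV' pr(2) Lk_def by simp
    qed
    also have "\<dots> = (\<Sum>k\<in>?B K. \<Sum>u\<in>?W C. \<Sum>s\<in>words ns. \<Sum>v\<in>?W J. of_nat (r ^ card R) *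
           (?rH * trpair d (V' k u s (restrict (\<lambda>j. f s (v j)) J)) (Lk k u v)))"
      by (rule sum.cong[OF refl sum.swap])
    finally have lhs: "(\<Sum>z\<in>Om m. trpair d (V (proj T z)) (Lam (proj K z))) = (\<Sum>k\<in>?B K. \<Sum>u\<in>?W C. \<Sum>s\<in>words ns. \<Sum>v\<in>?W J. of_nat (r ^ card R) *
           (?rH * trpair d (V' k u s (restrict (\<lambda>j. f s (v j)) J)) (Lk k u v)))" .
    have Meq: "of_nat (r ^ card R) * M = (\<Sum>k\<in>?B K. \<Sum>u\<in>?W C. \<Sum>s\<in>words ns. \<Sum>v\<in>?W J. of_nat (r ^ card R) *
           (?rH * ((\<Sum>y\<in>?A J. trpair d (V' k u s y) (Lk k u v)) / of_nat (card (?A J)))))"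
      unfolding M_def sum_distrib_left[of "of_nat (r ^ card R)"]
    proof (intro sum.cong refl arg_cong2[where f = "(*)"])
      fix k u s v assume u: "u \<in> ?W C"
      have "(\<Sum>w\<in>?W H. trpair d (V (cpart C H (?sig k s) u w)) (Lk k u v)) = (\<Sum>y\<in>?A J. ?rH * trpair d (V' k u s y) (Lk k u v))"
        unfolding tV' E_def Y_def
        using sum_fibres_free[OF m K T, of u "\<lambda>w. trpair d (V (cpart C H (?sig k s) u w)) (Lk k u v)" s] u
        unfolding C_def[symmetric] J_def[symmetric] H_def[symmetric] by simp
      then show "(\<Sum>w\<in>?W H. trpair d (V (cpart C H (?sig k s) u w)) (Lam (cpart C J k u v))) / of_nat (card (?A J))
         = ?rH * ((\<Sum>y\<in>?A J. trpair d (V' k u s y) (Lk k u v)) / of_nat (card (?A J)))"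
        unfolding Lk_def by (simp add: sum_distrib_left)
    qed
    have "(\<Sum>z\<in>Om m. trpair d (V (proj T z)) (Lam (proj K z))) - of_nat (r ^ card R) * M
       = of_nat (r ^ card R) * (?rH * (\<Sum>k\<in>?B K. \<Sum>u\<in>?W C. D k u))"
      unfolding lhs Meq D_def sum_distrib_left sum_subtractf[symmetric] right_diff_distrib[symmetric] ..
    then have "cmod ((\<Sum>z\<in>Om m. trpair d (V (proj T z)) (Lam (proj K z))) - of_nat (r ^ card R) * M)
       = real (r ^ card R) * (real (r ^ card H) * cmod (\<Sum>k\<in>?B K. \<Sum>u\<in>?W C. D k u))"
      by (simp only: norm_mult norm_of_nat norm_of_real abs_of_nat)
    also have "\<dots> \<le> real (r ^ card R) * (real (r ^ card H) * (\<Sum>k\<in>?B K. \<Sum>u\<in>?W C. card J * eps * card (words ns) * card (?W J)))"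
      by (intro mult_left_mono order.trans[OF norm_sum sum_mono[OF order.trans[OF norm_sum sum_mono[OF D]]]]) auto
    also have "\<dots> = card J * eps * card (Om m)"
    proof -
      have ns: "(2 ^ ns :: real) ^ t = (2 ^ ns) ^ (t - 1) * 2 ^ ns" using t by (cases t) auto
      have cw: "(2 ^ nw :: real) ^ (t - 1) = (2 ^ nw) ^ card C * (2 ^ nw) ^ card J"
        unfolding K(2)[symmetric] cK power_add ..
      show ?thesis
        unfolding card_Om[OF m] cR ns cw using fin K words_card[of ns] words_card[of nw]
        by (simp add: card_PiE power_add)
    qed
    also have "\<dots> \<le> t * eps * card (Om m)"
    proof -
      have "card J \<le> t" using cK K(2) by simp
      then show ?thesis using eps by (intro mult_right_mono) auto
    qed
    finally show ?thesis .
  qed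
  then show ?thesis by blast
qed

end

lemma density_mat_densf:
  assumes "density_mat d A"
  shows "densf d (\<lambda>i j. A $$ (i, j))"
proof -
  have A: "A \<in> carrier_mat d d" "\<And>v. v \<in> carrier_vec d \<Longrightarrow> Im (scalar_prod (conjugate v) (A *\<^sub>v v)) = 0 \<and> Re (scalar_prod (conjugate v) (A *\<^sub>v v)) \<ge> 0"
    "(\<Sum>i<d. A $$ (i,i)) = 1"
    using assms unfolding density_mat_def psd_mat_def by auto
  have "qform d (\<lambda>i j. A $$ (i, j)) x = scalar_prod (conjugate (Matrix.vec d x)) (A *\<^sub>v Matrix.vec d x)" for x
  proof -
    have "scalar_prod (conjugate (Matrix.vec d x)) (A *\<^sub>v Matrix.vec d x) = (\<Sum>i<d. cnj (x i) * (\<Sum>j<d. A $$ (i, j) * x j))"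
      using A(1) by (simp add: scalar_prod_def lessThan_atLeast0)
    then show ?thesis unfolding qform_def by (simp add: sum_distrib_left mult.assoc)
  qed
  then show ?thesis unfolding densf_def posf_def using A(2)[OF vec_carrier] A(3) by simp
qed

text \<open>Seeds of the extractor are bit tables, while shared seeds must be words; the tests are
  carried along the bijection.\<close>

lemma secure_reindex:
  fixes psi :: "'a \<Rightarrow> 's" and f :: "'s \<Rightarrow> 'w \<Rightarrow> 'y"
  assumes sec: "secure d S W Y f eps" and psi: "bij_betw psi S' S"
  shows "secure d S' W Y (\<lambda>s. f (psi s)) eps"
  unfolding secure_def
proof (intro allI impI)
  fix r and V :: "'a \<Rightarrow> 'y \<Rightarrow> nat \<Rightarrow> nat \<Rightarrow> complex"
  assume r: "\<forall>w\<in>W. densf d (r w)" and V: "\<forall>s y. V s y \<in> contractions d"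
  define V' where "V' = (\<lambda>s. V (the_inv_into S' psi s))"
  have V': "V' (psi s) = V s" if "s \<in> S'" for s
    unfolding V'_def using the_inv_into_f_f[OF bij_betw_imp_inj_on[OF psi] that] by simp
  have "(gap d S' W Y (\<lambda>s. f (psi s)) V r)
     = (\<Sum>s\<in>S'. \<Sum>w\<in>W. trpair d (V' (psi s) (f (psi s) w)) (r w) - (\<Sum>y\<in>Y. trpair d (V' (psi s) y) (r w)) / of_nat (card Y))"
    by (rule sum.cong[OF refl]) (simp add: V')
  also have "\<dots> = (gap d S W Y f V' r)"
    by (rule sum.reindex_bij_betw[OF psi])
  finally have eq: "(gap d S' W Y (\<lambda>s. f (psi s)) V r)
     = (gap d S W Y f V' r)" .
  show "cmod (gap d S' W Y (\<lambda>s. f (psi s)) V r) \<le> eps * card S' * card W"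
    unfolding eq bij_betw_same_card[OF psi]
    by (rule secureD[OF sec, where r = r and V = V']) (use r V in \<open>auto simp: V'_def\<close>)
qed

context scheme
begin

text \<open>Every block difference has its trace norm attained by one contraction, and these
  contractions, indexed by the classical value, form the test family. Both messages are within t *
  eps of the same ideal value; the resulting factor 2 cancels against the 1/2 of the trace
  distance.\<close>

lemma Share_resilient:
  fixes eps :: real
  assumes sec: "secure (2 ^ mu) (words ns) (words nw) (words l) f eps" and eps: "eps \<ge> 0" and k: "k < t"
  shows "leakage_resilient p t k mu l Share (t * eps)"
  unfolding leakage_resilient_def
proof (intro allI impI)
  fix T K and Lam :: "(nat \<Rightarrow> bool list) \<Rightarrow> complex mat" and m0 m1 :: "bool list"
  assume T: "T \<subseteq> {..<p}" "card T < t" and K: "K \<subseteq> {..<p}" "card K \<le> k"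
    and Lam: "\<forall>x. density_mat (2 ^ mu) (Lam x)" and m: "length m0 = l" "length m1 = l"
  define d :: nat where "d = 2 ^ mu"
  define L where "L = (\<lambda>x i j. Lam x $$ (i, j))"
  have L: "densf d (L x)" for x unfolding L_def d_def using density_mat_densf Lam by blast
  have mw: "m0 \<in> words l" "m1 \<in> words l" using m by auto
  define N where "N = real (card (Om m0))"
  have N1: "real (card (Om m1)) = N" unfolding N_def card_Om[OF mw(1)] card_Om[OF mw(2)] ..
  have N: "N > 0" unfolding N_def using Om_nonempty[OF mw(1)] finite_Om by (simp add: card_gt_0_iff)
  define blk where "blk = (\<lambda>m c. cq_block d (Share m) T K Lam c)"
  have blk: "blk m c $$ (i, j) = (\<Sum>z\<in>{z\<in>Om m. proj T z = c}. of_real (1 / N) * L (proj K z) i j)"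
    if "i < d" "j < d" "m \<in> {m0, m1}" for m c i j
  proof -
    have mm: "m \<in> words l" "real (card (Om m)) = N" using that(3) mw N_def N1 by auto
    show ?thesis using that(1,2) unfolding blk_def cq_block_def set_Share[OF mm(1)] L_def
      by (simp, intro sum.cong refl) (simp add: pmf_Share[OF mm(1)] mm(2))
  qed
  have blkc: "blk m c \<in> carrier_mat d d" for m c unfolding blk_def cq_block_def by simp
  define B where "B = (\<lambda>m c i j. \<Sum>z\<in>{z\<in>Om m. proj T z = c}. of_real (1 / N) * L (proj K z) i j)"
  have hB: "hermf d (B m c)" for m c
    unfolding hermf_def B_def cnj_sum using densfD(3)[OF L] by (auto intro!: sum.cong hermfD)
  define dif where "dif = (\<lambda>c. blk m0 c - blk m1 c)"
  have difc: "dif c \<in> carrier_mat d d" for c unfolding dif_def using blkc by (intro minus_carrier_mat)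
  have dif: "dif c $$ (i, j) = B m0 c i j - B m1 c i j" if "i < d" "j < d" for c i j
    using that blk[OF that] blkc[of m0 c] blkc[of m1 c] unfolding dif_def B_def by (simp add: carrier_matD)
  have hdif: "hermf d (\<lambda>i j. dif c $$ (i, j))" for c
    unfolding hermf_def
  proof (intro allI impI)
    fix i j assume ij: "i < d" "j < d"
    show "dif c $$ (j, i) = cnj (dif c $$ (i, j))"
      unfolding dif[OF ij] dif[OF ij(2,1)] using hermfD[OF hB ij, of m0 c] hermfD[OF hB ij, of m1 c] by simp
  qed
  have "\<forall>c. \<exists>V. V \<in> contractions d \<and> of_real (trace_norm (dif c)) = trpair d V (\<lambda>i j. dif c $$ (i, j))"
    using trace_norm_hermf[OF difc hdif] by blast
  from choice[OF this] obtain V where "\<forall>c. V c \<in> contractions d \<and> of_real (trace_norm (dif c)) = trpair d (V c) (\<lambda>i j. dif c $$ (i, j))"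
    by blast
  then have V: "\<And>c. V c \<in> contractions d" and tn: "\<And>c. of_real (trace_norm (dif c)) = trpair d (V c) (\<lambda>i j. dif c $$ (i, j))"
    by auto
  define Q where "Q = proj T ` (Om m0 \<union> Om m1)"
  have fQ: "finite Q" unfolding Q_def using finite_Om by simp
  define Sm where "Sm = (\<lambda>m. \<Sum>z\<in>Om m. trpair d (V (proj T z)) (L (proj K z)))"
  have tB: "(\<Sum>c\<in>Q. trpair d (V c) (B m c)) = of_real (1 / N) * Sm m" if "m \<in> {m0, m1}" for m
  proof -
    have "(\<Sum>c\<in>Q. trpair d (V c) (B m c)) = (\<Sum>c\<in>Q. \<Sum>z\<in>{z\<in>Om m. proj T z = c}. of_real (1 / N) * trpair d (V (proj T z)) (L (proj K z)))"
      unfolding B_def trpair_sum_right by (intro sum.cong refl) auto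
    also have "\<dots> = (\<Sum>z\<in>Om m. of_real (1 / N) * trpair d (V (proj T z)) (L (proj K z)))"
      by (rule sum.group[OF finite_Om fQ]) (use that in \<open>auto simp: Q_def\<close>)
    finally show ?thesis unfolding Sm_def by (simp only: sum_distrib_left)
  qed
  have sub: "trpair d (V c) (\<lambda>i j. dif c $$ (i, j)) = trpair d (V c) (B m0 c) - trpair d (V c) (B m1 c)" for c
    unfolding trpair_def sum_subtractf[symmetric] by (intro sum.cong refl) (simp add: dif right_diff_distrib)
  have "complex_of_real (\<Sum>c\<in>Q. trace_norm (dif c)) = of_real (1 / N) * (Sm m0 - Sm m1)"
    unfolding of_real_sum tn sub sum_subtractf tB[of m0, simplified] tB[of m1, simplified] by (simp add: right_diff_distrib)
  then have "(\<Sum>c\<in>Q. trace_norm (dif c)) \<le> cmod (of_real (1 / N) * (Sm m0 - Sm m1))"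
    by (metis abs_ge_self norm_of_real)
  also have "\<dots> = cmod (Sm m0 - Sm m1) / N" using N by (simp add: norm_mult norm_divide)
  finally have le: "(\<Sum>c\<in>Q. trace_norm (dif c)) \<le> cmod (Sm m0 - Sm m1) / N" .
  have Kt: "card K < t" using K k by simp
  \<comment> \<open>The estimate concerns sets of exactly t - 1 parties. Tests and channel are
    composed with the projections to the smaller sets, so the added shares are ignored.\<close>
  obtain T' where T': "T \<subseteq> T'" "T' \<subseteq> {..<p}" "card T' = t - 1" using extend_set[OF T] by blast
  obtain K' where K': "K \<subseteq> K'" "K' \<subseteq> {..<p}" "card K' = t - 1" using extend_set[OF K(1) Kt] by blast
  have pp: "proj T (proj T' z) = proj T z" "proj K (proj K' z) = proj K z" for z
    using T'(1) K'(1) unfolding proj_def by (auto simp: fun_eq_iff)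
  obtain M where M: "\<And>m. m \<in> words l \<Longrightarrow> cmod (Sm m - M) \<le> t * eps * card (Om m)"
    using leakage_sum[OF sec[folded d_def] eps K'(2,3) T'(2,3), of "\<lambda>c. V (proj T c)" "\<lambda>c. L (proj K c)"] V L
    unfolding pp Sm_def by blast
  have "cmod (Sm m0 - Sm m1) \<le> cmod (Sm m0 - M) + cmod (Sm m1 - M)"
    using norm_triangle_ineq4[of "Sm m0 - M" "Sm m1 - M"] by simp
  also have "\<dots> \<le> t * eps * N + t * eps * N"
    using M[OF mw(1)] M[OF mw(2)] unfolding N1 N_def[symmetric] by (rule add_mono)
  also have "\<dots> = 2 * (t * eps) * N" by simp
  finally have "cmod (Sm m0 - Sm m1) / N \<le> 2 * (t * eps)" by (simp only: pos_divide_le_eq[OF N])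
  with le have "1/2 * (\<Sum>c\<in>Q. trace_norm (dif c)) \<le> t * eps" by simp
  then show "cq_trace_dist (2 ^ mu) (Share m0) (Share m1) T K Lam \<le> t * eps"
    unfolding cq_trace_dist_def set_Share[OF mw(1)] set_Share[OF mw(2)] Q_def dif_def blk_def d_def .
qed

end

text \<open>The factor \<open>(1 + 1 / q) ^ a\<close> is the entropy lost to the overlaps of the design.\<close>

lemma extractor_exists:
  fixes b q l mu E nw :: nat
  defines "a \<equiv> 2 * b"
  assumes b: "b > 0" and q: "q > 0" and E: "\<And>i. i < l \<Longrightarrow> real i * (1 + 1 / q) ^ a \<le> E" and nw: "nw = E + mu + b" and El: "l \<le> E"
  shows "\<exists>f. (\<forall>s. (\<forall>w\<in>words nw. f s w \<in> words l) \<and> (\<forall>y\<in>words l. card {w\<in>words nw. f s w = y} = 2 ^ (nw - l)))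
    \<and> secure (2 ^ mu) (words (a * q)) (words nw) (words l) f (3 * (l * sqrt (2 * (1 + nw) / 2 ^ b)))"
proof -
  let ?S = "bitfuns ({..<a} \<times> {..<q})" and ?Z = "bitfuns {..<a}" and ?W = "words nw"
  obtain D where D: "\<And>i. i < l \<Longrightarrow> D i \<in> PiE {..<a} (\<lambda>_. {..<q})"
     "\<And>i. i < l \<Longrightarrow> (\<Sum>i'<i. 2 ^ card {j. j < a \<and> D i j = D i' j}) * q ^ a \<le> i * (q + 1) ^ a"
    using design_exists[OF q, of l a] by blast
  have DE: "(\<Sum>i'<i. 2 ^ card {j. j < a \<and> D i j = D i' j}) \<le> E" if i: "i < l" for i
  proof -
    define s :: nat where "s = (\<Sum>i'<i. 2 ^ card {j. j < a \<and> D i j = D i' j})"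
    have "real (s * q ^ a) \<le> real (i * (q + 1) ^ a)" using D(2)[OF i] unfolding s_def by (rule of_nat_mono)
    then have "real s * real q ^ a \<le> real i * (real q + 1) ^ a" by (simp add: add.commute)
    then have "real s \<le> real i * (real q + 1) ^ a / real q ^ a" using q by (simp add: le_divide_eq)
    also have "\<dots> = real i * (1 + 1 / q) ^ a"
    proof -
      have "1 + 1 / real q = (real q + 1) / real q" using q by (simp add: field_simps)
      then show ?thesis by (simp only: power_divide times_divide_eq_right)
    qed
    also have "\<dots> \<le> E" by (rule E[OF i])
    finally show ?thesis unfolding s_def[symmetric] by simp
  qed
  \<comment> \<open>A code position is a pair of field elements, hence 2 * b seed bits.\<close>
  have cZ: "card ?Z = card (GF b \<times> GF b)"
    using card_GF[OF b] by (simp add: card_bitfuns card_cartesian_product a_def mult_2 power_add)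
  obtain phi where phi: "bij_betw phi ?Z (GF b \<times> GF b)"
    using finite_same_card_bij[of ?Z "GF b \<times> GF b"] cZ card_GF[OF b] by (auto simp: card_bitfuns)
  define code where "code = (\<lambda>w z. sbcode b w (phi z))"
  define del where "del = real nw / 2 ^ b"
  have corr: "(\<Sum>z\<in>?Z. sg (code w z) * sg (code w' z)) \<le> del * card ?Z" if w: "w \<in> ?W" "w' \<in> ?W" "w \<noteq> w'" for w w'
  proof -
    have "(\<Sum>z\<in>?Z. sg (code w z) * sg (code w' z)) = (\<Sum>z\<in>GF b \<times> GF b. sg (sbcode b w z) * sg (sbcode b w' z))"
      unfolding code_def by (rule sum.reindex_bij_betw[OF phi])
    also have "\<dots> \<le> del * card (GF b \<times> GF b)"
      unfolding del_def by (rule sbcode_bias[OF b]) (use w in auto)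
    finally show ?thesis unfolding cZ .
  qed
  define e where "e = card ?S * sqrt (2 * real (card ?W) * (2 ^ E * real (2 ^ mu) + del * card ?W))"
  have one: "cmod (\<Sum>s\<in>?S. \<Sum>w\<in>?W. of_real (sg (trev_bit a D code i s w)) * trpair (2 ^ mu) (V s (trev a D code i s w)) (r w)) \<le> e"
    if "i < l" "\<And>w. w \<in> ?W \<Longrightarrow> densf (2 ^ mu) (r w)" "\<And>s y. V s y \<in> contractions (2 ^ mu)" for i r V
    unfolding e_def
    by (rule trev_one_bit[OF D(1) DE[OF that(1)] words_card(1) _ _ corr that(2,3)]) (use that(1) in \<open>auto simp: del_def\<close>)
  have e: "e = sqrt (2 * (1 + nw) / 2 ^ b) * card ?S * card ?W"
  proof -
    have cW: "real (card ?W) = 2 ^ nw" by (simp add: words_card)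
    \<comment> \<open>The source exceeds E + mu by \<open>b\<close> bits so that side information
      contributes 2^(-b), which the bias nw / 2^b of the code matches up to the factor
      \<open>nw\<close>.\<close>
    have "(2::real) ^ E * real (2 ^ mu) = 2 ^ nw / 2 ^ b" unfolding nw by (simp add: power_add)
    then have eq: "2 * real (card ?W) * (2 ^ E * real (2 ^ mu) + del * card ?W) = (2 * (1 + nw) / 2 ^ b) * (2 ^ nw)\<^sup>2"
      unfolding cW del_def by (simp add: field_simps power2_eq_square)
    show ?thesis unfolding e_def unfolding eq real_sqrt_mult[of _ "(2 ^ nw)\<^sup>2"] unfolding cW by simp
  qed
  have sec: "secure (2 ^ mu) ?S ?W (words l) (trev a D code l) (l * sqrt (2 * (1 + nw) / 2 ^ b))"
    by (rule secure_trev[OF one]) (simp_all add: e)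
  have lnw: "l \<le> nw" using El nw by simp
  have cWY: "card ?W = 2 ^ (nw - l) * card (words l)" using lnw by (simp add: words_card power_add[symmetric])
  have ne: "words l \<noteq> {}" using words_card(2)[of l] by (metis card.empty power_not_zero zero_neq_numeral)
  have d0: "(0::nat) < 2 ^ mu" by simp
  have tr: "trev a D code l s ` ?W \<subseteq> words l" for s by (auto simp: trev_def)
  obtain g where g: "\<forall>s. g s ` ?W \<subseteq> words l \<and> (\<forall>y\<in>words l. card {w\<in>?W. g s w = y} = 2 ^ (nw - l))"
    and secg: "secure (2 ^ mu) ?S ?W (words l) g (3 * (l * sqrt (2 * (1 + nw) / 2 ^ b)))"
    using secure_balanced[OF sec d0 words_card(1) words_card(1) ne cWY tr] by blast
  have "card (words (a * q)) = card ?S" by (simp add: words_card card_bitfuns card_cartesian_product)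
  then obtain psi where psi: "bij_betw psi (words (a * q)) ?S"
    using finite_same_card_bij[OF words_card(1), of ?S] by (auto simp: card_bitfuns)
  show ?thesis
    by (rule exI[of _ "\<lambda>s. g (psi s)"], rule conjI[OF _ secure_reindex[OF secg psi]]) (use g in blast)
qed

section \<open>Choice of parameters\<close>

text \<open>The left side bounds the numerator of the error: 3 from balancing, h^6 for the output
  length, 12 h^6 for \<open>2 * (1 + nw)\<close>. The denominator is 2 powr (h^2 / 2); half of its
  exponent is spent on this numerator.\<close>

lemma parameters_asymptotics:
  "\<exists>h0 :: nat. \<forall>h\<ge>h0. 3 * real h ^ 6 * sqrt (12 * real h ^ 6) \<le> 2 powr (real h ^ 2 / 4)"
proof -
  have "eventually (\<lambda>h :: nat. 3 * real h ^ 6 * sqrt (12 * real h ^ 6) \<le> 2 powr (real h ^ 2 / 4)) at_top"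
    by real_asymp
  then show ?thesis unfolding eventually_at_top_linorder .
qed

text \<open>The summands are the overlap loss 2 n / h, its rounding, the \<open>b\<close> = h^2
  extra source bits and the seed length 4 h^5, for h between n^(1/6) and n^(1/6) + 1.\<close>

lemma overhead_smallo:
  "(\<lambda>n. 2 * real n powr (5/6) + 1 + (real n powr (1/6) + 1) ^ 2 + 4 * (real n powr (1/6) + 1) ^ 5) \<in> o(\<lambda>n. real n)"
  by real_asymp

lemma power_one_plus_inverse_le:
  fixes h :: nat
  assumes h: "h \<ge> 1"
  shows "(1 + 1 / real (2 * h ^ 3)) ^ (2 * h ^ 2) \<le> 1 + 2 / h"
proof -
  have "(1 + 1 / real (2 * h ^ 3)) ^ (2 * h ^ 2) \<le> exp (1 / real (2 * h ^ 3)) ^ (2 * h ^ 2)"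
    by (intro power_mono exp_ge_add_one_self) simp
  also have "\<dots> = exp (real (2 * h ^ 2) * (1 / real (2 * h ^ 3)))" by (rule exp_of_nat_mult[symmetric])
  also have "real (2 * h ^ 2) * (1 / real (2 * h ^ 3)) = 1 / h"
    using h by (simp add: field_simps power2_eq_square power3_eq_cube)
  also have "exp (1 / h) \<le> 1 + 1 / h + (1 / h)\<^sup>2" using h by (intro exp_bound) auto
  also have "(1 / real h)\<^sup>2 \<le> 1 / h"
    using h by (simp add: power2_eq_square field_simps)
  finally show ?thesis by simp
qed

lemma leakage_resilient_mono:
  assumes e: "e \<le> e'" and res: "leakage_resilient p t k mu l S e"
  shows "leakage_resilient p t k mu l S e'"
  unfolding leakage_resilient_def
proof (intro allI impI)
  fix T K and Lam :: "(nat \<Rightarrow> bool list) \<Rightarrow> complex mat" and m0 m1 :: "bool list"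
  assume *: "T \<subseteq> {..<p}" "K \<subseteq> {..<p}" "card T < t" "card K \<le> k"
    "\<forall>x. density_mat (2 ^ mu) (Lam x)" "length m0 = l" "length m1 = l"
  show "cq_trace_dist (2 ^ mu) (S m0) (S m1) T K Lam \<le> e'"
    by (rule order.trans[OF res[unfolded leakage_resilient_def, rule_format, OF *(1-4) _ *(6,7)] e]) (use *(5) in blast)
qed

theorem theoremC1:
  shows "\<exists>(g :: nat \<Rightarrow> real) (c :: real) (C :: real) (x0 :: real).
     g \<in> o(\<lambda>n. real n) \<and> c > 0 \<and> C \<ge> 0 \<and> x0 \<ge> 1 \<and>
     (\<forall>(mu :: nat) (k :: nat) (t :: nat) (p :: nat) (l :: nat).
        k < t \<longrightarrow> t + k \<le> p \<longrightarrow> p \<le> l \<longrightarrow>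
        (\<exists>(l' :: nat) Share Rec.
           share_wf p l l' Share \<and>
           real l' \<le> real (l + mu) + g (l + mu) \<and>
           perfectly_correct p t l Share Rec \<and>
           perfectly_private p t l Share \<and>
           (let x = (real (l + mu) / real p) powr (1/3) in
              x \<ge> x0 \<longrightarrow>
              leakage_resilient p t k mu l Share
                (real p * 2 powr (- (c * x / (1 + ln x) powr C))))))"
proof -
  obtain h0 :: nat where h0: "\<And>h. h \<ge> h0 \<Longrightarrow> 3 * real h ^ 6 * sqrt (12 * real h ^ 6) \<le> 2 powr (real h ^ 2 / 4)"
    using parameters_asymptotics by blast
  define g :: "nat \<Rightarrow> real" where
    "g = (\<lambda>n. 2 * real n powr (5/6) + 1 + (real n powr (1/6) + 1) ^ 2 + 4 * (real n powr (1/6) + 1) ^ 5)"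
  \<comment> \<open>The quantity compared with \<open>x0\<close> is at most h^2, so beyond this
    threshold h \<ge> h0 and the asymptotic estimate holds.\<close>
  define x0 :: real where "x0 = max 1 (real h0 ^ 2)"
  have main: "\<exists>(l' :: nat) Share Rec. share_wf p l l' Share \<and> real l' \<le> real (l + mu) + g (l + mu) \<and>
      perfectly_correct p t l Share Rec \<and> perfectly_private p t l Share \<and>
      ((real (l + mu) / real p) powr (1/3) \<ge> x0 \<longrightarrow> leakage_resilient p t k mu l Share
          (real p * 2 powr (- (1/4 * (real (l + mu) / real p) powr (1/3)))))"
    if k: "k < t" and tp: "t + k \<le> p" and pl: "p \<le> l" for mu k t p l :: nat
  proof -
    define n where "n = l + mu"
    have n1: "n \<ge> 1" and pn: "p \<le> n" and p1: "p \<ge> 1" using k tp pl unfolding n_def by auto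
    define h where "h = nat \<lceil>real n powr (1/6)\<rceil>"
    have hge: "real n powr (1/6) \<le> h" unfolding h_def by linarith
    have hle: "h \<le> real n powr (1/6) + 1" unfolding h_def using powr_ge_zero[of "real n" "1/6"] by linarith
    have r1: "1 \<le> real n powr (1/6)" using n1 by (intro ge_one_powr_ge_zero) auto
    then have h1: "h \<ge> 1" using hge by linarith
    have n6: "real n \<le> real h ^ 6"
    proof -
      have "real n = (real n powr (1/6)) ^ 6" using n1 by (simp add: powr_power)
      also have "\<dots> \<le> real h ^ 6" by (rule power_mono[OF hge]) simp
      finally show ?thesis .
    qed
    \<comment> \<open>\<open>b\<close> is at least n^(1/3) and sets the security exponent. With
      \<open>q\<close> = 2 h^3 the ratio of 2 b rows to \<open>q\<close> is 1/h, which keeps the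
      overlap factor below 1 + 2/h and the seed length 2 b q = 4 h^5 of order n^(5/6).\<close>
    define b where "b = h ^ 2"
    define q where "q = 2 * h ^ 3"
    \<comment> \<open>An integer bound for l (1 + 2/h); the final 1 pays for the rounding in
      \<open>div\<close>.\<close>
    define E where "E = l + 2 * l div h + 1"
    define nw where "nw = E + mu + b"
    define ns where "ns = 2 * b * q"
    define eps where "eps = 3 * (l * sqrt (2 * (1 + nw) / 2 ^ b))"
    have bq: "b > 0" "q > 0" unfolding b_def q_def using h1 by auto
    have lh: "real l * (2 / h) \<le> 2 * l div h + 1"
    proof -
      have "h * (2 * l div h) + 2 * l mod h = 2 * l" by (rule mult_div_mod_eq)
      moreover have "2 * l mod h < h" using h1 by simp
      ultimately have "2 * l \<le> h * (2 * l div h) + h" by linarith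
      then have "2 * l \<le> h * (2 * l div h + 1)" by (simp only: distrib_left mult_1_right)
      then have "real (2 * l) \<le> real (h * (2 * l div h + 1))" by (rule of_nat_mono)
      then have "2 * real l \<le> h * real (2 * l div h + 1)" by (simp only: of_nat_mult of_nat_numeral)
      moreover have "0 < real h" using h1 by simp
      ultimately have "2 * real l / h \<le> real (2 * l div h + 1)"
        by (simp only: pos_divide_le_eq mult.commute[of "real h"])
      then show ?thesis by (simp add: mult.commute)
    qed
    have El: "l \<le> E" unfolding E_def by simp
    have E: "real i * (1 + 1 / q) ^ (2 * b) \<le> E" if "i < l" for i
    proof -
      have "real i * (1 + 1 / q) ^ (2 * b) \<le> real l * (1 + 2 / h)"
        unfolding b_def q_def using that power_one_plus_inverse_le[OF h1] by (intro mult_mono) auto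
      also have "\<dots> \<le> E" using lh unfolding E_def by (simp add: distrib_left)
      finally show ?thesis .
    qed
    have "\<exists>f. (\<forall>s. (\<forall>w\<in>words nw. f s w \<in> words l) \<and> (\<forall>y\<in>words l. card {w\<in>words nw. f s w = y} = 2 ^ (nw - l)))
        \<and> secure (2 ^ mu) (words ns) (words nw) (words l) f eps"
      unfolding ns_def eps_def by (rule extractor_exists[OF bq E nw_def El])
    then obtain f where f0: "\<forall>s. (\<forall>w\<in>words nw. f s w \<in> words l) \<and> (\<forall>y\<in>words l. card {w\<in>words nw. f s w = y} = 2 ^ (nw - l))"
      and sec: "secure (2 ^ mu) (words ns) (words nw) (words l) f eps" by (elim exE conjE) (rule that)
    have f: "f s w \<in> words l" if "w \<in> words nw" for s w using f0 that by blast
    have fibres: "card {w\<in>words nw. f s w = y} = 2 ^ (nw - l)" if "y \<in> words l" for s y using f0 that by blast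
    have pl2: "p < 2 ^ l" using pl less_exp[of l] by linarith
    have pns: "p < 2 ^ ns"
    proof -
      have "h ^ 3 < 2 ^ (h ^ 3)" by (rule less_exp)
      then have "(h ^ 3)\<^sup>2 < (2 ^ (h ^ 3))\<^sup>2" by (intro power_strict_mono) auto
      then have "h ^ 6 < 2 ^ (2 * h ^ 3)" by (simp add: power_mult[symmetric] mult.commute)
      also have "(2::nat) ^ (2 * h ^ 3) \<le> 2 ^ ns"
      proof -
        have "2 * h ^ 3 \<le> 4 * h ^ 5" using power_increasing[of 3 5 h] h1 by simp
        then have "2 * h ^ 3 \<le> 2 * b * q" unfolding q_def b_def by (simp add: power_add[symmetric])
        then show ?thesis unfolding ns_def by (intro power_increasing) auto
      qed
      finally have "h ^ 6 < 2 ^ ns" .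
      moreover have "n \<le> h ^ 6" using n6 by (simp only: of_nat_power[symmetric] of_nat_le_iff)
      ultimately show ?thesis using pn by linarith
    qed
    obtain CM where CM: "mds p t (words l) CM"
      using mds_exists[OF words_card, of p l t] pl2 p1 pl by auto
    obtain CS where CS: "mds p t (words ns) CS"
      using mds_exists[OF words_card, of p ns t] pns bq unfolding ns_def by auto
    have nwl: "(2::nat) ^ nw = 2 ^ (nw - l) * 2 ^ l" unfolding power_add[symmetric] nw_def E_def by simp
    interpret scheme p t l nw ns "2 ^ (nw - l)" f CM CS
      by unfold_locales (use k tp CM CS f fibres nwl in auto)
    have hn: "real n / h \<le> real n powr (5/6)"
    proof -
      have "real n = real n powr (5/6) * real n powr (1/6)" using n1 by (simp flip: powr_add)
      also have "\<dots> \<le> real n powr (5/6) * h" by (intro mult_left_mono hge) simp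
      finally show ?thesis using h1 by (simp add: divide_le_eq)
    qed
    have div: "real (2 * l div h) \<le> 2 * (real n / h)"
    proof -
      have "real (2 * l div h) \<le> real (2 * l) / h" by (rule of_nat_div_le_of_nat)
      also have "\<dots> \<le> real (2 * n) / h" unfolding n_def by (intro divide_right_mono) auto
      finally show ?thesis by simp
    qed
    have len: "real (nw + ns) \<le> real (l + mu) + g (l + mu)"
    proof -
      have "real (nw + ns) = real n + (real (2 * l div h) + 1 + real h ^ 2 + 4 * real h ^ 5)"
        unfolding nw_def ns_def E_def n_def b_def q_def by (simp add: power_add[symmetric])
      also have "\<dots> \<le> real n + g n"
        unfolding g_def using div hn hle by (intro add_mono mult_left_mono power_mono) auto
      finally show ?thesis unfolding n_def .
    qed
    have res: "leakage_resilient p t k mu l Share (real p * 2 powr (- (1/4 * (real n / real p) powr (1/3))))"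
      if x: "(real n / real p) powr (1/3) \<ge> x0"
    proof -
      let ?x = "(real n / real p) powr (1/3)"
      have "?x \<le> real n powr (1/3)" using p1 n1 by (intro powr_mono2) (auto simp: divide_le_eq)
      also have "\<dots> = (real n powr (1/6))\<^sup>2" using n1 by (simp add: powr_power)
      also have "\<dots> \<le> real h ^ 2" by (rule power_mono[OF hge]) simp
      finally have xh: "?x \<le> real h ^ 2" .
      moreover have "real h0 ^ 2 \<le> x0" unfolding x0_def by simp
      ultimately have "real h0 ^ 2 \<le> real h ^ 2" using x by linarith
      then have "h0 \<le> h" using power2_le_imp_le[of "real h0" "real h"] by simp
      note asy = h0[OF this]
      have hpow: "1 \<le> real h ^ 6" "real h ^ 2 \<le> real h ^ 6" using h1 by (auto intro: power_increasing)
      have "real n / h \<le> real n" using h1 mult_left_mono[of 1 "real h" "real n"] by (simp add: divide_le_eq)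
      moreover have "real nw = real n + real (2 * l div h) + 1 + real h ^ 2"
        unfolding nw_def E_def n_def b_def by simp
      ultimately have "real nw \<le> real n + 2 * real n + 1 + real h ^ 2" using div by linarith
      then have nwle: "1 + real nw \<le> 6 * real h ^ 6" using n6 hpow by linarith
      have "eps = 3 * real l * sqrt (2 * (1 + nw)) / sqrt (2 ^ b)"
        unfolding eps_def by (simp add: real_sqrt_divide)
      also have "\<dots> \<le> 3 * real h ^ 6 * sqrt (12 * real h ^ 6) / sqrt (2 ^ b)"
      proof (intro divide_right_mono mult_mono)
        have "real l \<le> real n" unfolding n_def by simp
        then show "real l \<le> real h ^ 6" using n6 by linarith
        show "sqrt (2 * (1 + nw)) \<le> sqrt (12 * real h ^ 6)" using nwle by simp
      qed auto
      also have "\<dots> \<le> 2 powr (real h ^ 2 / 4) / sqrt (2 ^ b)"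
        by (rule divide_right_mono[OF asy]) simp
      also have "sqrt (2 ^ b) = 2 powr (real h ^ 2 / 2)"
      proof (rule real_sqrt_unique)
        have "(2 powr (real h ^ 2 / 2))\<^sup>2 = 2 powr (real b)" by (simp add: powr_power b_def)
        then show "(2 powr (real h ^ 2 / 2))\<^sup>2 = 2 ^ b" by (simp add: powr_realpow)
      qed simp
      also have "2 powr (real h ^ 2 / 4) / 2 powr (real h ^ 2 / 2) = 2 powr (- (real h ^ 2 / 4))"
        by (simp add: powr_diff[symmetric])
      also have "\<dots> \<le> 2 powr (- (1/4 * ?x))" using xh by (intro powr_mono) auto
      finally have eps: "eps \<le> 2 powr (- (1/4 * ?x))" .
      have "real t * eps \<le> real p * 2 powr (- (1/4 * ?x))"
        using eps tp by (intro mult_mono) (auto simp: eps_def)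
      moreover have "leakage_resilient p t k mu l Share (t * eps)"
        by (rule Share_resilient[OF sec _ k]) (simp add: eps_def)
      ultimately show ?thesis by (rule leakage_resilient_mono)
    qed
    show ?thesis
      using Share_wf len Share_correct Share_private res unfolding n_def
      by (intro exI[of _ "nw + ns"] exI[of _ Share] exI[of _ Rec] conjI impI)
  qed
  \<comment> \<open>In \<open>powr\<close> the base 0 gives 0 even for exponent 0, so 1 + ln x must
    be known to be nonzero.\<close>
  have powr0: "(1 + ln x) powr 0 = 1" if "x \<ge> x0" for x
  proof -
    have "x \<ge> 1" using that unfolding x0_def by simp
    then have "ln x \<ge> 0" by (rule ln_ge_zero)
    then show ?thesis by simp
  qed
  show ?thesis
  \<comment> \<open>The constant 1/4 is half of the exponent h^2 / 2 left after absorbing polynomial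
    factors; choosing \<open>C\<close> = 0 means that no logarithmic factor is lost.\<close>
  proof (rule exI[of _ g], rule exI[of _ "1/4"], rule exI[of _ 0], rule exI[of _ x0], intro conjI allI impI)
    show "g \<in> o(\<lambda>n. real n)" unfolding g_def by (rule overhead_smallo)
    show "x0 \<ge> 1" unfolding x0_def by simp
    fix mu k t p l :: nat
    assume "k < t" "t + k \<le> p" "p \<le> l"
    from main[OF this, of mu] show "\<exists>(l' :: nat) Share Rec.
           share_wf p l l' Share \<and>
           real l' \<le> real (l + mu) + g (l + mu) \<and>
           perfectly_correct p t l Share Rec \<and>
           perfectly_private p t l Share \<and>
           (let x = (real (l + mu) / real p) powr (1/3) in
              x \<ge> x0 \<longrightarrow>
              leakage_resilient p t k mu l Share
                (real p * 2 powr (- (1/4 * x / (1 + ln x) powr 0))))"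
    proof (elim exE conjE, goal_cases)
      case (1 l' Share Rec)
      show ?case unfolding Let_def
      proof (intro exI[of _ l'] exI[of _ Share] exI[of _ Rec] conjI impI)
        assume x: "x0 \<le> (real (l + mu) / real p) powr (1/3)"
        then show "leakage_resilient p t k mu l Share
            (real p * 2 powr (- (1/4 * (real (l + mu) / real p) powr (1/3) / (1 + ln ((real (l + mu) / real p) powr (1/3))) powr 0)))"
          unfolding powr0[OF x] div_by_1 by (rule mp[OF 1(5)])
      qed (fact 1)+
    qed
  qed auto
qed

end
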